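(* Let $G$ be a Gromov-hyperbolic group with Cayley graph $\Gamma=\Gamma(G,S)$, and let $\rho$ satisfy (i)–(iii) of the context. For each $\xi\in\partial G$ and each vertex $o\in\Gamma$, for $\mathbb{P}$-a.e. $\omega\in\Omega$ there exists a unique $\omega$-geodesic ray (denoted $[o,\xi)_\omega$) starting from $o$ in direction $\xi$.
   Context: $G$ is a finitely generated (Gromov-)hyperbolic group, $S$ a finite symmetric generating set, $\Gamma=\Gamma(G,S)$ the undirected Cayley graph (vertex set $G$; an edge between $g$ and $h$ iff $g^{-1}h\in S$) with edge set $E$, and $\partial G$ is the Gromov boundary. First passage percolation: $\rho$ is a probability measure such that (i) its support is contained in $[0,\infty)$; (ii) it has no atoms; (iii) $\int e^{ax^2}\,d\rho(x)<\infty$ for some $a>0$. $\Omega=[0,\infty)^E$ carries $\mathbb{P}=\rho^{\otimes E}$. For an edge path $\gamma$, $\ell_\omega(\gamma)=\sum_{e\in\gamma}\omega(e)$, and $d_\omega(x,y)=\inf_\gamma\ell_\omega(\gamma)$ over edge paths from $x$ to $y$. An $\omega$-geodesic between $x$ and $y$ is a path attaining $d_\omega(x,y)$. An $\omega$-geodesic ray is a semi-infinite path all of whose finite subpaths are $\omega$-geodesics; it has direction $\xi\in\partial G$ if $\xi$ is its only accumulation point in $\partial G$ (equivalently, its vertices converge to $\xi$ in the Gromov compactification $\Gamma\cup\partial G$). *)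

theory Defs
  imports "HOL-Algebra.Generated_Groups" "HOL-Probability.Probability"
begin

section \<open>Cayley graphs and edge paths\<close>

text \<open>
  Undirected edges are unordered pairs of vertices. There are no multiple edges, so that a path is
  determined by the sequence of its vertices. If the generating set contains the identity, every
  vertex \<open>g\<close> carries a loop, namely the edge \<open>{g}\<close>.
\<close>

definition cayley_edges :: "('a, 'b) monoid_scheme \<Rightarrow> 'a set \<Rightarrow> 'a set set" where
  "cayley_edges G S =
     {{g, h} | g h. g \<in> carrier G \<and> h \<in> carrier G \<and> inv\<^bsub>G\<^esub> g \<otimes>\<^bsub>G\<^esub> h \<in> S}"

definition edge_path :: "'a set set \<Rightarrow> 'a \<Rightarrow> 'a \<Rightarrow> 'a list \<Rightarrow> bool" where
  "edge_path E x y p \<longleftrightarrow>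
     p \<noteq> [] \<and> hd p = x \<and> last p = y \<and> (\<forall>i. Suc i < length p \<longrightarrow> {p ! i, p ! Suc i} \<in> E)"

definition graph_dist :: "'a set set \<Rightarrow> 'a \<Rightarrow> 'a \<Rightarrow> nat" where
  "graph_dist E x y = (LEAST n. \<exists>p. edge_path E x y p \<and> length p = Suc n)"


section \<open>Gromov hyperbolicity and the Gromov boundary\<close>

definition gromov_product :: "'a set set \<Rightarrow> 'a \<Rightarrow> 'a \<Rightarrow> 'a \<Rightarrow> real" where
  "gromov_product E w x y =
     (real (graph_dist E x w) + real (graph_dist E y w) - real (graph_dist E x y)) / 2"

definition gromov_hyperbolic :: "'a set \<Rightarrow> 'a set set \<Rightarrow> bool" where
  "gromov_hyperbolic V E \<longleftrightarrow>
     (\<exists>\<delta>\<ge>0. \<forall>w\<in>V. \<forall>x\<in>V. \<forall>y\<in>V. \<forall>z\<in>V.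
        gromov_product E w x z \<ge>
          min (gromov_product E w x y) (gromov_product E w y z) - \<delta>)"

text \<open>
  The boundary is the set of equivalence classes of vertex sequences converging at infinity.
  Nothing below depends on the choice of the base point \<open>w\<close> in the Gromov products.
\<close>

definition gromov_sequences :: "'a set \<Rightarrow> 'a set set \<Rightarrow> 'a \<Rightarrow> (nat \<Rightarrow> 'a) set" where
  "gromov_sequences V E w =
     {x. (\<forall>n. x n \<in> V) \<and>
         filterlim (\<lambda>(i, j). gromov_product E w (x i) (x j)) at_top
           (sequentially \<times>\<^sub>F sequentially)}"

definition gromov_rel :: "'a set \<Rightarrow> 'a set set \<Rightarrow> 'a \<Rightarrow> ((nat \<Rightarrow> 'a) \<times> (nat \<Rightarrow> 'a)) set" where
  "gromov_rel V E w =
     {(x, y). x \<in> gromov_sequences V E w \<and> y \<in> gromov_sequences V E w \<and>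
        filterlim (\<lambda>(i, j). gromov_product E w (x i) (y j)) at_top
          (sequentially \<times>\<^sub>F sequentially)}"

definition gromov_boundary :: "'a set \<Rightarrow> 'a set set \<Rightarrow> 'a \<Rightarrow> (nat \<Rightarrow> 'a) set set" where
  "gromov_boundary V E w = gromov_sequences V E w // gromov_rel V E w"

text \<open>
  A sequence of vertices converges to a boundary point \<open>\<eta>\<close> in the Gromov compactification iff
  it is a member of the equivalence class \<open>\<eta>\<close>. Accumulation points are limits of subsequences.
\<close>

definition accumulates_at :: "(nat \<Rightarrow> 'a) \<Rightarrow> (nat \<Rightarrow> 'a) set \<Rightarrow> bool" where
  "accumulates_at x \<eta> \<longleftrightarrow> (\<exists>r. strict_mono r \<and> x \<circ> r \<in> \<eta>)"

definition has_direction ::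
    "'a set \<Rightarrow> 'a set set \<Rightarrow> 'a \<Rightarrow> (nat \<Rightarrow> 'a) \<Rightarrow> (nat \<Rightarrow> 'a) set \<Rightarrow> bool" where
  "has_direction V E w x \<xi> \<longleftrightarrow> {\<eta> \<in> gromov_boundary V E w. accumulates_at x \<eta>} = {\<xi>}"


section \<open>First passage percolation\<close>

definition measure_support :: "'a::topological_space measure \<Rightarrow> 'a set" where
  "measure_support M = {x. \<forall>U. open U \<and> x \<in> U \<longrightarrow> emeasure M U > 0}"

text \<open>
  The weight distribution is a Borel measure on the whole real line whose support lies in
  \<open>[0, \<infinity>)\<close>; restricting it makes the sample space equal to \<open>[0, \<infinity>)\<close> to the power \<open>E\<close>.
\<close>

definition fpp_measure :: "real measure \<Rightarrow> 'a set set \<Rightarrow> ('a set \<Rightarrow> real) measure" where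
  "fpp_measure \<rho> E = Pi\<^sub>M E (\<lambda>_. restrict_space \<rho> {0..})"

definition path_weight :: "('a set \<Rightarrow> real) \<Rightarrow> 'a list \<Rightarrow> real" where
  "path_weight \<omega> p = (\<Sum>i<length p - 1. \<omega> {p ! i, p ! Suc i})"

definition fpp_dist :: "'a set set \<Rightarrow> ('a set \<Rightarrow> real) \<Rightarrow> 'a \<Rightarrow> 'a \<Rightarrow> real" where
  "fpp_dist E \<omega> x y = (INF p\<in>{p. edge_path E x y p}. path_weight \<omega> p)"

definition fpp_geodesic :: "'a set set \<Rightarrow> ('a set \<Rightarrow> real) \<Rightarrow> 'a \<Rightarrow> 'a \<Rightarrow> 'a list \<Rightarrow> bool" where
  "fpp_geodesic E \<omega> x y p \<longleftrightarrow> edge_path E x y p \<and> path_weight \<omega> p = fpp_dist E \<omega> x y"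

definition fpp_geodesic_ray :: "'a set set \<Rightarrow> ('a set \<Rightarrow> real) \<Rightarrow> (nat \<Rightarrow> 'a) \<Rightarrow> bool" where
  "fpp_geodesic_ray E \<omega> x \<longleftrightarrow>
     (\<forall>i j. i \<le> j \<longrightarrow> fpp_geodesic E \<omega> (x i) (x j) (map x [i..<Suc j]))"

end

theory Submission
  imports Defs
begin

text \<open>
  Fix a word geodesic ray \<open>c\<close> from \<open>v\<close> to \<open>\<xi>\<close>. Call \<open>k\<close> a bottleneck if every \<open>\<omega>\<close>-geodesic
  between a point well behind \<open>c k\<close> and a point well ahead of \<open>c k\<close> (as measured by
  Gromov products) passes through \<open>c k\<close>. Since finite \<open>\<omega>\<close>-geodesics are almost surely unique (no
  atoms), infinitely many bottlenecks force existence, uniqueness and convergence to \<open>\<xi>\<close> of the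
  geodesic ray.

  Bottlenecks come from a local configuration of positive probability: the edges of \<open>c\<close> within
  distance \<open>L\<close> of \<open>c k\<close> are cheaper than \<open>a\<close>, while all other edges of a large ball around \<open>c k\<close> have
  weights in \<open>[b, M]\<close> with \<open>a < b\<close>. Provided that at all scales around the two ends of this
  corridor the passage times outside the ball are comparable to word length, \<open>\<omega>\<close>-geodesics
  crossing the region are quasi-geodesics there, hence come close to both ends by the Morse property
  and must then follow the corridor. The comparability is an exponential Chebyshev estimate with a
  union bound over paths; it is independent of the configuration inside the ball, and up to scale \<open>j\<close>
  it is a local event. Along a sparse sequence of \<open>k\<close> the local events are independent, so the
  zero-one law yields infinitely many of them, and Borel--Cantelli takes care of the scales beyond \<open>j\<close>.
\<close>

section \<open>Edge paths and the graph metric\<close>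

text \<open>The obstacle: weights may be close to 0 or very large, so
  \<open>\<omega>\<close>-geodesics need not be quasi-geodesics with uniform constants. Control is
  therefore asked for only as seen from one point \<open>z\<close>: an excursion away from a word
  geodesic is measured against a scale \<open>s\<close> that bounds its distance from
  \<open>z\<close> as well as the distance between its ends. This still forces the path near
  \<open>z\<close>, because the projection of an excursion advances by only a small multiple of its
  length. The corridor has edges that may be too light for the lower bounds; excursions cannot use
  them, as they stay farther from the word geodesic than the corridor does. The constants come in
  the order \<open>a\<close>, \<open>b\<close>, \<open>M\<close> (levels), \<open>m\<close>,
  \<open>T\<close>, \<open>\<epsilon>\<close> (moments), \<open>C\<close>, \<open>r\<close>,
  \<open>D\<close> (Morse), then \<open>L\<close> so long that the corridor repays the cost of
  reaching it, then \<open>R\<close> so large that leaving the ball costs more still. Bottlenecks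
  concern arbitrary pairs of points, not only geodesics from the origin, because the direction of
  the ray is controlled by applying them to its tails.\<close>

abbreviation seg :: "(nat \<Rightarrow> 'a) \<Rightarrow> nat \<Rightarrow> nat \<Rightarrow> 'a list" where
  "seg x i j \<equiv> map x [i..<Suc j]"

text \<open>Keeps \<open>[i..<Suc j]\<close> folded, so that rules about \<open>seg\<close> still
  match.\<close>

declare upt_Suc [simp del]

lemma nth_seg: "t \<le> j - i \<Longrightarrow> i \<le> j \<Longrightarrow> seg x i j ! t = x (i + t)"
  by (auto)

lemma hd_last_seg: "i \<le> j \<Longrightarrow> hd (seg x i j) = x i \<and> last (seg x i j) = x j"
  by (simp add: hd_map last_map)

lemma edge_path_seg:
  assumes "i \<le> j"
  shows "edge_path E a b (seg x i j) \<longleftrightarrow>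
    a = x i \<and> b = x j \<and> (\<forall>t. i \<le> t \<and> t < j \<longrightarrow> {x t, x (Suc t)} \<in> E)"
proof -
  have "(\<forall>t. Suc t < length (seg x i j) \<longrightarrow> {seg x i j ! t, seg x i j ! Suc t} \<in> E) \<longleftrightarrow>
     (\<forall>t. i \<le> t \<and> t < j \<longrightarrow> {x t, x (Suc t)} \<in> E)" (is "?A \<longleftrightarrow> ?B")
  proof
    assume A: ?A
    show ?B
    proof (intro allI impI)
      fix t assume t: "i \<le> t \<and> t < j"
      then have "t - i < j - i" by linarith
      with A[rule_format, of "t - i"] t show "{x t, x (Suc t)} \<in> E"
        by (simp add: nth_seg Suc_diff_le)
    qed
  next
    assume B: ?B
    show ?A
    proof (intro allI impI)
      fix t assume t: "Suc t < length (seg x i j)"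
      with B[rule_format, of "i + t"] assms show "{seg x i j ! t, seg x i j ! Suc t} \<in> E"
        by (simp add: nth_seg)
    qed
  qed
  with hd_last_seg[OF assms, of x] assms show ?thesis
    unfolding edge_path_def by (auto)
qed

lemma path_weight_seg:
  "path_weight \<omega> (seg x i j) = (\<Sum>t\<in>{i..<j}. \<omega> {x t, x (Suc t)})"
proof (cases "i \<le> j")
  case True
  have "path_weight \<omega> (seg x i j) = (\<Sum>t<j - i. \<omega> {x (i + t), x (Suc (i + t))})"
    unfolding path_weight_def using True
    by (intro sum.cong) (auto simp: nth_seg)
  also have "\<dots> = (\<Sum>t\<in>{i..<j}. \<omega> {x t, x (Suc t)})"
    using True by (intro sum.reindex_bij_witness[of _ "\<lambda>t. t - i" "\<lambda>t. i + t"]) auto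
  finally show ?thesis .
qed (simp add: path_weight_def)

lemma seg_nth: "p \<noteq> [] \<Longrightarrow> seg (nth p) 0 (length p - 1) = p"
  by (rule nth_equalityI) (auto)

lemma edge_pathD:
  assumes "edge_path E x y p"
  shows "p \<noteq> []" "p ! 0 = x" "p ! (length p - 1) = y" "seg (nth p) 0 (length p - 1) = p"
    "\<And>t. Suc t < length p \<Longrightarrow> {p ! t, p ! Suc t} \<in> E"
  using assms seg_nth[of p] unfolding edge_path_def by (auto simp: hd_conv_nth last_conv_nth)

text \<open>Turns a list path into a function on indices, the form in which subpaths are cut and
  compared with rays.\<close>

lemma edge_path_as_seg:
  assumes "edge_path E a b p"
  obtains x n where "p = seg x 0 n" "x 0 = a" "x n = b" "length p = Suc n"
    "\<And>t. t < n \<Longrightarrow> {x t, x (Suc t)} \<in> E"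
  using that[of "nth p" "length p - 1"] edge_pathD[OF assms] by auto

lemma edge_path_Nil [simp]: "edge_path E x y [] \<longleftrightarrow> False"
  by (simp add: edge_path_def)

lemma edge_path_single [simp]: "edge_path E x y [z] \<longleftrightarrow> x = z \<and> y = z"
  by (auto simp: edge_path_def)

lemma edge_path_Cons [simp]:
  "edge_path E x y (z # w # p) \<longleftrightarrow> x = z \<and> {z, w} \<in> E \<and> edge_path E w y (w # p)"
proof -
  have "(\<forall>i. Suc i < length (z # w # p) \<longrightarrow> {(z # w # p) ! i, (z # w # p) ! Suc i} \<in> E) \<longleftrightarrow>
    {z, w} \<in> E \<and> (\<forall>i. Suc i < length (w # p) \<longrightarrow> {(w # p) ! i, (w # p) ! Suc i} \<in> E)" (is "?A \<longleftrightarrow> ?B")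
  proof
    assume A: ?A
    show ?B using A[rule_format, of 0] A[rule_format, of "Suc i" for i] by simp
  next
    assume B: ?B
    show ?A
    proof (intro allI impI)
      fix i assume "Suc i < length (z # w # p)"
      then show "{(z # w # p) ! i, (z # w # p) ! Suc i} \<in> E" using B by (cases i) auto
    qed
  qed
  then show ?thesis unfolding edge_path_def by auto
qed

lemma path_weight_Cons [simp]:
  "path_weight \<omega> (z # w # p) = \<omega> {z, w} + path_weight \<omega> (w # p)"
  "path_weight \<omega> [z] = 0" "path_weight \<omega> [] = 0"
  by (simp_all add: path_weight_def sum.lessThan_Suc_shift del: sum.lessThan_Suc)

text \<open>\<open>tl q\<close> drops the junction vertex, which both paths contain.\<close>

lemma edge_path_append:
  "edge_path E x y p \<Longrightarrow> edge_path E y z q \<Longrightarrow> edge_path E x z (p @ tl q)"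
proof (induction p arbitrary: x)
  case (Cons a p)
  show ?case
  proof (cases p)
    case Nil
    with Cons.prems show ?thesis by (cases q) (auto simp: edge_path_def)
  next
    case (Cons b p')
    with Cons.prems Cons.IH show ?thesis by auto
  qed
qed simp

lemma path_weight_append:
  "edge_path E x y p \<Longrightarrow> edge_path E y z q \<Longrightarrow>
    path_weight \<omega> (p @ tl q) = path_weight \<omega> p + path_weight \<omega> q"
proof (induction p arbitrary: x)
  case (Cons a p)
  show ?case
  proof (cases p)
    case Nil
    with Cons.prems show ?thesis by (cases q) (auto simp: edge_path_def)
  next
    case (Cons b p')
    with Cons.prems Cons.IH show ?thesis by auto
  qed
qed simp

lemma edge_path_rev: "edge_path E x y p \<Longrightarrow> edge_path E y x (rev p)"
proof (induction p arbitrary: x)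
  case (Cons a p)
  show ?case
  proof (cases p)
    case Nil
    with Cons.prems show ?thesis by simp
  next
    case (Cons b p')
    with Cons.prems have *: "{b, a} \<in> E" "edge_path E b y p" "x = a" by (auto simp: insert_commute)
    have "edge_path E y a (rev p @ tl [b, a])"
      by (rule edge_path_append[OF Cons.IH[OF *(2)]]) (use * in auto)
    with * show ?thesis by simp
  qed
qed simp

lemma path_weight_rev: "edge_path E x y p \<Longrightarrow> path_weight \<omega> (rev p) = path_weight \<omega> p"
proof (induction p arbitrary: x)
  case (Cons a p)
  show ?case
  proof (cases p)
    case Nil
    with Cons.prems show ?thesis by simp
  next
    case (Cons b p')
    with Cons.prems have *: "{b, a} \<in> E" "edge_path E b y p" "x = a" by (auto simp: insert_commute)
    have "path_weight \<omega> (rev p @ tl [b, a]) = path_weight \<omega> (rev p) + path_weight \<omega> [b, a]"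
      by (rule path_weight_append[OF edge_path_rev[OF *(2)]]) (use * in auto)
    with * Cons.IH[OF *(2)] Cons show ?thesis by (simp add: insert_commute)
  qed
qed simp

section \<open>Connected graphs of bounded degree: metric, geodesics, path counting\<close>

locale bounded_graph =
  fixes V :: "'a set" and E :: "'a set set" and \<Delta> :: nat
  assumes edge_in: "\<And>x y. {x, y} \<in> E \<Longrightarrow> x \<in> V \<and> y \<in> V"
    and edge_pair: "\<And>e. e \<in> E \<Longrightarrow> \<exists>x y. e = {x, y}"
    and degree: "\<And>x. x \<in> V \<Longrightarrow> finite {y. {x, y} \<in> E} \<and> card {y. {x, y} \<in> E} \<le> \<Delta>"
    and connected: "\<And>x y. x \<in> V \<Longrightarrow> y \<in> V \<Longrightarrow> \<exists>p. edge_path E x y p"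
begin

abbreviation gd :: "'a \<Rightarrow> 'a \<Rightarrow> nat" where "gd \<equiv> graph_dist E"

lemma edge_path_in: "edge_path E x y p \<Longrightarrow> x \<in> V \<Longrightarrow> set p \<subseteq> V"
proof (induction p arbitrary: x)
  case (Cons a p)
  show ?case
  proof (cases p)
    case (Cons b p')
    with Cons.prems Cons.IH edge_in show ?thesis by auto
  qed (use Cons.prems in auto)
qed simp

lemma gd_path:
  assumes "x \<in> V" "y \<in> V"
  shows "\<exists>p. edge_path E x y p \<and> length p = Suc (gd x y)"
proof -
  obtain p where "edge_path E x y p" using connected assms by blast
  then have "\<exists>n p. edge_path E x y p \<and> length p = Suc n"
    by (intro exI[of _ "length p - 1"] exI[of _ p]) (cases p, auto)
  then show ?thesis unfolding graph_dist_def by (rule LeastI_ex)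
qed

lemma gd_le: "edge_path E x y p \<Longrightarrow> gd x y \<le> length p - 1"
  unfolding graph_dist_def by (rule Least_le) (cases p, auto)

lemma gd_refl [simp]: "gd x x = 0"
  using gd_le[of x x "[x]"] by simp

lemma gd_eq_0: "x \<in> V \<Longrightarrow> y \<in> V \<Longrightarrow> gd x y = 0 \<Longrightarrow> x = y"
  using gd_path[of x y] by (auto simp: length_Suc_conv)

lemma gd_sym_le: assumes "x \<in> V" "y \<in> V" shows "gd x y \<le> gd y x"
proof -
  obtain p where p: "edge_path E y x p" "length p = Suc (gd y x)" using gd_path[OF assms(2,1)] by auto
  show ?thesis using gd_le[OF edge_path_rev[OF p(1)]] p(2) by simp
qed

lemma gd_sym: "x \<in> V \<Longrightarrow> y \<in> V \<Longrightarrow> gd x y = gd y x"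
  by (intro antisym gd_sym_le)

lemma gd_tri: assumes "x \<in> V" "y \<in> V" "z \<in> V" shows "gd x z \<le> gd x y + gd y z"
proof -
  obtain p q where p: "edge_path E x y p" "length p = Suc (gd x y)"
    and q: "edge_path E y z q" "length q = Suc (gd y z)" using gd_path assms by meson
  show ?thesis using gd_le[OF edge_path_append[OF p(1) q(1)]] p(2) q(2) by simp
qed

lemma gd_edge: "{x, y} \<in> E \<Longrightarrow> gd x y \<le> 1"
  using gd_le[of x y "[x, y]"] by simp

lemma seg_in:
  assumes "\<And>t. i \<le> t \<Longrightarrow> t < j \<Longrightarrow> {x t, x (Suc t)} \<in> E" "x i \<in> V" "i \<le> t" "t \<le> j"
  shows "x t \<in> V"
  using assms(3,4)
proof (induction t rule: dec_induct)
  case (step n)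
  then show ?case using assms(1)[of n] edge_in by auto
qed (use assms in auto)

lemma seg_lipschitz:
  assumes "\<And>t. i \<le> t \<Longrightarrow> t < j \<Longrightarrow> {x t, x (Suc t)} \<in> E" "i \<le> j"
  shows "gd (x i) (x j) \<le> j - i"
proof -
  have "edge_path E (x i) (x j) (seg x i j)" using assms by (simp only: edge_path_seg) auto
  from gd_le[OF this] show ?thesis using assms(2) by simp
qed

definition word_geodesic :: "(nat \<Rightarrow> 'a) \<Rightarrow> nat \<Rightarrow> bool" where
  "word_geodesic g n \<longleftrightarrow> (\<forall>i\<le>n. g i \<in> V) \<and> (\<forall>i<n. {g i, g (Suc i)} \<in> E) \<and>
     (\<forall>i j. i \<le> j \<longrightarrow> j \<le> n \<longrightarrow> gd (g i) (g j) = j - i)"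

text \<open>A subpath whose ends are closer than its length would, by the triangle inequality, bring
  the two outer ends closer than \<open>n\<close>; so only these need checking.\<close>

lemma word_geodesicI:
  assumes "g 0 \<in> V" "\<And>i. i < n \<Longrightarrow> {g i, g (Suc i)} \<in> E" "gd (g 0) (g n) \<ge> n"
  shows "word_geodesic g n"
proof -
  have V: "g i \<in> V" if "i \<le> n" for i
    by (rule seg_in[of 0 n g]) (use assms that in auto)
  have "gd (g i) (g j) = j - i" if ij: "i \<le> j" "j \<le> n" for i j
  proof -
    have 1: "gd (g i) (g j) \<le> j - i" "gd (g 0) (g i) \<le> i - 0" "gd (g j) (g n) \<le> n - j"
      by (rule seg_lipschitz; use assms that in auto)+
    have "gd (g 0) (g n) \<le> gd (g 0) (g i) + gd (g i) (g n)" "gd (g i) (g n) \<le> gd (g i) (g j) + gd (g j) (g n)"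
      by (rule gd_tri; use V that in auto)+
    with 1 assms(3) that show ?thesis by linarith
  qed
  with V assms(2) show ?thesis unfolding word_geodesic_def by auto
qed

lemma word_geodesic_ex:
  assumes "x \<in> V" "y \<in> V"
  shows "\<exists>g. word_geodesic g (gd x y) \<and> g 0 = x \<and> g (gd x y) = y"
proof -
  obtain p where p: "edge_path E x y p" "length p = Suc (gd x y)" using gd_path[OF assms] by auto
  have "word_geodesic (nth p) (gd x y)"
    by (rule word_geodesicI) (use edge_pathD[OF p(1)] p(2) assms in auto)
  with edge_pathD[OF p(1)] p(2) show ?thesis by (intro exI[of _ "nth p"]) auto
qed

lemma word_geodesicD:
  assumes "word_geodesic g n"
  shows "i \<le> n \<Longrightarrow> g i \<in> V" "i < n \<Longrightarrow> {g i, g (Suc i)} \<in> E"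
    "i \<le> j \<Longrightarrow> j \<le> n \<Longrightarrow> gd (g i) (g j) = j - i"
  using assms unfolding word_geodesic_def by auto

lemma word_geodesic_inj:
  assumes "word_geodesic g n" "i \<le> n" "j \<le> n" "g i = g j"
  shows "i = j"
proof (cases "i \<le> j")
  case True
  with word_geodesicD(3)[OF assms(1) True assms(3)] assms(4) show ?thesis by simp
next
  case False
  then have "j \<le> i" by simp
  from word_geodesicD(3)[OF assms(1) this assms(2)] assms(4) this show ?thesis by simp
qed

lemma word_geodesic_distinct: "word_geodesic g n \<Longrightarrow> distinct (seg g 0 n)"
  unfolding distinct_map using word_geodesic_inj[of g n] by (auto simp: inj_on_def)

definition paths_from :: "'a \<Rightarrow> nat \<Rightarrow> 'a list set" where
  "paths_from x n = {p. length p = Suc n \<and> (\<exists>y. edge_path E x y p)}"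

lemma paths_from_Suc:
  "paths_from x (Suc n) = (\<Union>y\<in>{y. {x, y} \<in> E}. (#) x ` paths_from y n)"
proof (intro Set.set_eqI iffI)
  fix p assume "p \<in> paths_from x (Suc n)"
  then obtain y where p: "length p = Suc (Suc n)" "edge_path E x y p" by (auto simp: paths_from_def)
  then obtain a b q where "p = a # b # q" by (auto simp: length_Suc_conv)
  with p have "{x, b} \<in> E" "b # q \<in> paths_from b n" "p = x # b # q"
    by (auto simp: paths_from_def)
  then show "p \<in> (\<Union>y\<in>{y. {x, y} \<in> E}. (#) x ` paths_from y n)" by auto
next
  fix p assume "p \<in> (\<Union>y\<in>{y. {x, y} \<in> E}. (#) x ` paths_from y n)"
  then obtain y q z where *: "{x, y} \<in> E" "p = x # q" "length q = Suc n" "edge_path E y z q"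
    by (auto simp: paths_from_def)
  then obtain q' where "q = y # q'" by (cases q) (auto simp: edge_path_def)
  with * show "p \<in> paths_from x (Suc n)" by (auto simp: paths_from_def)
qed

lemma paths_from_0: "paths_from x 0 = {[x]}"
  by (auto simp: paths_from_def length_Suc_conv)

lemma card_paths_from: "x \<in> V \<Longrightarrow> finite (paths_from x n) \<and> card (paths_from x n) \<le> \<Delta> ^ n"
proof (induction n arbitrary: x)
  case (Suc n)
  let ?N = "{y. {x, y} \<in> E}"
  have N: "finite ?N" "card ?N \<le> \<Delta>" using degree[OF Suc.prems] by auto
  have IH: "finite (paths_from y n) \<and> card (paths_from y n) \<le> \<Delta> ^ n" if "y \<in> ?N" for y
    using that Suc.IH edge_in by auto
  have "card (paths_from x (Suc n)) \<le> (\<Sum>y\<in>?N. card ((#) x ` paths_from y n))"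
    unfolding paths_from_Suc by (rule card_UN_le[OF N(1)])
  also have "\<dots> \<le> (\<Sum>y\<in>?N. \<Delta> ^ n)"
    by (rule sum_mono) (use IH card_image_le le_trans in blast)
  also have "\<dots> \<le> \<Delta> ^ Suc n" using N by simp
  finally show ?case unfolding paths_from_Suc using N IH by auto
qed (simp add: paths_from_0)

definition short_paths :: "'a \<Rightarrow> nat \<Rightarrow> 'a list set" where
  "short_paths x n = (\<Union>i\<le>n. paths_from x i)"

lemma short_pathsI: "edge_path E x y p \<Longrightarrow> length p \<le> Suc n \<Longrightarrow> p \<in> short_paths x n"
  unfolding short_paths_def paths_from_def
  by (cases p) auto

text \<open>Enlarging the base by one absorbs all shorter lengths, for every \<open>k\<close>
  including 0 and 1, so no geometric-series quotient appears.\<close>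

lemma sum_powers_le: "(\<Sum>i\<le>n. k ^ i) \<le> Suc k ^ n" for k n :: nat
proof (induction n)
  case (Suc n)
  have "(\<Sum>i\<le>Suc n. k ^ i) \<le> Suc k ^ n + k * k ^ n" using Suc by simp
  also have "\<dots> \<le> Suc k ^ n + k * Suc k ^ n"
    by (intro add_left_mono mult_left_mono power_mono) auto
  finally show ?case by simp
qed simp

lemma card_short_paths: 
  assumes "x \<in> V" 
  shows "finite (short_paths x n)" "card (short_paths x n) \<le> Suc \<Delta> ^ n"
proof -
  show "finite (short_paths x n)" unfolding short_paths_def using card_paths_from[OF assms] by auto
  have "card (short_paths x n) \<le> (\<Sum>i\<le>n. card (paths_from x i))"
    unfolding short_paths_def by (rule card_UN_le) simp
  also have "\<dots> \<le> (\<Sum>i\<le>n. \<Delta> ^ i)" by (rule sum_mono) (use card_paths_from[OF assms] in auto)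
  also note sum_powers_le
  finally show "card (short_paths x n) \<le> Suc \<Delta> ^ n" .
qed

definition gball :: "'a \<Rightarrow> nat \<Rightarrow> 'a set" where "gball x n = {y \<in> V. gd x y \<le> n}"

text \<open>Each point of the ball is the end of a short path from the centre.\<close>

lemma card_gball:
  assumes "x \<in> V" shows "finite (gball x n)" "card (gball x n) \<le> Suc \<Delta> ^ n"
proof -
  have "gball x n \<subseteq> last ` short_paths x n"
  proof
    fix y assume "y \<in> gball x n"
    then obtain p where p: "edge_path E x y p" "length p = Suc (gd x y)" "gd x y \<le> n"
      using gd_path assms unfolding gball_def by blast
    then have "p \<in> short_paths x n" by (intro short_pathsI) auto
    then show "y \<in> last ` short_paths x n" using p(1) by (force simp: edge_path_def)
  qed
  then show "finite (gball x n)" "card (gball x n) \<le> Suc \<Delta> ^ n"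
    using card_short_paths[OF assms, of n] 
    by (auto intro: finite_subset order_trans[OF surj_card_le])
qed

lemma countable_V: "countable V"
proof (cases "V = {}")
  case False
  then obtain x where x: "x \<in> V" by auto
  have "V = (\<Union>n. gball x n)" unfolding gball_def by auto
  moreover have "countable (\<Union>n. gball x n)" using card_gball(1)[OF x] by (auto intro: countable_finite)
  ultimately show ?thesis by simp
qed simp

lemma countable_E: "countable E"
proof -
  have "E \<subseteq> (\<lambda>(x, y). {x, y}) ` (V \<times> V)" using edge_pair edge_in by (fastforce simp: image_iff)
  then show ?thesis using countable_V by (meson countable_SIGMA countable_image countable_subset)
qed

end

section \<open>Hyperbolic graphs and the Morse property\<close>

locale hyperbolic_graph = bounded_graph V E \<Delta> for V :: "'a set" and E \<Delta> +
  fixes \<delta> :: real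
  assumes \<delta>_nonneg: "\<delta> \<ge> 0"
    and hyperbolic: "\<And>w x y z. \<lbrakk>w \<in> V; x \<in> V; y \<in> V; z \<in> V\<rbrakk> \<Longrightarrow>
        min (gromov_product E w x y) (gromov_product E w y z) - \<delta> \<le> gromov_product E w x z"
begin

abbreviation gp :: "'a \<Rightarrow> 'a \<Rightarrow> 'a \<Rightarrow> real" where "gp \<equiv> gromov_product E"
abbreviation rd :: "'a \<Rightarrow> 'a \<Rightarrow> real" where "rd x y \<equiv> real (gd x y)"

lemma rd_sym: "x \<in> V \<Longrightarrow> y \<in> V \<Longrightarrow> rd x y = rd y x"
  using gd_sym by simp

lemma rd_tri: "x \<in> V \<Longrightarrow> y \<in> V \<Longrightarrow> z \<in> V \<Longrightarrow> rd x z \<le> rd x y + rd y z"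
  using gd_tri[of x y z] by linarith

text \<open>Twice the Gromov product inequality at \<open>w\<close>, rearranged: the classical
  four-point condition, symmetric in all points.\<close>

lemma four_point:
  assumes "x \<in> V" "y \<in> V" "z \<in> V" "w \<in> V"
  shows "rd x z + rd y w \<le> max (rd x y + rd z w) (rd x w + rd y z) + 2 * \<delta>"
  using hyperbolic[OF assms(4) assms(1-3)]
  unfolding gromov_product_def by (simp add: min_def max_def field_simps split: if_splits)

section \<open>Nearest-point projection to a word geodesic\<close>

definition is_proj :: "(nat \<Rightarrow> 'a) \<Rightarrow> nat \<Rightarrow> 'a \<Rightarrow> nat \<Rightarrow> bool" where
  "is_proj g n x \<alpha> \<longleftrightarrow> \<alpha> \<le> n \<and> (\<forall>\<beta>\<le>n. gd x (g \<alpha>) \<le> gd x (g \<beta>))"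

lemma is_proj_ex: "\<exists>\<alpha>. is_proj g n x \<alpha>"
proof -
  have "\<exists>\<alpha>. is_arg_min (\<lambda>\<alpha>. gd x (g \<alpha>)) (\<lambda>\<alpha>. \<alpha> \<in> {..n}) \<alpha>"
    by (rule ex_is_arg_min_if_finite) auto
  then show ?thesis unfolding is_arg_min_def is_proj_def by (metis atMost_iff not_le)
qed

text \<open>Otherwise a vertex of \<open>g\<close> between the projection and
  \<open>g \<beta>\<close> would be closer to \<open>x\<close> than the projection. So the Gromov
  product at the projection is at most \<open>2 * \<delta> + 1\<close>, the 1 paying for rounding to
  a vertex.\<close>

lemma proj_tri:
  assumes g: "word_geodesic g n" and x: "x \<in> V" and \<alpha>: "is_proj g n x \<alpha>" and \<beta>: "\<beta> \<le> n"
  shows "rd x (g \<beta>) \<ge> rd x (g \<alpha>) + \<bar>real \<alpha> - real \<beta>\<bar> - (4 * \<delta> + 2)"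
proof -
  define P where "P = g \<alpha>"
  define t where "t = nat \<lfloor>gp P x (g \<beta>)\<rfloor>"
  have \<alpha>n: "\<alpha> \<le> n" using \<alpha> by (simp add: is_proj_def)
  have V: "P \<in> V" "g \<beta> \<in> V" using word_geodesicD[OF g] \<alpha>n \<beta> by (auto simp: P_def)
  have dist: "rd (g i) (g j) = \<bar>real i - real j\<bar>" if "i \<le> n" "j \<le> n" for i j
    using word_geodesicD(3)[OF g, of i j] word_geodesicD(3)[OF g, of j i] rd_sym[of "g i" "g j"]
      word_geodesicD(1)[OF g] that by (cases "i \<le> j") auto
  have le: "gp P x (g \<beta>) \<le> \<bar>real \<alpha> - real \<beta>\<bar>"
    using rd_tri[OF x V(2,1)] dist[OF \<beta> \<alpha>n]
    unfolding gromov_product_def P_def by (simp add: abs_minus_commute)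
  have ge: "gp P x (g \<beta>) \<ge> 0"
    using rd_tri[OF x V(1,2)] rd_sym[OF V] unfolding gromov_product_def by simp
  have t: "real t \<le> gp P x (g \<beta>)" "gp P x (g \<beta>) \<le> real t + 1" using ge unfolding t_def by linarith+
  \<comment> \<open>The vertex of \<open>g\<close> at distance \<open>t\<close> from the projection
    on the way to \<open>g \<beta>\<close>.\<close>
  define m where "m = (if \<alpha> \<le> \<beta> then \<alpha> + t else \<alpha> - t)"
  have tb: "real t \<le> \<bar>real \<alpha> - real \<beta>\<bar>" using t le by simp
  have m: "m \<le> n" "\<bar>real m - real \<alpha>\<bar> = real t" "\<bar>real \<beta> - real m\<bar> = \<bar>real \<alpha> - real \<beta>\<bar> - real t"
    using \<alpha>n \<beta> tb by (auto simp: m_def of_nat_diff)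
  have mV: "g m \<in> V" using m(1) word_geodesicD[OF g] by auto
  have 1: "gp P (g \<beta>) (g m) = t"
    using dist[OF \<beta> \<alpha>n] dist[OF m(1) \<alpha>n] dist[OF \<beta> m(1)] m unfolding gromov_product_def P_def by simp
  \<comment> \<open>\<open>g m\<close> is no closer to \<open>x\<close> than the projection, which
    leaves only half of \<open>t\<close>.\<close>
  have 2: "gp P x (g m) \<le> t / 2"
    using \<alpha> m(1) dist[OF m(1) \<alpha>n] m(2) unfolding is_proj_def gromov_product_def P_def by auto
  have "real t - \<delta> \<le> gp P x (g m)" using hyperbolic[OF V(1) x V(2) mV] 1 t by simp
  with 2 have "real t \<le> 2 * \<delta>" by simp
  with t have "gp P x (g \<beta>) \<le> 2 * \<delta> + 1" by simp
  then show ?thesis using dist[OF \<beta> \<alpha>n] unfolding gromov_product_def P_def by (simp add: field_simps)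
qed

text \<open>In the four-point inequality for \<open>x\<close>, \<open>y\<close> and their
  projections, \<open>proj_tri\<close> makes the left side exceed the second term of the maximum by
  nearly twice the gap. A gap above \<open>5 * \<delta> + 2\<close> rules that term out, so going
  from \<open>x\<close> to \<open>y\<close> costs almost as much as passing through both
  projections.\<close>

lemma proj_contraction:
  assumes g: "word_geodesic g n" and x: "x \<in> V" and \<alpha>: "is_proj g n x \<alpha>"
    and y: "y \<in> V" and \<beta>: "is_proj g n y \<beta>" and far: "\<bar>real \<alpha> - real \<beta>\<bar> > 5 * \<delta> + 2"
  shows "rd x y \<ge> rd x (g \<alpha>) + rd y (g \<beta>) + \<bar>real \<alpha> - real \<beta>\<bar> - (10 * \<delta> + 4)"
proof -
  have n: "\<alpha> \<le> n" "\<beta> \<le> n" using \<alpha> \<beta> by (auto simp: is_proj_def)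
  have V: "g \<alpha> \<in> V" "g \<beta> \<in> V" using word_geodesicD[OF g] n by auto
  have dist: "rd (g i) (g j) = \<bar>real i - real j\<bar>" if "i \<le> n" "j \<le> n" for i j
    using word_geodesicD(3)[OF g, of i j] word_geodesicD(3)[OF g, of j i] rd_sym[of "g i" "g j"]
      word_geodesicD(1)[OF g] that by (cases "i \<le> j") auto
  have "rd x (g \<beta>) + rd y (g \<alpha>) \<le> max (rd x y + rd (g \<beta>) (g \<alpha>)) (rd x (g \<alpha>) + rd y (g \<beta>)) + 2 * \<delta>"
    by (rule four_point[OF x y V(2,1)])
  moreover have "rd x (g \<beta>) \<ge> rd x (g \<alpha>) + \<bar>real \<alpha> - real \<beta>\<bar> - (4 * \<delta> + 2)"
    by (rule proj_tri[OF g x \<alpha> n(2)])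
  moreover have "rd y (g \<alpha>) \<ge> rd y (g \<beta>) + \<bar>real \<beta> - real \<alpha>\<bar> - (4 * \<delta> + 2)"
    by (rule proj_tri[OF g y \<beta> n(1)])
  ultimately show ?thesis using dist[OF n] dist[OF n(2,1)] far \<delta>_nonneg by (simp add: max_def abs_minus_commute split: if_splits)
qed

text \<open>The witness is where the tripod of \<open>z\<close> and the ends of \<open>g\<close>
  branches: at distance from \<open>g 0\<close> equal to the rounded-down Gromov product
  there.\<close>

lemma near_geodesic:
  assumes g: "word_geodesic g n" and z: "z \<in> V"
  shows "\<exists>t\<le>n. rd z (g t) \<le> gp z (g 0) (g n) + 2 * \<delta> + 1"
proof -
  have V: "g 0 \<in> V" "g n \<in> V" using word_geodesicD[OF g] by auto
  have n: "rd (g 0) (g n) = n" using word_geodesicD(3)[OF g, of 0 n] by simp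
  define t where "t = nat \<lfloor>gp (g 0) z (g n)\<rfloor>"
  have ge: "gp (g 0) z (g n) \<ge> 0"
    using rd_tri[OF z V] rd_sym[OF V] unfolding gromov_product_def by simp
  have t: "real t \<le> gp (g 0) z (g n)" "gp (g 0) z (g n) \<le> real t + 1" using ge unfolding t_def by linarith+
  have "gp (g 0) z (g n) \<le> n"
    using rd_tri[OF z V(2,1)] rd_sym[OF V] n unfolding gromov_product_def by simp
  with t have tn: "t \<le> n" by linarith
  then have tV: "g t \<in> V" using word_geodesicD[OF g] by auto
  have d: "rd (g 0) (g t) = t" "rd (g t) (g n) = real n - t"
    using word_geodesicD(3)[OF g, of 0 t] word_geodesicD(3)[OF g, of t n] tn by auto
  have 1: "gp (g 0) (g n) (g t) = t"
    using d n rd_sym[OF V] rd_sym[OF V(1) tV] rd_sym[OF tV V(2)] unfolding gromov_product_def by simp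
  have "t - \<delta> \<le> gp (g 0) z (g t)" using hyperbolic[OF V(1) z V(2) tV] 1 t by simp
  then have "rd z (g t) \<le> gp z (g 0) (g n) + 2 * \<delta> + 1"
    using t(2) d n rd_sym[OF V] rd_sym[OF V(1) tV] rd_sym[OF V(1) z] rd_sym[OF V(2) z]
    unfolding gromov_product_def by (simp add: field_simps)
  with tn show ?thesis by auto
qed

text \<open>Outside the \<open>r\<close>-neighbourhood of a geodesic, the projection to the geodesic moves by a
  bounded amount per \<open>r\<close> steps, because balls disjoint from a geodesic have bounded projections.\<close>

lemma proj_progress:
  assumes g: "word_geodesic g n" and r: "real r > 10 * \<delta> + 4"
  shows "\<lbrakk>i \<le> j; \<And>t. i \<le> t \<Longrightarrow> t < j \<Longrightarrow> {x t, x (Suc t)} \<in> E; x i \<in> V;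
     \<And>t s. \<lbrakk>i \<le> t; t \<le> j; s \<le> n\<rbrakk> \<Longrightarrow> r \<le> gd (x t) (g s);
     is_proj g n (x i) \<alpha>; is_proj g n (x j) \<beta>\<rbrakk> \<Longrightarrow>
     \<bar>real \<alpha> - real \<beta>\<bar> \<le> (5 * \<delta> + 2) * (real (j - i) / r + 1)"
proof (induction "j - i" arbitrary: i \<alpha> rule: less_induct)
  case less
  have r0: "r > 0" using r \<delta>_nonneg by (cases r) auto
  have V: "x t \<in> V" if "i \<le> t" "t \<le> j" for t
    by (rule seg_in[of i j x t]) (use less.prems that in auto)
  \<comment> \<open>Both points are at least \<open>r\<close> from \<open>g\<close>; projections
    farther apart than \<open>5 * \<delta> + 2\<close> would force their distance above
    \<open>2 * r - (10 * \<delta> + 4)\<close>, hence above \<open>r\<close>.\<close>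
  have base: "\<bar>real \<alpha> - real \<alpha>'\<bar> \<le> 5 * \<delta> + 2"
    if "i \<le> k" "k \<le> j" "k - i \<le> r" "is_proj g n (x k) \<alpha>'" for k \<alpha>'
  proof (rule ccontr)
    assume "\<not> ?thesis"
    then have *: "\<bar>real \<alpha> - real \<alpha>'\<bar> > 5 * \<delta> + 2" by simp
    have "rd (x i) (x k) \<ge> rd (x i) (g \<alpha>) + rd (x k) (g \<alpha>') + \<bar>real \<alpha> - real \<alpha>'\<bar> - (10 * \<delta> + 4)"
      by (rule proj_contraction[OF g]) (use V less.prems that * in auto)
    moreover have "gd (x i) (x k) \<le> k - i" by (rule seg_lipschitz) (use less.prems that in auto)
    moreover have "r \<le> gd (x i) (g \<alpha>)" "r \<le> gd (x k) (g \<alpha>')"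
      using less.prems that by (auto simp: is_proj_def)
    ultimately show False using r * that(3) \<delta>_nonneg by linarith
  qed
  show ?case
  proof (cases "j - i \<le> r")
    case True
    have "\<bar>real \<alpha> - real \<beta>\<bar> \<le> 5 * \<delta> + 2" using base[of j \<beta>] less.prems True by auto
    also have "\<dots> \<le> (5 * \<delta> + 2) * (real (j - i) / r + 1)" using \<delta>_nonneg by (simp add: algebra_simps)
    finally show ?thesis .
  next
    case False
    obtain \<alpha>' where \<alpha>': "is_proj g n (x (i + r)) \<alpha>'" using is_proj_ex by blast
    define K where "K = 5 * \<delta> + 2"
    have "\<bar>real \<alpha>' - real \<beta>\<bar> \<le> K * (real (j - (i + r)) / r + 1)"
      unfolding K_def by (rule less.hyps) (use less.prems False r0 \<alpha>' V in auto)
    moreover have "real (j - (i + r)) / r + 1 = real (j - i) / r"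
      using False r0 by (simp add: field_simps of_nat_diff)
    moreover have "\<bar>real \<alpha> - real \<alpha>'\<bar> \<le> K" unfolding K_def using base[of "i + r" \<alpha>'] False \<alpha>' by auto
    moreover have "\<bar>real \<alpha> - real \<beta>\<bar> \<le> \<bar>real \<alpha>' - real \<beta>\<bar> + \<bar>real \<alpha> - real \<alpha>'\<bar>" by simp
    ultimately have "\<bar>real \<alpha> - real \<beta>\<bar> \<le> K * (real (j - i) / r) + K" by simp
    then show ?thesis unfolding K_def[symmetric] by (simp only: distrib_left mult_1_right)
  qed
qed

text \<open>Let \<open>i2\<close> be the first time within \<open>r\<close> of \<open>g\<close> with
  projection at or beyond \<open>b\<close>, and \<open>i1\<close> the last earlier time within
  \<open>r\<close> of \<open>g\<close>. If the projection jumps by \<open>P\<close> in between, the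
  excursion has length at most \<open>\<Lambda> * s\<close> with \<open>s\<close> equal to
  \<open>P\<close> plus a constant, whereas progress \<open>P\<close> takes length about
  \<open>r * P / (5 * \<delta> + 2)\<close>. The lower bound on \<open>r\<close> makes the two
  incompatible for large \<open>P\<close>, so \<open>x i2\<close> is close to
  \<open>z\<close>.\<close>

lemma morse:
  assumes g: "word_geodesic g n" and r: "real r > 10 * \<delta> + 4" "real r \<ge> 2 * (5 * \<delta> + 2) * \<Lambda>"
    and \<Lambda>: "\<Lambda> \<ge> 0"
    and path: "\<And>t. t < N \<Longrightarrow> {x t, x (Suc t)} \<in> E" "x 0 = g 0" "x N = g n"
    and z: "z \<in> V" "b \<le> n" "gd (g b) z \<le> C"
    and excursion: "\<And>i j s. \<lbrakk>Suc i < j; j \<le> N; \<And>t u. i < t \<Longrightarrow> t < j \<Longrightarrow> u \<le> n \<Longrightarrow> r < gd (x t) (g u);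
        1 \<le> s; gd (x i) z \<le> s; gd (x i) (x j) \<le> s\<rbrakk> \<Longrightarrow> real (j - i) \<le> \<Lambda> * s"
  shows "\<exists>i\<le>N. rd (x i) z \<le> 4 * r + 2 * C + 2 * (5 * \<delta> + 2)"
proof -
  have gV: "g i \<in> V" if "i \<le> n" for i using word_geodesicD[OF g] that by auto
  have xV: "x t \<in> V" if "t \<le> N" for t by (rule seg_in[of 0 N x]) (use path gV that in auto)
  define \<pi> where "\<pi> t = (SOME \<alpha>. is_proj g n (x t) \<alpha>)" for t
  have \<pi>: "is_proj g n (x t) (\<pi> t)" for t unfolding \<pi>_def by (rule someI_ex[OF is_proj_ex])
  have \<pi>n: "\<pi> t \<le> n" and \<pi>_min: "u \<le> n \<Longrightarrow> gd (x t) (g (\<pi> t)) \<le> gd (x t) (g u)" for t u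
    using \<pi>[of t] by (auto simp: is_proj_def)
  have \<pi>_eq: "\<pi> t = u" if "x t = g u" "t \<le> N" "u \<le> n" for t u
  proof -
    have "gd (x t) (g (\<pi> t)) = 0" using \<pi>_min[OF that(3), of t] that by simp
    then have "g u = g (\<pi> t)" using gd_eq_0 xV gV \<pi>n that by metis
    then show ?thesis using word_geodesic_inj[OF g \<pi>n that(3)] by simp
  qed
  define T where "T = {t. t \<le> N \<and> gd (x t) (g (\<pi> t)) \<le> r}"
  have T0: "0 \<in> T" "\<pi> 0 = 0" using \<pi>_eq[of 0 0] path(2) by (auto simp: T_def)
  have TN: "N \<in> T" "\<pi> N = n" using \<pi>_eq[of N n] path(3) by (auto simp: T_def)
  define i2 where "i2 = (LEAST t. t \<in> T \<and> b \<le> \<pi> t)"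
  have i2: "i2 \<in> T" "b \<le> \<pi> i2" unfolding i2_def using TN z(2) LeastI[of "\<lambda>t. t \<in> T \<and> b \<le> \<pi> t" N] by auto
  have i2_least: "t < i2 \<Longrightarrow> t \<in> T \<Longrightarrow> \<pi> t < b" for t
    unfolding i2_def using not_less_Least[of t "\<lambda>t. t \<in> T \<and> b \<le> \<pi> t"] by auto
  have i2N: "i2 \<le> N" using i2(1) by (simp add: T_def)
  have h2: "gd (x i2) (g (\<pi> i2)) \<le> r" using i2(1) by (simp add: T_def)
  show ?thesis
  proof (cases "i2 = 0")
    case True
    then have "b = 0" using i2 T0 by simp
    then have "gd (x 0) z \<le> C" using z path(2) by simp
    then show ?thesis using \<delta>_nonneg by (intro exI[of _ 0]) auto
  next
    case False
    define i1 where "i1 = Max {t. t \<in> T \<and> t < i2}"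
    have fin: "finite {t. t \<in> T \<and> t < i2}" "0 \<in> {t. t \<in> T \<and> t < i2}" using False T0 by auto
    have i1: "i1 \<in> T" "i1 < i2" using Max_in[OF fin(1)] fin(2) unfolding i1_def by blast+
    have between: "t \<notin> T" if "i1 < t" "t < i2" for t
      using Max_ge[OF fin(1), of t] that unfolding i1_def by (auto simp: not_le[symmetric])
    have h1: "gd (x i1) (g (\<pi> i1)) \<le> r" using i1(1) by (simp add: T_def)
    have \<pi>1: "\<pi> i1 < b" using i2_least i1 by auto
    have V: "x i1 \<in> V" "x i2 \<in> V" "g (\<pi> i1) \<in> V" "g (\<pi> i2) \<in> V" "g b \<in> V"
      using xV gV \<pi>n i2N i1 z(2) by auto
    define P where "P = \<pi> i2 - \<pi> i1"
    have dP: "gd (g (\<pi> i1)) (g (\<pi> i2)) = P" "gd (g (\<pi> i1)) (g b) = b - \<pi> i1" "gd (g b) (g (\<pi> i2)) = \<pi> i2 - b"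
      unfolding P_def by (rule word_geodesicD(3)[OF g]; use \<pi>n[of i2] z(2) i2(2) \<pi>1 in linarith)+
    have Pr: "\<bar>real (\<pi> i1) - real (\<pi> i2)\<bar> = P" using \<pi>1 i2 by (simp add: P_def of_nat_diff)
    have "real P \<le> 3 * r + C + 2 * (5 * \<delta> + 2)"
    proof (cases "i2 = Suc i1")
      case True
      then have "gd (x i1) (x i2) \<le> 1" using path(1)[of i1] i2N gd_edge by auto
      moreover have "gd (g (\<pi> i1)) (g (\<pi> i2)) \<le> gd (g (\<pi> i1)) (x i1) + gd (x i1) (g (\<pi> i2))"
        "gd (x i1) (g (\<pi> i2)) \<le> gd (x i1) (x i2) + gd (x i2) (g (\<pi> i2))" by (intro gd_tri V)+
      ultimately have "P \<le> 2 * r + 1" using h1 h2 dP(1) gd_sym[OF V(3,1)] by linarith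
      then have "real P \<le> real (2 * r + 1)" by (simp only: of_nat_le_iff)
      also have "\<dots> \<le> real (3 * r + C) + 1" by simp
      also have "\<dots> \<le> real (3 * r + C) + 2 * (5 * \<delta> + 2)" using \<delta>_nonneg by simp
      finally show ?thesis .
    next
      case False
      have far: "r < gd (x t) (g u)" if "i1 < t" "t < i2" "u \<le> n" for t u
        using between[OF that(1,2)] \<pi>_min[OF that(3), of t] that i2N unfolding T_def by auto
      \<comment> \<open>Extends to the endpoints, which are themselves within \<open>r\<close>:
        their neighbours inside the excursion are at distance above \<open>r\<close>, and an edge
        changes the integer distance by at most 1.\<close>
      have far': "r \<le> gd (x t) (g u)" if t: "i1 \<le> t" "t \<le> i2" and u: "u \<le> n" for t u
      proof -
        consider "t = i1" | "t = i2" | "i1 < t \<and> t < i2" using t by linarith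
        then show ?thesis
        proof cases
          case 1
          have "r < gd (x (Suc i1)) (g u)" using far[of "Suc i1" u] False i1 u by auto
          moreover have "gd (x (Suc i1)) (x i1) \<le> 1"
            using gd_edge[of "x (Suc i1)" "x i1"] path(1)[of i1] i1 i2N by (auto simp: insert_commute)
          moreover have "gd (x (Suc i1)) (g u) \<le> gd (x (Suc i1)) (x i1) + gd (x i1) (g u)"
            by (rule gd_tri) (use xV gV u i1 i2N in auto)
          ultimately show ?thesis unfolding 1 by linarith
        next
          case 2
          have "r < gd (x (i2 - 1)) (g u)" using far[of "i2 - 1" u] False i1 u by auto
          moreover have "gd (x (i2 - 1)) (x i2) \<le> 1"
            using gd_edge[of "x (i2 - 1)" "x i2"] path(1)[of "i2 - 1"] i1 i2N by auto
          moreover have "gd (x (i2 - 1)) (g u) \<le> gd (x (i2 - 1)) (x i2) + gd (x i2) (g u)"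
            by (rule gd_tri) (use xV gV u i1 i2N in auto)
          ultimately show ?thesis unfolding 2 by linarith
        next
          case 3
          with far u show ?thesis by (intro less_imp_le) auto
        qed
      qed
      have prog: "real P \<le> (5 * \<delta> + 2) * (real (i2 - i1) / r + 1)"
        unfolding Pr[symmetric]
        by (rule proj_progress[OF g r(1), where x = x]) (use i1 path i2N V far' \<pi> in auto)
      \<comment> \<open>Large enough to dominate the distances from \<open>x i1\<close> to
        \<open>z\<close> and to \<open>x i2\<close>, and to be at least 1.\<close>
      define s where "s = P + 3 * r + C"
      have r0: "r > 0" using r(1) \<delta>_nonneg by (cases r) auto
      have "real (i2 - i1) \<le> \<Lambda> * s"
      proof (rule excursion)
        have "gd (x i1) z \<le> gd (x i1) (g (\<pi> i1)) + gd (g (\<pi> i1)) z"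
             "gd (g (\<pi> i1)) z \<le> gd (g (\<pi> i1)) (g b) + gd (g b) z" by (intro gd_tri V z(1))+
        then show "gd (x i1) z \<le> s" using h1 dP(2) z(3) i2(2) \<pi>1 unfolding s_def P_def by linarith
        have "gd (x i1) (x i2) \<le> gd (x i1) (g (\<pi> i1)) + gd (g (\<pi> i1)) (x i2)"
             "gd (g (\<pi> i1)) (x i2) \<le> gd (g (\<pi> i1)) (g (\<pi> i2)) + gd (g (\<pi> i2)) (x i2)" by (intro gd_tri V)+
        then show "gd (x i1) (x i2) \<le> s"
          using h1 h2 dP(1) gd_sym[OF V(4,2)] unfolding s_def by linarith
      qed (use False i1 i2N far r0 in \<open>auto simp: s_def\<close>)
      then have "real (i2 - i1) / r \<le> \<Lambda> * s / r" by (intro divide_right_mono) auto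
      then have "(5 * \<delta> + 2) * (real (i2 - i1) / r) \<le> (5 * \<delta> + 2) * (\<Lambda> * s / r)"
        using \<delta>_nonneg by (intro mult_left_mono) auto
      also have "\<dots> = (2 * (5 * \<delta> + 2) * \<Lambda>) * (s / 2) / r" by (simp add: divide_simps)
      \<comment> \<open>The size of \<open>r\<close> leaves only half of \<open>s\<close>, so that
        the \<open>P\<close> in \<open>s\<close> can be absorbed on the left.\<close>
      also have "\<dots> \<le> r * (s / 2) / r"
        by (intro divide_right_mono mult_right_mono r(2)) auto
      also have "\<dots> = s / 2" using r0 by simp
      finally have "(5 * \<delta> + 2) * (real (i2 - i1) / r) + (5 * \<delta> + 2) \<le> s / 2 + (5 * \<delta> + 2)"
        by (rule add_right_mono)
      moreover have "real P \<le> (5 * \<delta> + 2) * (real (i2 - i1) / r) + (5 * \<delta> + 2)"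
        using prog by (simp only: distrib_left mult_1_right)
      ultimately have "real P \<le> s / 2 + (5 * \<delta> + 2)" by (rule order_trans[rotated])
      then show ?thesis unfolding s_def by (simp add: field_simps)
    qed
    moreover have "gd (x i2) z \<le> gd (x i2) (g (\<pi> i2)) + gd (g (\<pi> i2)) z"
         "gd (g (\<pi> i2)) z \<le> gd (g (\<pi> i2)) (g b) + gd (g b) z" by (intro gd_tri V z(1))+
    then have "gd (x i2) z \<le> r + P + C"
      using h2 dP(3) z(3) gd_sym[OF V(4,5)] \<pi>1 i2(2) unfolding P_def by linarith
    then have "rd (x i2) z \<le> r + P + C" by (simp flip: of_nat_add of_nat_mult)
    ultimately have "rd (x i2) z \<le> 4 * r + 2 * C + 2 * (5 * \<delta> + 2)" by simp
    with i2N show ?thesis by (intro exI[of _ i2]) simp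
  qed
qed

section \<open>Word geodesic rays\<close>

definition geodesic_ray :: "(nat \<Rightarrow> 'a) \<Rightarrow> bool" where
  "geodesic_ray c \<longleftrightarrow> (\<forall>n. word_geodesic c n)"

lemma geodesic_rayD:
  assumes "geodesic_ray c"
  shows "c i \<in> V" "{c i, c (Suc i)} \<in> E" "rd (c i) (c j) = \<bar>real i - real j\<bar>"
proof -
  have w: "word_geodesic c n" for n using assms by (simp add: geodesic_ray_def)
  show 1: "c i \<in> V" for i using word_geodesicD(1)[OF w, of i i] by simp
  show "{c i, c (Suc i)} \<in> E" using word_geodesicD(2)[OF w, of i "Suc i"] by simp
  show "rd (c i) (c j) = \<bar>real i - real j\<bar>"
    using word_geodesicD(3)[OF w, of i j j] word_geodesicD(3)[OF w, of j i i] rd_sym[OF 1[of i] 1[of j]]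
    by (cases "i \<le> j") auto
qed

text \<open>\<open>y\<close> branches off the ray before \<open>c j\<close> and \<open>y'\<close>
  after it, with the far point \<open>c m\<close> standing for the boundary point; hence geodesics
  from \<open>y\<close> to \<open>y'\<close> pass close to \<open>c j\<close>.\<close>

lemma ray_between:
  assumes c: "geodesic_ray c" and V: "y \<in> V" "y' \<in> V" and jm: "j \<le> m"
    and B: "gp (c 0) y (c m) \<le> B" "B + 2 * \<delta> < j" and A: "A \<le> gp (c 0) y' (c m)" "j + 2 * \<delta> < A"
  shows "gp (c j) y y' \<le> 2 * \<delta>"
proof -
  note cD = geodesic_rayD[OF c]
  note d = cD(3)
  have 0: "gp (c 0) (c j) (c m) = j" "gp (c j) (c 0) (c m) = 0"
    using jm unfolding gromov_product_def d by auto
  have "gp (c 0) y (c j) \<le> B + \<delta>"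
    using hyperbolic[OF cD(1)[of 0] V(1) cD(1)[of j] cD(1)[of m]] 0 B \<delta>_nonneg by (simp add: min_def split: if_splits)
  then have 1: "gp (c j) (c 0) y > \<delta>"
    using B d[of 0 j] d[of j 0] rd_sym[OF V(1) cD(1)[of 0]] unfolding gromov_product_def by (simp add: field_simps)
  \<comment> \<open>Seen from \<open>c j\<close>, the points \<open>c 0\<close> and
    \<open>c m\<close> are opposite, and \<open>y\<close> is on the side of
    \<open>c 0\<close>.\<close>
  have 2: "gp (c j) y (c m) \<le> \<delta>"
    using hyperbolic[OF cD(1)[of j] cD(1)[of 0] V(1) cD(1)[of m]] 0 1 by (simp add: min_def split: if_splits)
  have "rd y' (c 0) \<le> rd y' (c j) + rd (c j) (c 0)" by (rule rd_tri[OF V(2) cD(1) cD(1)])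
  then have 3: "gp (c j) y' (c m) > 2 * \<delta>"
    using A jm unfolding gromov_product_def by (simp add: d field_simps)
  show ?thesis
    using hyperbolic[OF cD(1)[of j] V(1) V(2) cD(1)[of m]] 2 3 by (simp add: min_def split: if_splits)
qed

end

section \<open>Passage times and the corridor event\<close>

text \<open>Edges as a set: along a repetition-free path each occurs once, so the weight becomes a
  sum over distinct, hence independent, coordinates.\<close>

definition path_edges :: "'a list \<Rightarrow> 'a set set" where
  "path_edges p = (\<lambda>i. {p ! i, p ! Suc i}) ` {..<length p - 1}"

lemma inj_on_path_edges:
  assumes "distinct p" shows "inj_on (\<lambda>i. {p ! i, p ! Suc i}) {..<length p - 1}"
proof (rule inj_onI)
  fix i j assume *: "i \<in> {..<length p - 1}" "j \<in> {..<length p - 1}" "{p ! i, p ! Suc i} = {p ! j, p ! Suc j}"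
  then have "i < length p" "Suc i < length p" "j < length p" "Suc j < length p" by auto
  with *(3) show "i = j"
    by (auto simp: doubleton_eq_iff nth_eq_iff_index_eq[OF assms])
qed

lemma path_weight_distinct: "distinct p \<Longrightarrow> path_weight \<omega> p = (\<Sum>e\<in>path_edges p. \<omega> e)"
  unfolding path_weight_def path_edges_def by (subst sum.reindex[OF inj_on_path_edges]) auto

lemma card_path_edges: "distinct p \<Longrightarrow> card (path_edges p) = length p - 1"
  unfolding path_edges_def by (subst card_image[OF inj_on_path_edges]) auto

lemma finite_path_edges [simp]: "finite (path_edges p)"
  by (simp add: path_edges_def)

lemma path_edges_seg: "i \<le> j \<Longrightarrow> path_edges (seg x i j) = (\<lambda>t. {x t, x (Suc t)}) ` {i..<j}"
proof -
  assume ij: "i \<le> j"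
  have "path_edges (seg x i j) = (\<lambda>t. {x (i + t), x (Suc (i + t))}) ` {..<j - i}"
    unfolding path_edges_def using ij by (intro image_cong) (auto simp: nth_seg)
  also have "\<dots> = (\<lambda>t. {x t, x (Suc t)}) ` (\<lambda>t. i + t) ` {..<j - i}" by (simp add: image_image)
  also have "(\<lambda>t. i + t) ` {..<j - i} = {i..<j}"
    using ij image_add_atLeastLessThan[of i 0 "j - i"] by (simp add: lessThan_atLeast0)
  finally show ?thesis .
qed

lemma path_edges_subset: "edge_path E x y p \<Longrightarrow> path_edges p \<subseteq> E"
  using edge_pathD(5) by (fastforce simp: path_edges_def)

section \<open>First-passage distance, its geodesics, and blocks\<close>

context bounded_graph
begin

definition nonneg_weight :: "('a set \<Rightarrow> real) \<Rightarrow> bool" where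
  "nonneg_weight \<omega> \<longleftrightarrow> (\<forall>e\<in>E. 0 \<le> \<omega> e)"

lemma path_weight_nonneg:
  assumes "nonneg_weight \<omega>" "edge_path E x y p" shows "0 \<le> path_weight \<omega> p"
  unfolding path_weight_def
  using assms edge_pathD(5)[OF assms(2)] by (intro sum_nonneg) (auto simp: nonneg_weight_def)

text \<open>A real \<open>INF\<close> behaves as an infimum only on nonempty sets bounded below:
  nonnegative weights give the bound here, connectedness the nonemptiness in
  \<open>fpp_dist_greatest\<close>.\<close>

lemma fpp_dist_le:
  assumes "nonneg_weight \<omega>" "edge_path E x y p" shows "fpp_dist E \<omega> x y \<le> path_weight \<omega> p"
  unfolding fpp_dist_def
  by (rule cINF_lower) (use assms path_weight_nonneg[OF assms(1)] in \<open>auto intro!: bdd_belowI[of _ 0]\<close>)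

lemma fpp_dist_greatest:
  assumes "x \<in> V" "y \<in> V" "\<And>p. edge_path E x y p \<Longrightarrow> a \<le> path_weight \<omega> p"
  shows "a \<le> fpp_dist E \<omega> x y"
  unfolding fpp_dist_def
  by (rule cINF_greatest) (use assms connected in auto)

lemma fpp_dist_tri:
  assumes \<omega>: "nonneg_weight \<omega>" and V: "x \<in> V" "y \<in> V" "z \<in> V"
  shows "fpp_dist E \<omega> x z \<le> fpp_dist E \<omega> x y + fpp_dist E \<omega> y z"
proof -
  have "fpp_dist E \<omega> x z - path_weight \<omega> q \<le> fpp_dist E \<omega> x y" if q: "edge_path E y z q" for q
  proof (rule fpp_dist_greatest[OF V(1,2)])
    fix p assume p: "edge_path E x y p"
    show "fpp_dist E \<omega> x z - path_weight \<omega> q \<le> path_weight \<omega> p"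
      using fpp_dist_le[OF \<omega> edge_path_append[OF p q]] path_weight_append[OF p q, of \<omega>] by simp
  qed
  then have "fpp_dist E \<omega> x z - fpp_dist E \<omega> x y \<le> fpp_dist E \<omega> y z"
    by (intro fpp_dist_greatest[OF V(2,3)]) (simp add: algebra_simps)
  then show ?thesis by simp
qed

lemma fpp_dist_sym: assumes "x \<in> V" "y \<in> V" "nonneg_weight \<omega>"
  shows "fpp_dist E \<omega> x y = fpp_dist E \<omega> y x"
proof -
  have "fpp_dist E \<omega> x y \<le> fpp_dist E \<omega> y x" if "x \<in> V" "y \<in> V" for x y
  proof (rule fpp_dist_greatest[OF that(2,1)])
    fix p assume p: "edge_path E y x p"
    show "fpp_dist E \<omega> x y \<le> path_weight \<omega> p"
      using fpp_dist_le[OF assms(3) edge_path_rev[OF p]] path_weight_rev[OF p, of \<omega>] by simp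
  qed
  from this[OF assms(1,2)] this[OF assms(2,1)] show ?thesis by simp
qed

lemma fpp_geodesic_rev:
  assumes "x \<in> V" "y \<in> V" "nonneg_weight \<omega>" "fpp_geodesic E \<omega> x y p"
  shows "fpp_geodesic E \<omega> y x (rev p)"
  using assms edge_path_rev[of E x y p] path_weight_rev[of E x y p \<omega>] fpp_dist_sym[OF assms(1-3)]
  unfolding fpp_geodesic_def by auto

lemma fpp_geodesic_sub:
  assumes \<omega>: "nonneg_weight \<omega>" and g: "fpp_geodesic E \<omega> a b (seg x 0 n)" and a: "a \<in> V"
    and ij: "i \<le> j" "j \<le> n"
  shows "fpp_geodesic E \<omega> (x i) (x j) (seg x i j)"
proof -
  have e: "a = x 0" "b = x n" "\<And>t. t < n \<Longrightarrow> {x t, x (Suc t)} \<in> E"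
    using g unfolding fpp_geodesic_def by (auto simp only: edge_path_seg[OF le0])
  have xV: "x t \<in> V" if "t \<le> n" for t by (rule seg_in[of 0 n x]) (use e a that in auto)
  have ep: "edge_path E (x s) (x t) (seg x s t)" if "s \<le> t" "t \<le> n" for s t
    using e that by (simp only: edge_path_seg) auto
  have "fpp_dist E \<omega> (x 0) (x n) \<le> fpp_dist E \<omega> (x 0) (x i) + fpp_dist E \<omega> (x i) (x n)"
    "fpp_dist E \<omega> (x i) (x n) \<le> fpp_dist E \<omega> (x i) (x j) + fpp_dist E \<omega> (x j) (x n)"
    by (rule fpp_dist_tri[OF \<omega>]; use xV ij in auto)+
  moreover have "fpp_dist E \<omega> (x 0) (x i) \<le> path_weight \<omega> (seg x 0 i)"
     "fpp_dist E \<omega> (x j) (x n) \<le> path_weight \<omega> (seg x j n)"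
     "fpp_dist E \<omega> (x i) (x j) \<le> path_weight \<omega> (seg x i j)"
    by (rule fpp_dist_le[OF \<omega> ep]; use ij in auto)+
  moreover have "path_weight \<omega> (seg x 0 n) = path_weight \<omega> (seg x 0 i) + path_weight \<omega> (seg x i j) + path_weight \<omega> (seg x j n)"
    unfolding path_weight_seg using ij by (simp add: sum.atLeastLessThan_concat)
  moreover have "path_weight \<omega> (seg x 0 n) = fpp_dist E \<omega> (x 0) (x n)"
    using g e unfolding fpp_geodesic_def by auto
  ultimately have "path_weight \<omega> (seg x i j) = fpp_dist E \<omega> (x i) (x j)" by linarith
  with ep[OF ij] show ?thesis unfolding fpp_geodesic_def by blast
qed

text \<open>Between two visits of a vertex the subpath is geodesic, so it weighs no more than the
  one-vertex path, contrary to positivity.\<close>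

lemma fpp_geodesic_distinct:
  assumes pos: "\<forall>e\<in>E. 0 < \<omega> e" and g: "fpp_geodesic E \<omega> a b p" and a: "a \<in> V"
  shows "distinct p"
proof -
  have \<omega>: "nonneg_weight \<omega>" using pos by (auto simp: nonneg_weight_def less_imp_le)
  obtain x n where p: "p = seg x 0 n" "\<And>t. t < n \<Longrightarrow> {x t, x (Suc t)} \<in> E"
    using g unfolding fpp_geodesic_def by (metis edge_path_as_seg)
  have "x s \<noteq> x t" if st: "s < t" "t \<le> n" for s t
  proof
    assume eq: "x s = x t"
    have "fpp_geodesic E \<omega> (x s) (x t) (seg x s t)"
      by (rule fpp_geodesic_sub[OF \<omega> g[unfolded p(1)] a]) (use st in auto)
    then have "(\<Sum>u\<in>{s..<t}. \<omega> {x u, x (Suc u)}) \<le> 0"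
      using fpp_dist_le[OF \<omega>, of "x s" "x t" "[x s]"] eq
      unfolding fpp_geodesic_def path_weight_seg by simp
    moreover have "(\<Sum>u\<in>{s..<t}. \<omega> {x u, x (Suc u)}) > 0"
      by (rule sum_pos) (use st p(2) pos in auto)
    ultimately show False by simp
  qed
  then show ?thesis unfolding p(1) distinct_map
    by (auto simp: inj_on_def) (metis less_Suc_eq_le linorder_neqE_nat)
qed

definition ball_edges :: "'a \<Rightarrow> nat \<Rightarrow> 'a set set" where
  "ball_edges z R = {e \<in> E. e \<subseteq> gball z R}"

lemma finite_ball_edges: "z \<in> V \<Longrightarrow> finite (ball_edges z R)"
  by (rule finite_subset[of _ "Pow (gball z R)"]) (auto simp: ball_edges_def card_gball)

text \<open>A word geodesic from \<open>u\<close> to \<open>w\<close> does not leave the ball, where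
  each edge costs at most \<open>M\<close>.\<close>

lemma fpp_dist_le_short:
  assumes \<omega>: "nonneg_weight \<omega>" and V: "u \<in> V" "w \<in> V" "z \<in> V"
    and M: "\<And>e. e \<in> ball_edges z R \<Longrightarrow> \<omega> e \<le> M" "0 \<le> M"
    and d: "gd u w \<le> d" "gd z u + d \<le> R"
  shows "fpp_dist E \<omega> u w \<le> M * d"
proof -
  obtain g where g: "word_geodesic g (gd u w)" "g 0 = u" "g (gd u w) = w"
    using word_geodesic_ex[OF V(1,2)] by auto
  have in_ball: "g t \<in> gball z R" if "t \<le> gd u w" for t
  proof -
    have "gd z (g t) \<le> gd z (g 0) + gd (g 0) (g t)"
      by (rule gd_tri) (use V g word_geodesicD[OF g(1)] that in auto)
    moreover have "gd (g 0) (g t) = t" using word_geodesicD(3)[OF g(1) le0 that] by simp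
    ultimately show ?thesis using word_geodesicD(1)[OF g(1) that] that d g(2) by (simp add: gball_def)
  qed
  have ep: "edge_path E u w (seg g 0 (gd u w))"
    using g word_geodesicD(2)[OF g(1)] by (simp only: edge_path_seg[OF le0]) auto
  have "fpp_dist E \<omega> u w \<le> (\<Sum>t\<in>{0..<gd u w}. \<omega> {g t, g (Suc t)})"
    using fpp_dist_le[OF \<omega> ep] unfolding path_weight_seg .
  also have "\<dots> \<le> (\<Sum>t\<in>{0..<gd u w}. M)"
    by (intro sum_mono M) (use in_ball word_geodesicD(2)[OF g(1)] in \<open>auto simp: ball_edges_def\<close>)
  also have "\<dots> \<le> M * d" using M(2) d by (simp add: mult.commute mult_left_mono)
  finally show ?thesis .
qed

definition corridor :: "(nat \<Rightarrow> 'a) \<Rightarrow> nat \<Rightarrow> nat \<Rightarrow> 'a set set" where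
  "corridor c k L = (\<lambda>a. {c a, c (Suc a)}) ` {k - L..<k + L}"

text \<open>One interval per edge, so that the probability of the event can be bounded below by a
  finite product.\<close>

definition block :: "(nat \<Rightarrow> 'a) \<Rightarrow> nat \<Rightarrow> nat \<Rightarrow> nat \<Rightarrow> real \<Rightarrow> real \<Rightarrow> real \<Rightarrow> ('a set \<Rightarrow> real) \<Rightarrow> bool" where
  "block c k L R a b M \<omega> \<longleftrightarrow> (\<forall>e\<in>ball_edges (c k) R.
     if e \<in> corridor c k L then \<omega> e \<le> a else b \<le> \<omega> e \<and> \<omega> e \<le> M)"

end

context hyperbolic_graph
begin

lemma geodesic_ray_inj: assumes "geodesic_ray c" "c i = c j" shows "i = j"
  using geodesic_rayD(3)[OF assms(1), of i j] assms(2) by simp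

lemma geodesic_ray_gd: "geodesic_ray c \<Longrightarrow> i \<le> j \<Longrightarrow> gd (c i) (c j) = j - i"
  "geodesic_ray c \<Longrightarrow> i \<le> j \<Longrightarrow> gd (c j) (c i) = j - i"
  using geodesic_rayD(3)[of c i j] geodesic_rayD(3)[of c j i] by linarith+

text \<open>A geodesic avoiding \<open>c k\<close> has to travel from the left half of the corridor (or from its own
  starting point) to the right half without using corridor edges; this is more
  expensive than following the corridor.\<close>

lemma block_crossing:
  assumes c: "geodesic_ray c" and kL: "L \<le> k" and D: "D < L" and R: "L + D \<le> R"
    and ab: "0 \<le> a" "a < b" "b \<le> M"
    and L: "2 * real D * (M + b) < real L * (b - a)"
    and R': "2 * real D * M + 2 * real L * a < b * real (R - (L + D))"
    and \<omega>: "nonneg_weight \<omega>" and bl: "block c k L R a b M \<omega>"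
    and g: "fpp_geodesic E \<omega> (x 0) (x n) (seg x 0 n)"
    and near: "x 0 \<in> V" "gd (x 0) (c (k - L)) \<le> D" "gd (x n) (c (k + L)) \<le> D"
  shows "\<exists>t\<le>n. x t = c k"
proof (rule ccontr)
  assume "\<not> ?thesis"
  then have avoid: "x t \<noteq> c k" if "t \<le> n" for t using that by auto
  note cV = geodesic_rayD(1)[OF c]
  note cd = geodesic_ray_gd[OF c]
  have e: "{x t, x (Suc t)} \<in> E" if "t < n" for t
    using g that unfolding fpp_geodesic_def by (auto simp only: edge_path_seg[OF le0])
  have xV: "x t \<in> V" if "t \<le> n" for t by (rule seg_in[of 0 n x]) (use e near that in auto)
  define Lf where "Lf = c ` {k - L..<k}"
  define Rt where "Rt = c ` {k<..k + L}"
  have xn_Lf: "x n \<notin> Lf"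
  proof
    assume "x n \<in> Lf"
    then obtain s where s: "s < k" "x n = c s" by (auto simp: Lf_def)
    then have "gd (x n) (c (k + L)) = k + L - s" using cd by auto
    with near(3) D s show False by auto
  qed
  have x0_Rt: "x 0 \<notin> Rt"
  proof
    assume "x 0 \<in> Rt"
    then obtain s where s: "k < s" "x 0 = c s" by (auto simp: Rt_def)
    then have "gd (x 0) (c (k - L)) = s - (k - L)" using cd by auto
    with near(2) D s kL show False by auto
  qed
  have n0: "n \<noteq> 0"
  proof
    assume "n = 0"
    moreover have "gd (c (k - L)) (c (k + L)) \<le> gd (c (k - L)) (x 0) + gd (x 0) (c (k + L))"
      by (rule gd_tri) (use cV near in auto)
    moreover have "gd (c (k - L)) (c (k + L)) = 2 * L" using cd kL by auto
    ultimately show False using near D gd_sym[OF near(1) cV[of "k - L"]] by auto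
  qed
  \<comment> \<open>Time 0 is included so that \<open>i\<close> exists even if the left half is
    never visited; likewise \<open>j\<close> below may be the end \<open>n\<close>.\<close>
  define I where "I = {t. t \<le> n \<and> (t = 0 \<or> x t \<in> Lf)}"
  define i where "i = Max I"
  have I: "finite I" "I \<noteq> {}" unfolding I_def by auto
  have i: "i \<le> n" "i = 0 \<or> x i \<in> Lf" using Max_in[OF I] unfolding i_def I_def by auto
  have after_i: "x t \<notin> Lf" if "i < t" "t \<le> n" for t
  proof
    assume "x t \<in> Lf"
    then have "t \<in> I" using that by (simp add: I_def)
    from Max_ge[OF I(1) this] that show False unfolding i_def by simp
  qed
  have i_n: "i < n" using i xn_Lf n0 by (cases "i = n") auto
  define j where "j = (LEAST t. i < t \<and> t \<le> n \<and> (t = n \<or> x t \<in> Rt))"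
  have j: "i < j" "j \<le> n" "j = n \<or> x j \<in> Rt"
    using LeastI[of "\<lambda>t. i < t \<and> t \<le> n \<and> (t = n \<or> x t \<in> Rt)" n] i_n unfolding j_def by auto
  have before_j: "x t \<notin> Rt" if "i < t" "t < j" for t
    using not_less_Least[of t "\<lambda>t. i < t \<and> t \<le> n \<and> (t = n \<or> x t \<in> Rt)"] that j unfolding j_def by auto
  \<comment> \<open>Either \<open>x i\<close> lies on the corridor, or it is the start, within
    \<open>D\<close> of the corridor end; \<open>D1\<close> is the number of edges allowed for
    getting onto the corridor.\<close>
  obtain a1 D1 where a1: "k - L \<le> a1" "a1 < k" "gd (x i) (c a1) \<le> D1" "D1 = 0 \<or> D1 = D \<and> a1 = k - L"
  proof (cases "x i \<in> Lf")
    case True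
    then obtain s where "s \<in> {k - L..<k}" "x i = c s" unfolding Lf_def by blast
    then show ?thesis using that[of s 0] by auto
  next
    case False
    then show ?thesis using that[of "k - L" D] i near D kL by auto
  qed
  obtain a2 D2 where a2: "a2 \<le> k + L" "k < a2" "gd (x j) (c a2) \<le> D2" "D2 = 0 \<or> D2 = D \<and> a2 = k + L"
  proof (cases "x j \<in> Rt")
    case True
    then obtain s where "s \<in> {k<..k + L}" "x j = c s" unfolding Rt_def by blast
    then show ?thesis using that[of s 0] by auto
  next
    case False
    then show ?thesis using that[of "k + L" D] j near D by auto
  qed
  have D12: "D1 \<le> D" "D2 \<le> D" using a1 a2 by auto
  define X where "X = a2 - a1"
  have X: "0 < X" "X \<le> 2 * L" using a1 a2 kL unfolding X_def by auto
  have dX: "gd (c a1) (c a2) = X" using cd a1 a2 unfolding X_def by auto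
  have ca: "c s \<in> gball (c k) R" if "k - L \<le> s" "s \<le> k + L" for s
    using that cd[of s k] cd[of k s] R cV kL unfolding gball_def by (cases "s \<le> k") auto
  have M: "\<omega> e \<le> M" if "e \<in> ball_edges (c k) R" for e
    using bl that ab unfolding block_def by (auto split: if_splits)
  have zV: "gd (c k) (c a1) \<le> L" "gd (c k) (c a2) \<le> L" using cd a1 a2 by auto
  \<comment> \<open>The competing route goes from \<open>x i\<close> to the corridor, along it from
    \<open>c a1\<close> to \<open>c a2\<close>, and on to \<open>x j\<close>.\<close>
  have "fpp_dist E \<omega> (x i) (x j) \<le> fpp_dist E \<omega> (x i) (c a1) + fpp_dist E \<omega> (c a1) (x j)"
     "fpp_dist E \<omega> (c a1) (x j) \<le> fpp_dist E \<omega> (c a1) (c a2) + fpp_dist E \<omega> (c a2) (x j)"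
    by (rule fpp_dist_tri[OF \<omega>]; use xV cV i j in auto)+
  moreover have "fpp_dist E \<omega> (c a1) (x i) \<le> M * D1"
    by (rule fpp_dist_le_short[OF \<omega> _ _ _ M])
      (use xV cV i zV D12 R ab a1 gd_sym[of "x i" "c a1"] in auto)
  moreover have "fpp_dist E \<omega> (c a2) (x j) \<le> M * D2"
    by (rule fpp_dist_le_short[OF \<omega> _ _ _ M])
      (use xV cV j zV D12 R ab a2 gd_sym[of "x j" "c a2"] in auto)
  moreover have "fpp_dist E \<omega> (c a1) (c a2) \<le> a * X"
  proof -
    have "edge_path E (c a1) (c a2) (seg c a1 a2)"
      using a1 a2 geodesic_rayD(2)[OF c] by (subst edge_path_seg) auto
    then have "fpp_dist E \<omega> (c a1) (c a2) \<le> (\<Sum>t\<in>{a1..<a2}. \<omega> {c t, c (Suc t)})"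
      using fpp_dist_le[OF \<omega>] unfolding path_weight_seg[symmetric] by blast
    also have "\<dots> \<le> (\<Sum>t\<in>{a1..<a2}. a)"
    proof (rule sum_mono)
      fix t assume t: "t \<in> {a1..<a2}"
      then have "{c t, c (Suc t)} \<in> corridor c k L" using a1 a2 unfolding corridor_def by auto
      moreover have "{c t, c (Suc t)} \<in> ball_edges (c k) R"
        using t a1 a2 ca[of t] ca[of "Suc t"] geodesic_rayD(2)[OF c] unfolding ball_edges_def by auto
      ultimately show "\<omega> {c t, c (Suc t)} \<le> a" using bl unfolding block_def by auto
    qed
    finally show ?thesis unfolding X_def by (simp add: mult.commute)
  qed
  moreover have "fpp_dist E \<omega> (x i) (c a1) = fpp_dist E \<omega> (c a1) (x i)"
    by (rule fpp_dist_sym[OF _ _ \<omega>]) (use xV cV i in auto)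
  moreover have "path_weight \<omega> (seg x i j) = fpp_dist E \<omega> (x i) (x j)"
    using fpp_geodesic_sub[OF \<omega> g near(1), of i j] j unfolding fpp_geodesic_def by auto
  ultimately have upper: "(\<Sum>t\<in>{i..<j}. \<omega> {x t, x (Suc t)}) \<le> M * (D1 + D2) + a * X"
    unfolding path_weight_seg by (simp add: algebra_simps)
  \<comment> \<open>A corridor edge used between \<open>i\<close> and \<open>j\<close> and avoiding
    \<open>c k\<close> would join the left half to the right half, whose vertices are at least 2
    apart.\<close>
  have not_corridor: "{x t, x (Suc t)} \<notin> corridor c k L" if t: "i \<le> t" "t < j" for t
  proof
    assume "{x t, x (Suc t)} \<in> corridor c k L"
    then obtain s where s: "s \<in> {k - L..<k + L}" "{x t, x (Suc t)} = {c s, c (Suc s)}"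
      unfolding corridor_def by blast
    have t_n: "t \<le> n" "Suc t \<le> n" using t j by auto
    have split: "c s \<in> Lf \<union> Rt \<union> {c k}" "c (Suc s) \<in> Lf \<union> Rt \<union> {c k}"
      using s(1) unfolding Lf_def Rt_def by (auto simp: image_iff not_less le_less) (metis greaterThanAtMost_iff atLeastLessThan_iff less_Suc_eq_le nat_less_le not_less_eq le_less_trans linorder_neqE_nat)+
    then have in_c: "x t \<in> Lf \<union> Rt" "x (Suc t) \<in> Lf \<union> Rt"
      using s(2) avoid[OF t_n(1)] avoid[OF t_n(2)] by (auto simp: doubleton_eq_iff)
    have "x (Suc t) \<in> Rt" using in_c(2) after_i[of "Suc t"] t t_n by auto
    then have "Suc t = j" using before_j[of "Suc t"] t by (cases "Suc t = j") auto
    have "t = i"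
      using in_c(1) after_i[of t] before_j[of t] t t_n by (cases "t = i") auto
    then have "x t \<in> Lf" using in_c(1) i x0_Rt by auto
    then obtain u w where uw: "u < k" "x t = c u" "k < w" "x (Suc t) = c w"
      using \<open>x (Suc t) \<in> Rt\<close> unfolding Lf_def Rt_def by auto
    have "gd (x t) (x (Suc t)) \<le> 1" using e t j gd_edge by auto
    moreover have "gd (x t) (x (Suc t)) = w - u" using uw cd by simp
    ultimately show False using uw by simp
  qed
  have low: "b \<le> \<omega> {x t, x (Suc t)}" if t: "i \<le> t" "t < j" "x t \<in> gball (c k) R" "x (Suc t) \<in> gball (c k) R" for t
  proof -
    have "{x t, x (Suc t)} \<in> ball_edges (c k) R" using t e j by (auto simp: ball_edges_def)
    then show ?thesis using bl not_corridor[OF t(1,2)] unfolding block_def by auto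
  qed
  have \<omega>0: "0 \<le> \<omega> {x t, x (Suc t)}" if "t < j" for t using \<omega> e that j unfolding nonneg_weight_def by auto
  show False
  proof (cases "\<forall>t. i \<le> t \<longrightarrow> t \<le> j \<longrightarrow> x t \<in> gball (c k) R")
    case True
    have "b * (real X - (D1 + D2)) \<le> b * real (j - i)"
    proof (rule mult_left_mono)
      have "gd (c a1) (c a2) \<le> gd (c a1) (x i) + gd (x i) (c a2)"
        "gd (x i) (c a2) \<le> gd (x i) (x j) + gd (x j) (c a2)" by (rule gd_tri; use cV xV i j in auto)+
      moreover have "gd (x i) (x j) \<le> j - i" by (rule seg_lipschitz) (use e j in auto)
      ultimately have "X \<le> (j - i) + (D1 + D2)" using a1(3) a2(3) dX gd_sym[OF xV[OF i(1)] cV[of a1]] by linarith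
      then have "real X \<le> real ((j - i) + (D1 + D2))" by (simp only: of_nat_le_iff)
      then show "real X - (D1 + D2) \<le> real (j - i)" by simp
    qed (use ab in auto)
    also have "b * real (j - i) = (\<Sum>t\<in>{i..<j}. b)" by simp
    also have "\<dots> \<le> (\<Sum>t\<in>{i..<j}. \<omega> {x t, x (Suc t)})" by (rule sum_mono) (use True low in auto)
    also note upper
    finally have *: "X * (b - a) \<le> (D1 + D2) * (M + b)" by (simp add: algebra_simps)
    \<comment> \<open>If both ends lie on the corridor there is no approach cost, so any saving
      contradicts optimality; otherwise the competing route follows at least \<open>L\<close>
      corridor edges.\<close>
    show False
    proof (cases "D1 = 0 \<and> D2 = 0")
      case True
      then have "X * (b - a) \<le> 0" using * by simp
      moreover have "X * (b - a) > 0" using X ab by simp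
      ultimately show False by simp
    next
      case False
      then have "L \<le> X" using a1 a2 kL unfolding X_def by auto
      then have "L * (b - a) \<le> X * (b - a)" using ab by (intro mult_right_mono) auto
      also note *
      also have "(D1 + D2) * (M + b) \<le> (2 * D) * (M + b)"
        using D12 ab by (intro mult_right_mono) auto
      finally show False using L by simp
    qed
  next
    case False
    define t0 where "t0 = (LEAST t. i \<le> t \<and> t \<le> j \<and> x t \<notin> gball (c k) R)"
    have t0: "i \<le> t0" "t0 \<le> j" "x t0 \<notin> gball (c k) R"
      using LeastI_ex[of "\<lambda>t. i \<le> t \<and> t \<le> j \<and> x t \<notin> gball (c k) R"] False unfolding t0_def by auto
    have inside: "x t \<in> gball (c k) R" if "i \<le> t" "t < t0" for t
      using not_less_Least[of t "\<lambda>t. i \<le> t \<and> t \<le> j \<and> x t \<notin> gball (c k) R"] that t0 unfolding t0_def by auto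
    have V: "x t0 \<in> V" "x i \<in> V" using xV t0 j i by auto
    have "gd (c k) (x t0) > R" using t0(3) V unfolding gball_def by auto
    moreover have "gd (c k) (x t0) \<le> gd (c k) (x i) + gd (x i) (x t0)" "gd (c k) (x i) \<le> gd (c k) (c a1) + gd (c a1) (x i)"
      by (rule gd_tri; use cV V in auto)+
    moreover have "gd (x i) (x t0) \<le> t0 - i" by (rule seg_lipschitz) (use e t0 j in auto)
    \<comment> \<open>\<open>t0 - 1\<close> because the edge that leaves the ball is not a ball
      edge, so \<open>b\<close> does not bound its weight.\<close>
    ultimately have len: "R - (L + D) \<le> t0 - 1 - i" using zV a1(3) D12 gd_sym[OF V(2) cV[of a1]] by linarith
    have "b * real (R - (L + D)) \<le> b * real (t0 - 1 - i)"
      using len ab by (intro mult_left_mono) auto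
    also have "\<dots> = (\<Sum>t\<in>{i..<t0 - 1}. b)" by simp
    also have "\<dots> \<le> (\<Sum>t\<in>{i..<t0 - 1}. \<omega> {x t, x (Suc t)})"
    proof (rule sum_mono)
      fix t assume t: "t \<in> {i..<t0 - 1}"
      then have "i \<le> t" "t < j" "Suc t < t0" using t0 by auto
      then show "b \<le> \<omega> {x t, x (Suc t)}" using low inside[of t] inside[of "Suc t"] by auto
    qed
    also have "\<dots> \<le> (\<Sum>t\<in>{i..<j}. \<omega> {x t, x (Suc t)})"
      by (rule sum_mono2) (use \<omega>0 t0 in auto)
    also note upper
    also have "M * (D1 + D2) + a * X \<le> M * (2 * D) + a * (2 * L)"
      using D12 X ab by (intro add_mono mult_left_mono) auto
    finally show False using R' by (simp add: algebra_simps)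
  qed
qed

end

section \<open>Bottlenecks\<close>

text \<open>A path of length \<open>n\<close> with total penalty at most \<open>T * n\<close> has passage time at most \<open>T * n\<close>, and at most
  half of its edges are lighter than \<open>\<epsilon>\<close>.\<close>

definition penalty :: "real \<Rightarrow> real \<Rightarrow> real \<Rightarrow> real" where
  "penalty T \<epsilon> x = x + (if x < \<epsilon> then 2 * T else 0)"

context bounded_graph
begin

text \<open>Removing \<open>B\<close> makes the event independent of the block inside the ball;
  restricting to paths of at most \<open>n\<close> edges starting within \<open>n\<close> of
  \<open>z\<close> makes it local, with only exponentially many paths to control.\<close>

definition good :: "'a \<Rightarrow> 'a set set \<Rightarrow> real \<Rightarrow> real \<Rightarrow> nat \<Rightarrow> ('a set \<Rightarrow> real) \<Rightarrow> bool" where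
  "good z B T \<epsilon> n \<omega> \<longleftrightarrow> (\<forall>u\<in>gball z n. \<forall>p\<in>short_paths u n. distinct p \<longrightarrow>
     (\<Sum>e\<in>path_edges p - B. penalty T \<epsilon> (\<omega> e)) \<le> T * n)"

lemma good_upper:
  assumes good: "good z B T \<epsilon> n \<omega>" and T: "0 < T" and M: "0 \<le> M" "\<And>e. e \<in> B \<Longrightarrow> \<omega> e \<le> M"
    and p: "edge_path E u w p" "distinct p" "length p \<le> Suc n" "u \<in> gball z n"
  shows "path_weight \<omega> p \<le> (T + M) * n"
proof -
  have "path_weight \<omega> p = (\<Sum>e\<in>path_edges p - B. \<omega> e) + (\<Sum>e\<in>path_edges p \<inter> B. \<omega> e)"
    unfolding path_weight_distinct[OF p(2)]
    by (subst sum.union_disjoint[symmetric]) (auto intro: arg_cong[of _ _ "sum \<omega>"])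
  also have "(\<Sum>e\<in>path_edges p - B. \<omega> e) \<le> (\<Sum>e\<in>path_edges p - B. penalty T \<epsilon> (\<omega> e))"
    using T by (intro sum_mono) (auto simp: penalty_def)
  also have "\<dots> \<le> T * n" using good p short_pathsI[OF p(1,3)] unfolding good_def by auto
  also have "(\<Sum>e\<in>path_edges p \<inter> B. \<omega> e) \<le> (\<Sum>e\<in>path_edges p \<inter> B. M)"
    by (intro sum_mono M) auto
  also have "\<dots> = card (path_edges p \<inter> B) * M" by simp
  also have "\<dots> \<le> n * M"
  proof -
    have "card (path_edges p \<inter> B) \<le> card (path_edges p)" by (rule card_mono) auto
    also have "\<dots> \<le> n" using card_path_edges[OF p(2)] p(3) by simp
    finally show ?thesis using M(1) by (intro mult_right_mono) auto
  qed
  finally show ?thesis by (simp add: algebra_simps)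
qed

text \<open>The bound \<open>\<epsilon>\<close> is asked only of those edges of \<open>B\<close>
  that lie on this path, because corridor edges in \<open>B\<close> may be lighter.\<close>

lemma good_lower:
  assumes good: "good z B T \<epsilon> n \<omega>" and T: "0 < T" and \<epsilon>: "0 < \<epsilon>"
    and \<omega>: "nonneg_weight \<omega>"
    and p: "edge_path E u w p" "distinct p" "length p = Suc n" "u \<in> gball z n"
    and B: "\<And>e. e \<in> path_edges p \<inter> B \<Longrightarrow> \<epsilon> \<le> \<omega> e"
  shows "\<epsilon> * n / 2 \<le> path_weight \<omega> p"
proof -
  define K where "K = {e \<in> path_edges p. \<omega> e < \<epsilon>}"
  have w0: "0 \<le> \<omega> e" if "e \<in> path_edges p" for e
    using path_edges_subset[OF p(1)] \<omega> that unfolding nonneg_weight_def by auto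
  have KB: "K \<subseteq> path_edges p - B" using B by (force simp: K_def)
  have "2 * T * card K = (\<Sum>e\<in>K. 2 * T)" by simp
  also have "\<dots> \<le> (\<Sum>e\<in>K. penalty T \<epsilon> (\<omega> e))"
    by (rule sum_mono) (auto simp: penalty_def K_def w0)
  also have "\<dots> \<le> (\<Sum>e\<in>path_edges p - B. penalty T \<epsilon> (\<omega> e))"
    by (rule sum_mono2) (use KB w0 T in \<open>auto simp: penalty_def\<close>)
  also have "\<dots> \<le> T * n"
    using good p short_pathsI[OF p(1), of n] unfolding good_def by auto
  finally have "T * (2 * card K) \<le> T * n" by (simp add: algebra_simps)
  then have K: "2 * real (card K) \<le> n" using T by simp
  have "\<epsilon> * n / 2 \<le> \<epsilon> * (real n - card K)" using K \<epsilon> by (simp add: field_simps)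
  also have "real n - card K = card (path_edges p - K)"
  proof -
    have "card K \<le> card (path_edges p)" by (rule card_mono) (auto simp: K_def)
    moreover have "card (path_edges p - K) = card (path_edges p) - card K"
      by (rule card_Diff_subset) (auto simp: K_def)
    ultimately show ?thesis using card_path_edges[OF p(2)] p(3) by (simp add: of_nat_diff)
  qed
  also have "\<epsilon> * card (path_edges p - K) = (\<Sum>e\<in>path_edges p - K. \<epsilon>)" by simp
  also have "\<dots> \<le> (\<Sum>e\<in>path_edges p - K. \<omega> e)"
    by (rule sum_mono) (auto simp: K_def)
  also have "\<dots> \<le> (\<Sum>e\<in>path_edges p. \<omega> e)"
    by (rule sum_mono2) (use w0 in auto)
  finally show ?thesis unfolding path_weight_distinct[OF p(2)] .
qed

text \<open>Two scales are compared: the path is heavy by \<open>good_lower\<close> at scale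
  \<open>j - i\<close>, while a word geodesic between its ends is light by \<open>good_upper\<close>
  at scale \<open>s\<close>.\<close>

lemma excursion_bound:
  assumes good: "\<And>n. 1 \<le> n \<Longrightarrow> good z B T \<epsilon> n \<omega>" and T: "0 < T" and \<epsilon>: "0 < \<epsilon>"
    and M: "0 \<le> M" "\<And>e. e \<in> B \<Longrightarrow> \<omega> e \<le> M" and pos: "\<forall>e\<in>E. 0 < \<omega> e" and z: "z \<in> V"
    and g: "fpp_geodesic E \<omega> (x i) (x j) (seg x i j)" "i < j" "x i \<in> V"
    and B: "\<And>e. e \<in> path_edges (seg x i j) \<inter> B \<Longrightarrow> \<epsilon> \<le> \<omega> e"
    and s: "1 \<le> s" "gd (x i) z \<le> s" "gd (x i) (x j) \<le> s"
  shows "real (j - i) \<le> (1 + 2 * (T + M) / \<epsilon>) * s"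
\<comment> \<open>The first case accounts for the summand 1. In the second, \<open>x i\<close> is
  within \<open>s\<close>, hence within \<open>j - i\<close>, of \<open>z\<close>, so goodness
  applies at both scales.\<close>
proof (cases "j - i \<le> s")
  case True
  then have "real (j - i) \<le> s" by (simp only: of_nat_le_iff)
  also have "\<dots> \<le> (1 + 2 * (T + M) / \<epsilon>) * s" using T M \<epsilon> by (simp add: distrib_right)
  finally show ?thesis .
next
  case False
  have \<omega>: "nonneg_weight \<omega>" using pos by (auto simp: nonneg_weight_def less_imp_le)
  define n where "n = j - i"
  have n: "s \<le> n" "1 \<le> n" using False s(1) by (auto simp: n_def)
  have len: "length (seg x i j) = Suc n" using g(2) by (simp add: n_def)
  have ep: "edge_path E (x i) (x j) (seg x i j)" using g(1) unfolding fpp_geodesic_def by blast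
  have xjV: "x j \<in> V" using edge_path_in[OF ep g(3)] g(2) by auto
  have zx: "gd z (x i) \<le> s" using s(2) gd_sym[OF z g(3)] by simp
  have "\<epsilon> * n / 2 \<le> path_weight \<omega> (seg x i j)"
    by (rule good_lower[OF good[OF n(2)] T \<epsilon> \<omega> ep fpp_geodesic_distinct[OF pos g(1,3)] len _ B])
      (use zx n g(3) in \<open>auto simp: gball_def\<close>)
  also have "\<dots> = fpp_dist E \<omega> (x i) (x j)" using g(1) unfolding fpp_geodesic_def by blast
  also have "\<dots> \<le> (T + M) * s"
  proof -
    obtain h where h: "word_geodesic h (gd (x i) (x j))" "h 0 = x i" "h (gd (x i) (x j)) = x j"
      using word_geodesic_ex[OF g(3) xjV] by auto
    have ep: "edge_path E (x i) (x j) (seg h 0 (gd (x i) (x j)))"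
      using h word_geodesicD(2)[OF h(1)] by (simp only: edge_path_seg[OF le0]) auto
    have "fpp_dist E \<omega> (x i) (x j) \<le> path_weight \<omega> (seg h 0 (gd (x i) (x j)))"
      by (rule fpp_dist_le[OF \<omega> ep])
    also have "\<dots> \<le> (T + M) * s"
      by (rule good_upper[OF good[OF s(1)] T M ep word_geodesic_distinct[OF h(1)]])
        (use s zx g(3) in \<open>auto simp: gball_def\<close>)
    finally show ?thesis .
  qed
  finally have "real n \<le> 2 * (T + M) / \<epsilon> * s" using \<epsilon> by (simp add: field_simps)
  then show ?thesis unfolding n_def by (simp add: distrib_right)
qed

end

context hyperbolic_graph
begin

text \<open>\<open>c m\<close> with \<open>m\<close> arbitrarily large replaces the boundary point,
  which avoids Gromov products with boundary points.\<close>

definition bottleneck :: "(nat \<Rightarrow> 'a) \<Rightarrow> nat \<Rightarrow> nat \<Rightarrow> ('a set \<Rightarrow> real) \<Rightarrow> bool" where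
  "bottleneck c W k \<omega> \<longleftrightarrow> (\<forall>y\<in>V. \<forall>y'\<in>V. \<forall>p m. fpp_geodesic E \<omega> y y' p \<longrightarrow> k + W \<le> m \<longrightarrow>
     gp (c 0) y (c m) \<le> real k - real W \<longrightarrow> real k + real W \<le> gp (c 0) y' (c m) \<longrightarrow> c k \<in> set p)"

text \<open>Corridor vertices are within \<open>C\<close> of a word geodesic from \<open>y\<close>
  to \<open>y'\<close>, so \<open>morse\<close> brings the path within \<open>D\<close> of both
  corridor ends, and \<open>block_crossing\<close> applies to the part in between.\<close>

lemma bottleneckI:
  fixes L D R W r C k :: nat and \<epsilon> T M a b :: real
  assumes c: "geodesic_ray c" and pos: "\<forall>e\<in>E. 0 < \<omega> e" and kL: "L \<le> k"
    and ab: "0 \<le> a" "a < b" "b \<le> M" and \<epsilon>: "0 < \<epsilon>" "\<epsilon> \<le> b" and T: "0 < T"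
    and C: "4 * \<delta> + 1 \<le> C"
    and r: "real r > 10 * \<delta> + 4" "2 * (5 * \<delta> + 2) * (1 + 2 * (T + M) / \<epsilon>) \<le> real r" "C \<le> r"
    and D: "4 * real r + 2 * real C + 2 * (5 * \<delta> + 2) \<le> real D"
    and L: "D < L" "2 * real D * (M + b) < real L * (b - a)"
    and R: "L + D \<le> R" "2 * real D * M + 2 * real L * a < b * real (R - (L + D))"
    and W: "real L + 2 * \<delta> < real W"
    and bl: "block c k L R a b M \<omega>"
    and good: "\<And>n. 1 \<le> n \<Longrightarrow> good (c (k - L)) (ball_edges (c k) R) T \<epsilon> n \<omega>"
      "\<And>n. 1 \<le> n \<Longrightarrow> good (c (k + L)) (ball_edges (c k) R) T \<epsilon> n \<omega>"
  shows "bottleneck c W k \<omega>"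
  unfolding bottleneck_def
proof (intro ballI allI impI)
  fix y y' p m
  assume V: "y \<in> V" "y' \<in> V" and p: "fpp_geodesic E \<omega> y y' p" and m: "k + W \<le> m"
    and y: "gp (c 0) y (c m) \<le> real k - real W" and y': "real k + real W \<le> gp (c 0) y' (c m)"
  have \<omega>: "nonneg_weight \<omega>" using pos by (auto simp: nonneg_weight_def less_imp_le)
  note cV = geodesic_rayD(1)[OF c]
  obtain x N where x: "p = seg x 0 N" "x 0 = y" "x N = y'" "\<And>t. t < N \<Longrightarrow> {x t, x (Suc t)} \<in> E"
    using p unfolding fpp_geodesic_def by (metis edge_path_as_seg)
  have xg: "fpp_geodesic E \<omega> (x 0) (x N) (seg x 0 N)" using p x by simp
  have xV: "x t \<in> V" if "t \<le> N" for t by (rule seg_in[of 0 N x]) (use x V that in auto)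
  define n where "n = gd y y'"
  obtain g where g: "word_geodesic g n" "g 0 = y" "g n = y'"
    using word_geodesic_ex[OF V] unfolding n_def by auto
  have near: "\<exists>t\<le>n. gd (c j) (g t) \<le> C" if j: "k - L \<le> j" "j \<le> k + L" for j
  proof -
    have "gp (c j) y y' \<le> 2 * \<delta>"
    proof (rule ray_between[OF c V _ y _ y'])
      have "L \<le> W" using W \<delta>_nonneg by linarith
      then show "j \<le> m" using j m by simp
      have "real k - real L \<le> real j" using j kL by linarith
      then show "real k - real W + 2 * \<delta> < real j" using W by linarith
      have "real j \<le> real k + real L" using j by linarith
      then show "real j + 2 * \<delta> < real k + real W" using W by linarith
    qed
    moreover obtain t where "t \<le> n" "rd (c j) (g t) \<le> gp (c j) (g 0) (g n) + 2 * \<delta> + 1"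
      using near_geodesic[OF g(1) cV] by blast
    ultimately have "t \<le> n" "rd (c j) (g t) \<le> real C" using C g by auto
    then show ?thesis by (intro exI[of _ t]) simp
  qed
  have M: "0 \<le> M" "\<And>e. e \<in> ball_edges (c k) R \<Longrightarrow> \<omega> e \<le> M"
    using ab bl unfolding block_def by (auto split: if_splits)
  have approach: "\<exists>i\<le>N. gd (x i) z \<le> D"
    if z: "z = c j" "k - L \<le> j" "j \<le> k + L" and good: "\<And>n. 1 \<le> n \<Longrightarrow> good z (ball_edges (c k) R) T \<epsilon> n \<omega>" for z j
  proof -
    have zV: "z \<in> V" using z cV by simp
    obtain u where u: "u \<le> n" "gd (c j) (g u) \<le> C" using near[OF z(2,3)] by auto
    have u': "gd (g u) z \<le> C"
      using u gd_sym[OF cV[of j] word_geodesicD(1)[OF g(1) u(1)]] z by simp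
    have "\<exists>i\<le>N. rd (x i) z \<le> 4 * real r + 2 * real C + 2 * (5 * \<delta> + 2)"
    proof (rule morse[where x = x and N = N, OF g(1) r(1,2) _ x(4) _ _ zV u(1) u'])
      show "0 \<le> 1 + 2 * (T + M) / \<epsilon>" using T M \<epsilon> by auto
      show "x 0 = g 0" "x N = g n" using x g by auto
    next
      fix i j' s
      assume ij: "Suc i < j'" "j' \<le> N" and far: "\<And>t u. i < t \<Longrightarrow> t < j' \<Longrightarrow> u \<le> n \<Longrightarrow> r < gd (x t) (g u)"
        and s: "1 \<le> s" "gd (x i) z \<le> s" "gd (x i) (x j') \<le> s"
      show "real (j' - i) \<le> (1 + 2 * (T + M) / \<epsilon>) * s"
      proof (rule excursion_bound[where x = x and i = i and j = j', OF good T \<epsilon>(1) M pos zV _ _ _ _ s])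
        show "fpp_geodesic E \<omega> (x i) (x j') (seg x i j')"
          by (rule fpp_geodesic_sub[OF \<omega> xg]) (use ij xV in auto)
        show "i < j'" "x i \<in> V" using ij xV by auto
      next
        fix e assume e: "e \<in> path_edges (seg x i j') \<inter> ball_edges (c k) R"
        then obtain t where t: "i \<le> t" "t < j'" "e = {x t, x (Suc t)}"
          using ij by (auto simp: path_edges_seg)
        \<comment> \<open>An endpoint of \<open>e\<close> strictly inside the excursion, hence
          farther than \<open>r\<close> from \<open>g\<close>; corridor vertices are within
          \<open>C\<close>, which is at most \<open>r\<close>.\<close>
        define t' where "t' = (if t = i then Suc t else t)"
        have t': "i < t'" "t' < j'" "x t' \<in> e" using t ij by (auto simp: t'_def)
        have "e \<notin> corridor c k L"
        proof
          assume "e \<in> corridor c k L"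
          then obtain q where "k - L \<le> q" "q < k + L" "e = {c q, c (Suc q)}"
            unfolding corridor_def by auto
          then obtain q where q: "k - L \<le> q" "q \<le> k + L" "x t' = c q"
            using t'(3) by (metis insertE le_SucI less_imp_le_nat Suc_leI singletonD)
          obtain u where "u \<le> n" "gd (c q) (g u) \<le> C" using near[OF q(1,2)] by auto
          then show False using far[OF t'(1,2), of u] q r(3) by simp
        qed
        then have "b \<le> \<omega> e" using bl e unfolding block_def by auto
        then show "\<epsilon> \<le> \<omega> e" using \<epsilon> by simp
      qed
    qed
    then obtain i where i: "i \<le> N" "rd (x i) z \<le> 4 * real r + 2 * real C + 2 * (5 * \<delta> + 2)" by auto
    with D have "rd (x i) z \<le> real D" by simp
    with i show ?thesis by auto
  qed
  obtain i1 where i1: "i1 \<le> N" "gd (x i1) (c (k - L)) \<le> D" using approach[of "c (k - L)" "k - L", OF refl _ _ good(1)] kL by fastforce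
  obtain i2 where i2: "i2 \<le> N" "gd (x i2) (c (k + L)) \<le> D" using approach[of "c (k + L)" "k + L", OF refl _ _ good(2)] kL by fastforce
  \<comment> \<open>The corridor ends may be approached in either order; if the right one comes
    first, the reversed path crosses from left to right.\<close>
  show "c k \<in> set p"
  proof (cases "i1 \<le> i2")
    case True
    let ?h = "\<lambda>t. x (i1 + t)"
    have seg: "seg x i1 i2 = seg ?h 0 (i2 - i1)"
      using True by (intro nth_equalityI) (auto simp: nth_seg)
    have "\<exists>t\<le>i2 - i1. ?h t = c k"
    proof (rule block_crossing[OF c kL L(1) R(1) ab L(2) R(2) \<omega> bl])
      show "fpp_geodesic E \<omega> (?h 0) (?h (i2 - i1)) (seg ?h 0 (i2 - i1))"
        using fpp_geodesic_sub[OF \<omega> xg _ True i2(1)] xV True unfolding seg by simp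
    qed (use xV i1 i2 True in auto)
    then obtain t where "t \<le> i2 - i1" "x (i1 + t) = c k" by auto
    then have "x (i1 + t) \<in> set (seg x 0 N)" using i2 True unfolding set_map by (intro imageI) auto
    then show ?thesis using \<open>x (i1 + t) = c k\<close> x by simp
  next
    case False
    then have le: "i2 \<le> i1" by simp
    let ?h = "\<lambda>t. x (i1 - t)"
    have seg: "rev (seg x i2 i1) = seg ?h 0 (i1 - i2)"
      using le by (intro nth_equalityI) (auto simp: nth_seg rev_nth)
    have "\<exists>t\<le>i1 - i2. ?h t = c k"
    proof (rule block_crossing[OF c kL L(1) R(1) ab L(2) R(2) \<omega> bl])
      have "fpp_geodesic E \<omega> (x i1) (x i2) (rev (seg x i2 i1))"
        by (rule fpp_geodesic_rev[OF _ _ \<omega>]; use xV i1 i2 fpp_geodesic_sub[OF \<omega> xg _ le i1(1)] in simp)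
      then show "fpp_geodesic E \<omega> (?h 0) (?h (i1 - i2)) (seg ?h 0 (i1 - i2))"
        using le unfolding seg by simp
    qed (use xV i1 i2 le in auto)
    then obtain t where "t \<le> i1 - i2" "x (i1 - t) = c k" by auto
    then have "x (i1 - t) \<in> set (seg x 0 N)" using i1 unfolding set_map by (intro imageI) auto
    then show ?thesis using \<open>x (i1 - t) = c k\<close> x by simp
  qed
qed

end

section \<open>From bottlenecks to the unique geodesic ray\<close>

lemma filterlim_prod_at_top:
  fixes f :: "nat \<Rightarrow> nat \<Rightarrow> real"
  shows "filterlim (\<lambda>(i, j). f i j) at_top (sequentially \<times>\<^sub>F sequentially) \<longleftrightarrow>
    (\<forall>Z. \<exists>N. \<forall>i\<ge>N. \<forall>j\<ge>N. Z \<le> f i j)"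
  unfolding filterlim_at_top eventually_prod_sequentially prod.case by blast

context hyperbolic_graph
begin

section \<open>The boundary as classes of divergent sequences\<close>

lemma gp_sym: "x \<in> V \<Longrightarrow> y \<in> V \<Longrightarrow> gp w x y = gp w y x"
  unfolding gromov_product_def using rd_sym[of x y] by simp

lemma gp_base: assumes "v \<in> V" "w \<in> V" "x \<in> V" "y \<in> V" shows "gp v x y \<le> gp w x y + rd v w"
  using rd_tri[OF assms(3,2,1)] rd_tri[OF assms(4,2,1)] rd_sym[OF assms(1,2)]
  unfolding gromov_product_def by (simp add: field_simps)

lemma gromov_sequences_iff:
  "x \<in> gromov_sequences V E w \<longleftrightarrow> (\<forall>n. x n \<in> V) \<and> (\<forall>Z. \<exists>N. \<forall>i\<ge>N. \<forall>j\<ge>N. Z \<le> gp w (x i) (x j))"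
  unfolding gromov_sequences_def filterlim_prod_at_top by auto

lemma gromov_rel_iff:
  "(x, y) \<in> gromov_rel V E w \<longleftrightarrow> x \<in> gromov_sequences V E w \<and> y \<in> gromov_sequences V E w \<and>
    (\<forall>Z. \<exists>N. \<forall>i\<ge>N. \<forall>j\<ge>N. Z \<le> gp w (x i) (y j))"
  unfolding gromov_rel_def filterlim_prod_at_top by auto

lemma equiv_gromov_rel:
  assumes w: "w \<in> V" shows "equiv (gromov_sequences V E w) (gromov_rel V E w)"
proof (rule equivI)
  show "gromov_rel V E w \<subseteq> gromov_sequences V E w \<times> gromov_sequences V E w"
    unfolding gromov_rel_def by auto
  show "refl_on (gromov_sequences V E w) (gromov_rel V E w)"
    unfolding refl_on_def gromov_rel_iff by (auto simp: gromov_sequences_iff)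
  show "sym (gromov_rel V E w)"
  proof (rule symI)
    fix x y assume xy: "(x, y) \<in> gromov_rel V E w"
    then have V: "x n \<in> V" "y n \<in> V" for n unfolding gromov_rel_iff gromov_sequences_iff by auto
    show "(y, x) \<in> gromov_rel V E w"
      using xy unfolding gromov_rel_iff gp_sym[OF V(1) V(2)] by blast
  qed
  show "trans (gromov_rel V E w)"
  proof (rule transI)
    fix x y z assume xy: "(x, y) \<in> gromov_rel V E w" and yz: "(y, z) \<in> gromov_rel V E w"
    then have V: "x n \<in> V" "y n \<in> V" "z n \<in> V" for n unfolding gromov_rel_iff gromov_sequences_iff by auto
    have "\<exists>N. \<forall>i\<ge>N. \<forall>j\<ge>N. Z \<le> gp w (x i) (z j)" for Z
    proof -
      obtain N1 where N1: "\<And>i j. N1 \<le> i \<Longrightarrow> N1 \<le> j \<Longrightarrow> Z + \<delta> \<le> gp w (x i) (y j)"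
        using xy unfolding gromov_rel_iff by meson
      obtain N2 where N2: "\<And>i j. N2 \<le> i \<Longrightarrow> N2 \<le> j \<Longrightarrow> Z + \<delta> \<le> gp w (y i) (z j)"
        using yz unfolding gromov_rel_iff by meson
      show ?thesis
      proof (intro exI[of _ "max N1 N2"] allI impI)
        fix i j assume "max N1 N2 \<le> i" "max N1 N2 \<le> j"
        then show "Z \<le> gp w (x i) (z j)"
          using hyperbolic[OF w V(1)[of i] V(2)[of "max N1 N2"] V(3)[of j]]
            N1[of i "max N1 N2"] N2[of "max N1 N2" j] by (simp add: min_def split: if_splits)
      qed
    qed
    with xy yz show "(x, z) \<in> gromov_rel V E w" unfolding gromov_rel_iff by blast
  qed
qed

lemma gp_ray: "geodesic_ray c \<Longrightarrow> gp (c 0) (c i) (c j) = min (real i) (real j)"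
  using geodesic_rayD(3)[of c] unfolding gromov_product_def by (auto simp: min_def)

lemma divergence_base:
  assumes vw: "v \<in> V" "w \<in> V" and V: "\<And>n. x n \<in> V" "\<And>n. y n \<in> V"
    and div: "\<forall>Z. \<exists>N. \<forall>i\<ge>N. \<forall>j\<ge>N. Z \<le> gp v (x i) (y j)"
  shows "\<forall>Z. \<exists>N. \<forall>i\<ge>N. \<forall>j\<ge>N. Z \<le> gp w (x i) (y j)"
proof
  fix Z
  obtain N where N: "\<And>i j. N \<le> i \<Longrightarrow> N \<le> j \<Longrightarrow> Z + rd v w \<le> gp v (x i) (y j)" using div by meson
  have "Z \<le> gp w (x i) (y j)" if "N \<le> i" "N \<le> j" for i j
    using N[OF that] gp_base[OF vw V(1)[of i] V(2)[of j]] by simp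
  then show "\<exists>N. \<forall>i\<ge>N. \<forall>j\<ge>N. Z \<le> gp w (x i) (y j)" by auto
qed

text \<open>By local finiteness, the word geodesics from \<open>v\<close> to the points of a sequence
  representing \<open>\<xi>\<close> have a limit (Koenig's lemma).\<close>

lemma geodesic_ray_ex:
  assumes v: "v \<in> V" and w: "w \<in> V" and \<xi>: "\<xi> \<in> gromov_boundary V E w"
  shows "\<exists>c. geodesic_ray c \<and> c 0 = v \<and> c \<in> \<xi>"
proof -
  note eq = equiv_gromov_rel[OF w]
  obtain a where a: "a \<in> \<xi>" using in_quotient_imp_non_empty[OF eq] \<xi> unfolding gromov_boundary_def by blast
  have "(a, a) \<in> gromov_rel V E w"
    using in_quotient_imp_in_rel[OF eq] \<xi> a unfolding gromov_boundary_def by blast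
  then have a_seq: "a \<in> gromov_sequences V E w" unfolding gromov_rel_iff by simp
  then have aV: "a n \<in> V" for n unfolding gromov_sequences_iff by simp
  have a_div: "\<forall>Z. \<exists>N. \<forall>i\<ge>N. \<forall>j\<ge>N. Z \<le> gp v (a i) (a j)"
    by (rule divergence_base[OF w v aV aV]) (use a_seq in \<open>simp add: gromov_sequences_iff\<close>)
  define l where "l n = gd v (a n)" for n
  have "\<forall>n. \<exists>g. word_geodesic g (l n) \<and> g 0 = v \<and> g (l n) = a n"
    unfolding l_def using word_geodesic_ex[OF v aV] by blast
  then obtain g where g: "\<And>n. word_geodesic (g n) (l n)" "\<And>n. g n 0 = v" "\<And>n. g n (l n) = a n" by metis
  have l_inf: "\<exists>N. \<forall>n\<ge>N. s \<le> l n" for s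
  proof -
    obtain N where N: "\<And>i j. N \<le> i \<Longrightarrow> N \<le> j \<Longrightarrow> real s \<le> gp v (a i) (a j)" using a_div by meson
    have "s \<le> l n" if "N \<le> n" for n
      using N[OF that that] rd_sym[OF aV v] unfolding gromov_product_def l_def by simp
    then show ?thesis by auto
  qed
  \<comment> \<open>Indices whose geodesic follows \<open>p\<close> up to time \<open>s\<close>. The
    choice fixes one more vertex, out of finitely many neighbours, and keeps this set
    infinite.\<close>
  define M where "M s p = {n. s \<le> l n \<and> (\<forall>t\<le>s. g n t = p t)}" for s p
  have "\<exists>f. \<forall>s. infinite (M s (f s)) \<and> (\<forall>t\<le>s. f (Suc s) t = f s t)"
  proof (rule dependent_nat_choice)
    have "M 0 (\<lambda>_. v) = UNIV" unfolding M_def using g by auto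
    then show "\<exists>p. infinite (M 0 p)" by (intro exI[of _ "\<lambda>_. v"]) simp
  next
    fix p s assume p: "infinite (M s p)"
    obtain N where N: "\<And>n. N \<le> n \<Longrightarrow> Suc s \<le> l n" using l_inf[of "Suc s"] by auto
    define A where "A = M s p - {..<N}"
    have A: "infinite A" unfolding A_def using p by (rule Diff_infinite_finite[rotated]) simp
    have "g n (Suc s) \<in> {y. {p s, y} \<in> E}" if "n \<in> A" for n
    proof -
      have "n \<in> M s p" "N \<le> n" using that unfolding A_def by auto
      then have "s < l n" "g n s = p s" using N[of n] unfolding M_def by auto
      then show ?thesis using word_geodesicD(2)[OF g(1), of s n] by simp
    qed
    then have sub: "(\<lambda>n. g n (Suc s)) ` A \<subseteq> {y. {p s, y} \<in> E}" by auto
    have "A \<noteq> {}" using A by auto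
    then obtain n0 where "n0 \<in> A" by blast
    then have "{p s, g n0 (Suc s)} \<in> E" using sub by auto
    then have "finite {y. {p s, y} \<in> E}" using edge_in degree by blast
    then have "finite ((\<lambda>n. g n (Suc s)) ` A)" using sub finite_subset by blast
    then obtain n1 where n1: "n1 \<in> A" "infinite {n \<in> A. g n (Suc s) = g n1 (Suc s)}"
      using pigeonhole_infinite[OF A] by auto
    define q where "q = p(Suc s := g n1 (Suc s))"
    have "{n \<in> A. g n (Suc s) = g n1 (Suc s)} \<subseteq> M (Suc s) q"
      using N unfolding A_def M_def q_def by (auto simp: le_Suc_eq not_less)
    then have "infinite (M (Suc s) q)" using n1(2) finite_subset by blast
    moreover have "\<forall>t\<le>s. q t = p t" unfolding q_def by auto
    ultimately show "\<exists>q. infinite (M (Suc s) q) \<and> (\<forall>t\<le>s. q t = p t)" by blast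
  qed
  then obtain f where f: "\<And>s. infinite (M s (f s))" "\<And>s t. t \<le> s \<Longrightarrow> f (Suc s) t = f s t" by blast
  define c where "c s = f s s" for s
  have fc: "f s t = c t" if "t \<le> s" for s t
    using that
  proof (induction s rule: dec_induct)
    case (step s)
    then show ?case using f(2)[of t s] by simp
  qed (simp add: c_def)
  have inf: "\<exists>m\<ge>N. s \<le> l m \<and> (\<forall>t\<le>s. g m t = c t)" for s N
  proof -
    obtain m where "m \<ge> N" "m \<in> M s (f s)"
      using f(1)[of s] by (meson infinite_nat_iff_unbounded_le)
    then show ?thesis using fc[of _ s] unfolding M_def by auto
  qed
  have ray: "geodesic_ray c"
    unfolding geodesic_ray_def
  proof
    fix s
    obtain m where m: "s \<le> l m" "\<And>t. t \<le> s \<Longrightarrow> g m t = c t" using inf[of 0 s] by auto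
    have "word_geodesic (g m) s" using g(1)[of m] m(1) unfolding word_geodesic_def by auto
    then show "word_geodesic c s" unfolding word_geodesic_def by (simp add: m(2))
  qed
  have c0: "c 0 = v" using inf[of 0 0] g(2) by auto
  note cV = geodesic_rayD(1)[OF ray]
  have c_seq: "c \<in> gromov_sequences V E w"
    unfolding gromov_sequences_iff
  proof (intro conjI allI[of "\<lambda>n. c n \<in> V"] cV)
    have "\<exists>N. \<forall>i\<ge>N. \<forall>j\<ge>N. Z \<le> gp v (c i) (c j)" for Z
    proof (intro exI[of _ "nat \<lceil>Z\<rceil>"] allI impI)
      fix i j assume "nat \<lceil>Z\<rceil> \<le> i" "nat \<lceil>Z\<rceil> \<le> j"
      then show "Z \<le> gp v (c i) (c j)" using gp_ray[OF ray, of i j] c0 by (simp add: min_def)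
    qed
    then show "\<forall>Z. \<exists>N. \<forall>i\<ge>N. \<forall>j\<ge>N. Z \<le> gp w (c i) (c j)"
      by (intro divergence_base[OF v w cV cV]) blast
  qed
  have "\<exists>N. \<forall>i\<ge>N. \<forall>j\<ge>N. Z \<le> gp v (c i) (a j)" for Z
  proof -
    obtain N where N: "\<And>i j. N \<le> i \<Longrightarrow> N \<le> j \<Longrightarrow> Z + \<delta> \<le> gp v (a i) (a j)" using a_div by meson
    show ?thesis
    proof (intro exI[of _ "max N (nat \<lceil>Z + \<delta>\<rceil>)"] allI impI)
      fix i j assume ij: "max N (nat \<lceil>Z + \<delta>\<rceil>) \<le> i" "max N (nat \<lceil>Z + \<delta>\<rceil>) \<le> j"
      obtain m where m: "N \<le> m" "i \<le> l m" "\<And>t. t \<le> i \<Longrightarrow> g m t = c t" using inf[of N i] by auto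
      have "gd (c i) (a m) = l m - i" using word_geodesicD(3)[OF g(1)[of m] m(2)] m(3) g(3) by simp
      moreover have "rd (c i) v = i" using geodesic_rayD(3)[OF ray, of i 0] c0 by simp
      moreover have "rd (a m) v = l m" using rd_sym[OF aV v] by (simp add: l_def)
      \<comment> \<open>\<open>c i\<close> lies on the geodesic from \<open>v\<close> to
        \<open>a m\<close>; hyperbolicity then passes from \<open>a m\<close> to every late
        \<open>a j\<close>.\<close>
      ultimately have "gp v (c i) (a m) = i" using m(2) unfolding gromov_product_def by (simp add: of_nat_diff)
      moreover have "Z + \<delta> \<le> real i" using ij by linarith
      ultimately show "Z \<le> gp v (c i) (a j)"
        using hyperbolic[OF v cV[of i] aV[of m] aV[of j]] N[OF m(1), of j] ij
        by (simp add: min_def split: if_splits)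
    qed
  qed
  then have "\<forall>Z. \<exists>N. \<forall>i\<ge>N. \<forall>j\<ge>N. Z \<le> gp w (c i) (a j)"
    by (intro divergence_base[OF v w cV aV]) blast
  then have "(c, a) \<in> gromov_rel V E w" unfolding gromov_rel_iff using c_seq a_seq by blast
  then have "(a, c) \<in> gromov_rel V E w" using eq unfolding equiv_def sym_def by blast
  then have "c \<in> \<xi>" using in_quotient_imp_closed[OF eq _ a] \<xi> unfolding gromov_boundary_def by blast
  with ray c0 show ?thesis by blast
qed

lemma geodesic_path_le: "edge_path E x y p \<Longrightarrow> gd x y < length p"
  using gd_le[of x y p] by (cases p) auto

text \<open>The geodesics from \<open>c 0\<close> to successive bottlenecks extend one another,
  since each passes through the earlier bottlenecks and finite geodesics are unique; their union is
  the ray. Any other ray towards \<open>\<xi>\<close> visits the same bottlenecks and has the same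
  parts up to them.\<close>

lemma unique_ray:
  assumes c: "geodesic_ray c" and pos: "\<forall>e\<in>E. 0 < \<omega> e"
    and unique: "\<And>y y'. y \<in> V \<Longrightarrow> y' \<in> V \<Longrightarrow> \<exists>!p. fpp_geodesic E \<omega> y y' p"
    and inf: "infinite {k. bottleneck c W k \<omega>}"
    and w: "w \<in> V" and \<xi>: "\<xi> \<in> gromov_boundary V E w" "c \<in> \<xi>"
  shows "\<exists>!x. fpp_geodesic_ray E \<omega> x \<and> x 0 = c 0 \<and> has_direction V E w x \<xi>"
proof -
  have \<omega>: "nonneg_weight \<omega>" using pos by (auto simp: nonneg_weight_def less_imp_le)
  note cV = geodesic_rayD(1)[OF c]
  note eq = equiv_gromov_rel[OF w]
  have rel_iff: "x \<in> \<eta> \<longleftrightarrow> (y, x) \<in> gromov_rel V E w" if "\<eta> \<in> gromov_boundary V E w" "y \<in> \<eta>" for \<eta> x y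
    using in_quotient_imp_in_rel[OF eq] in_quotient_imp_closed[OF eq] that
    unfolding gromov_boundary_def by blast
  have ray_sub: "fpp_geodesic E \<omega> (x i) (x j) (seg x i j)" if "fpp_geodesic_ray E \<omega> x" "i \<le> j" for x i j
    using that unfolding fpp_geodesic_ray_def by simp
  have behind: "gp (c 0) (c 0) (c m) \<le> real k - real W" if "W \<le> k" for m k
    using gp_ray[OF c, of 0 m] that by simp
  \<comment> \<open>\<open>W \<le> k\<close> puts the starting point \<open>c 0\<close> behind the
    bottleneck.\<close>
  define K where "K = {k. bottleneck c W k \<omega> \<and> W \<le> k}"
  have K: "\<exists>k\<in>K. N \<le> k" for N
  proof (rule ccontr)
    assume "\<not> ?thesis"
    then have "{k. bottleneck c W k \<omega>} \<subseteq> {..max N W}" unfolding K_def by (auto simp: not_le)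
    then show False using inf finite_subset by blast
  qed
  have bn: "c k \<in> set p" if "k \<in> K" "y \<in> V" "y' \<in> V" "fpp_geodesic E \<omega> y y' p" "k + W \<le> m"
     "gp (c 0) y (c m) \<le> real k - real W" "real k + real W \<le> gp (c 0) y' (c m)" for k y y' p m
    using that unfolding K_def bottleneck_def by blast
  have distinct_ray: "s = t" if x: "fpp_geodesic_ray E \<omega> x" "x 0 \<in> V" "x s = x t" for x s t
  proof -
    have "distinct (seg x 0 (max s t))"
      by (rule fpp_geodesic_distinct[OF pos ray_sub[OF x(1)] x(2)]) auto
    then have "inj_on x {0..<Suc (max s t)}" by (simp add: distinct_map)
    then show ?thesis using x(3) by (auto dest!: inj_onD[of _ _ s t])
  qed
  show ?thesis
  proof (rule ex_ex1I)
    \<comment> \<open>Gaps larger than \<open>W\<close> put \<open>c (\<kappa> m)\<close> ahead of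
      the bottleneck at \<open>\<kappa> n\<close> whenever \<open>n < m\<close>.\<close>
    obtain \<kappa> where \<kappa>: "\<And>n. \<kappa> n \<in> K" "\<And>n. \<kappa> n + W + 1 \<le> \<kappa> (Suc n)"
      using dependent_nat_choice[of "\<lambda>_ k. k \<in> K" "\<lambda>_ k k'. k + W + 1 \<le> k'"] K by meson
    have \<kappa>_mono: "\<kappa> n + W < \<kappa> m" if "n < m" for n m
      using that
    proof (induction m)
      case (Suc m)
      then show ?case using \<kappa>(2)[of m] by (cases "n = m") auto
    qed simp
    have \<kappa>_ge: "n \<le> \<kappa> n" for n
    proof (induction n)
      case (Suc n)
      then show ?case using \<kappa>(2)[of n] by simp
    qed simp
    define P where "P k = (THE p. fpp_geodesic E \<omega> (c 0) (c k) p)" for k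
    have P: "fpp_geodesic E \<omega> (c 0) (c k) (P k)" for k
      unfolding P_def by (rule theI'[OF unique[OF cV cV]])
    have P_eq: "p = P k" if "fpp_geodesic E \<omega> (c 0) (c k) p" for p k
      using unique[OF cV cV] P that by blast
    have Pe: "edge_path E (c 0) (c k) (P k)" for k using P[of k] unfolding fpp_geodesic_def by simp
    have P_nth: "P k ! 0 = c 0" "P k ! (length (P k) - 1) = c k" "P k = seg (nth (P k)) 0 (length (P k) - 1)" for k
      using edge_pathD(2,3,4)[OF Pe] by auto
    have Plen: "k < length (P k)" for k using geodesic_path_le[OF Pe[of k]] geodesic_ray_gd(1)[OF c, of 0 k] by simp
    have P': "fpp_geodesic E \<omega> (c 0) (c k) (seg (nth (P k)) 0 (length (P k) - 1))" for k
      unfolding P_nth(3)[symmetric] by (rule P)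
    have sub: "fpp_geodesic E \<omega> (P k ! i) (P k ! j) (seg (nth (P k)) i j)" if "i \<le> j" "j < length (P k)" for i j k
      by (rule fpp_geodesic_sub[OF \<omega> P'[of k] cV that(1)]) (use that in auto)
    have prefix: "\<exists>t<length (P (\<kappa> m)). P (\<kappa> n) = take (Suc t) (P (\<kappa> m))" if "n < m" for n m
    proof -
      have "c (\<kappa> n) \<in> set (P (\<kappa> m))"
        by (rule bn[OF \<kappa>(1) cV cV P, of _ "\<kappa> m"])
          (use \<kappa>_mono[OF that] behind \<kappa>(1)[of n] gp_ray[OF c, of "\<kappa> m" "\<kappa> m"] in \<open>auto simp: K_def\<close>)
      then obtain t where t: "t < length (P (\<kappa> m))" "P (\<kappa> m) ! t = c (\<kappa> n)" by (auto simp: in_set_conv_nth)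
      have "seg (nth (P (\<kappa> m))) 0 t = P (\<kappa> n)"
        by (rule P_eq) (use sub[of 0 t "\<kappa> m"] t P_nth(1)[of "\<kappa> m"] in simp)
      moreover have "seg (nth (P (\<kappa> m))) 0 t = take (Suc t) (P (\<kappa> m))"
        using t(1) by (intro nth_equalityI) (auto simp: nth_seg)
      ultimately show ?thesis using t(1) by auto
    qed
    \<comment> \<open>The index \<open>i\<close> is in range because \<open>P (\<kappa> i)\<close>
      has more than \<open>\<kappa> i\<close> vertices and \<open>\<kappa> i\<close> is at least
      \<open>i\<close>.\<close>
    define x where "x i = P (\<kappa> i) ! i" for i
    define \<tau> where "\<tau> n = length (P (\<kappa> n)) - 1" for n
    have \<tau>: "\<kappa> n \<le> \<tau> n" "length (P (\<kappa> n)) = Suc (\<tau> n)" for n using Plen[of "\<kappa> n"] unfolding \<tau>_def by auto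
    have x_eq: "x i = P (\<kappa> n) ! i" if "i \<le> n" for i n
    proof (cases "i = n")
      case False
      then obtain t where "t < length (P (\<kappa> n))" "P (\<kappa> i) = take (Suc t) (P (\<kappa> n))"
        using prefix[of i n] \<open>i \<le> n\<close> by auto
      moreover have "i < length (P (\<kappa> i))" using Plen[of "\<kappa> i"] \<kappa>_ge[of i] by simp
      ultimately show ?thesis unfolding x_def by simp
    qed (simp add: x_def)
    have "fpp_geodesic E \<omega> (x i) (x j) (seg x i j)" if "i \<le> j" for i j
    proof -
      have eq: "seg x i j = seg (nth (P (\<kappa> j))) i j" using x_eq[of _ j] by auto
      have len: "j < length (P (\<kappa> j))" using Plen[of "\<kappa> j"] \<kappa>_ge[of j] by simp
      show ?thesis unfolding eq x_eq[OF that] x_eq[OF order_refl[of j]] by (rule sub[OF that len])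
    qed
    then have ray: "fpp_geodesic_ray E \<omega> x" unfolding fpp_geodesic_ray_def by simp
    have x0: "x 0 = c 0" unfolding x_def by (rule P_nth)
    have x\<tau>: "x (\<tau> n) = c (\<kappa> n)" for n
    proof -
      have n: "n \<le> \<tau> n" using \<kappa>_ge[of n] \<tau>(1)[of n] by simp
      have "P (\<kappa> (\<tau> n)) ! (\<tau> n) = P (\<kappa> n) ! (\<tau> n)"
      proof (cases "n = \<tau> n")
        case False
        then obtain t where "t < length (P (\<kappa> (\<tau> n)))" "P (\<kappa> n) = take (Suc t) (P (\<kappa> (\<tau> n)))"
          using prefix[of n "\<tau> n"] n by auto
        with \<tau>(2)[of n] show ?thesis by (metis lessI nth_take length_take min_less_iff_conj)
      qed auto
      then show ?thesis unfolding x_def using P_nth(2)[of "\<kappa> n"] by (simp add: \<tau>_def)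
    qed
    have \<tau>_mono: "strict_mono \<tau>"
    proof (rule strict_monoI)
      fix n m :: nat assume nm: "n < m"
      obtain t where t: "t < length (P (\<kappa> m))" "P (\<kappa> n) = take (Suc t) (P (\<kappa> m))" using prefix[OF nm] by auto
      then have "\<tau> n = t" unfolding \<tau>_def by simp
      moreover have "t \<noteq> \<tau> m"
      proof
        assume "t = \<tau> m"
        then have "P (\<kappa> n) = P (\<kappa> m)" using t \<tau>(2)[of m] by simp
        then have "c (\<kappa> n) = c (\<kappa> m)" using P_nth(2) by metis
        then show False using geodesic_ray_inj[OF c] \<kappa>_mono[OF nm] by fastforce
      qed
      ultimately show "\<tau> n < \<tau> m" using t(1) \<tau>(2)[of m] by simp
    qed
    have xV: "x i \<in> V" for i
      using ray_sub[OF ray, of 0 i] edge_path_in[of "x 0" "x i" "seg x 0 i"] x0 cV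
      unfolding fpp_geodesic_def by (auto)
    have "accumulates_at x \<xi>"
      unfolding accumulates_at_def
    proof (intro exI[of _ \<tau>] conjI \<tau>_mono)
      have c_seq: "\<forall>Z. \<exists>N. \<forall>i\<ge>N. \<forall>j\<ge>N. Z \<le> gp w (c i) (c j)"
        using rel_iff[OF \<xi>(1,2), of c] \<xi>(2) unfolding gromov_rel_iff gromov_sequences_iff by blast
      have "\<forall>Z. \<exists>N. \<forall>i\<ge>N. \<forall>j\<ge>N. Z \<le> gp w (c (\<kappa> i)) (c (\<kappa> j))"
        "\<forall>Z. \<exists>N. \<forall>i\<ge>N. \<forall>j\<ge>N. Z \<le> gp w (c i) (c (\<kappa> j))"
        using c_seq by (meson \<kappa>_ge order_trans)+
      then have "(c, c \<circ> \<kappa>) \<in> gromov_rel V E w"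
        using c_seq cV unfolding gromov_rel_iff gromov_sequences_iff by auto
      then have "c \<circ> \<kappa> \<in> \<xi>" using rel_iff[OF \<xi>] by blast
      moreover have "x \<circ> \<tau> = c \<circ> \<kappa>" using x\<tau> by auto
      ultimately show "x \<circ> \<tau> \<in> \<xi>" by simp
    qed
    \<comment> \<open>If a subsequence went elsewhere, some late \<open>x (r i)\<close> would lie
      behind a bottleneck already passed; the tail from it to a later bottleneck would visit that
      vertex again, contrary to injectivity of the ray.\<close>
    moreover have "\<eta> = \<xi>" if \<eta>: "\<eta> \<in> gromov_boundary V E w" "accumulates_at x \<eta>" for \<eta>
    proof (rule ccontr)
      assume ne: "\<eta> \<noteq> \<xi>"
      obtain r where r: "strict_mono r" "x \<circ> r \<in> \<eta>" using \<eta>(2) unfolding accumulates_at_def by auto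
      have "(x \<circ> r, c) \<notin> gromov_rel V E w"
      proof
        assume "(x \<circ> r, c) \<in> gromov_rel V E w"
        then have "c \<in> \<eta>" using rel_iff[OF \<eta>(1) r(2)] by simp
        with \<xi> \<eta>(1) have "\<eta> = \<xi>"
          using quotient_disj[OF eq, of \<eta> \<xi>] unfolding gromov_boundary_def by blast
        with ne show False ..
      qed
      moreover have "x \<circ> r \<in> gromov_sequences V E w" "c \<in> gromov_sequences V E w"
        using rel_iff[OF \<eta>(1) r(2), of "x \<circ> r"] rel_iff[OF \<xi>, of c] r(2) \<xi>(2) unfolding gromov_rel_iff by blast+
      ultimately obtain Z where Z: "\<And>N. \<exists>i\<ge>N. \<exists>j\<ge>N. gp w (x (r i)) (c j) < Z"
        unfolding gromov_rel_iff by (auto simp: not_le)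
      \<comment> \<open>Chosen so that a product below \<open>Z\<close> at base point
        \<open>w\<close> means lying behind \<open>c (\<kappa> n)\<close> after moving the base
        point to \<open>c 0\<close>.\<close>
      define n where "n = W + nat \<lceil>Z + rd (c 0) w\<rceil>"
      have k_ge: "real W + Z + rd (c 0) w \<le> real (\<kappa> n)" using \<kappa>_ge[of n] unfolding n_def by linarith
      obtain i j where ij: "max (\<tau> n + 1) (\<kappa> n + W) \<le> i" "max (\<tau> n + 1) (\<kappa> n + W) \<le> j" "gp w (x (r i)) (c j) < Z"
        using Z[of "max (\<tau> n + 1) (\<kappa> n + W)"] by auto
      have ri: "i \<le> r i" using r(1) by (rule strict_mono_imp_increasing)
      define m where "m = max (r i) (\<kappa> n + W)"
      have m: "r i \<le> \<tau> m" "\<kappa> n + W \<le> \<kappa> m" using \<kappa>_ge[of m] \<tau>(1)[of m] unfolding m_def by linarith+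
      have "gp (c 0) (x (r i)) (c j) \<le> real (\<kappa> n) - real W"
        using gp_base[OF cV[of 0] w xV[of "r i"] cV[of j]] ij(3) k_ge by linarith
      moreover have "real (\<kappa> n) + real W \<le> gp (c 0) (c (\<kappa> m)) (c j)"
        using m(2) ij(2) unfolding gp_ray[OF c] by auto
      ultimately have "c (\<kappa> n) \<in> set (seg x (r i) (\<tau> m))"
        using bn[where k = "\<kappa> n" and m = j and p = "seg x (r i) (\<tau> m)", OF \<kappa>(1) xV[of "r i"] cV[of "\<kappa> m"]] ij(2) ray_sub[OF ray m(1)] x\<tau>[of m] by simp
      then obtain t where t: "r i \<le> t" "x t = c (\<kappa> n)" by (auto)
      have "t = \<tau> n" by (rule distinct_ray[OF ray]) (use x0 cV t x\<tau> in auto)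
      with t ri ij(1) show False by simp
    qed
    ultimately have "has_direction V E w x \<xi>" using \<xi>(1) unfolding has_direction_def by blast
    with ray x0 show "\<exists>x. fpp_geodesic_ray E \<omega> x \<and> x 0 = c 0 \<and> has_direction V E w x \<xi>" by blast
  next
    fix x y
    assume x: "fpp_geodesic_ray E \<omega> x \<and> x 0 = c 0 \<and> has_direction V E w x \<xi>"
      and y: "fpp_geodesic_ray E \<omega> y \<and> y 0 = c 0 \<and> has_direction V E w y \<xi>"
    have pass: "\<exists>t. x t = c k"
      if k: "k \<in> K" and x: "fpp_geodesic_ray E \<omega> x" "x 0 = c 0" "has_direction V E w x \<xi>" for x k
    proof -
      have xV: "x i \<in> V" for i
        using ray_sub[OF x(1), of 0 i] edge_path_in[of "x 0" "x i" "seg x 0 i"] x(2) cV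
        unfolding fpp_geodesic_def by (auto)
      have "accumulates_at x \<xi>" using x(3) unfolding has_direction_def by blast
      then obtain r where r: "x \<circ> r \<in> \<xi>" unfolding accumulates_at_def by auto
      have "(x \<circ> r, c) \<in> gromov_rel V E w" using rel_iff[OF \<xi>(1) r] \<xi>(2) by blast
      then obtain N where N: "\<And>i j. N \<le> i \<Longrightarrow> N \<le> j \<Longrightarrow> real k + real W + rd w (c 0) \<le> gp w (x (r i)) (c j)"
        unfolding gromov_rel_iff by (auto simp: comp_def) meson
      have "real k + real W \<le> gp (c 0) (x (r N)) (c (max N (k + W)))"
        using N[of N "max N (k + W)"] gp_base[OF w cV[of 0] xV[of "r N"] cV[of "max N (k + W)"]] by simp
      moreover have "W \<le> k" using k by (simp add: K_def)
      ultimately have "c k \<in> set (seg x 0 (r N))"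
        using bn[where m = "max N (k + W)", OF k xV[of 0] xV[of "r N"] ray_sub[OF x(1) le0]] behind[of k "max N (k + W)"] x(2) by simp
      then show ?thesis by (auto)
    qed
    show "x = y"
    proof
      fix s
      obtain k where k: "k \<in> K" "s \<le> k" using K by blast
      obtain t t' where t: "x t = c k" "y t' = c k" using pass[OF k(1)] x y by meson
      have gx: "fpp_geodesic E \<omega> (c 0) (c k) (seg x 0 t)" using ray_sub[of x 0 t] x t by simp
      have gy: "fpp_geodesic E \<omega> (c 0) (c k) (seg y 0 t')" using ray_sub[of y 0 t'] y t by simp
      have eq: "seg x 0 t = seg y 0 t'" using unique[OF cV cV] gx gy by blast
      then have "length (seg x 0 t) = length (seg y 0 t')" by (rule arg_cong)
      then have tt: "t = t'" by simp
      have "edge_path E (c 0) (c k) (seg x 0 t)" using gx unfolding fpp_geodesic_def by blast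
      \<comment> \<open>The ray cannot reach \<open>c k\<close> before time \<open>k\<close>, its
        word distance from the start.\<close>
      from geodesic_path_le[OF this] have "k < length (seg x 0 t)"
        using geodesic_ray_gd(1)[OF c, of 0 k] by simp
      then have "s \<le> t" using k by simp
      then show "x s = y s" using eq nth_seg[of s t 0 x] nth_seg[of s t 0 y] tt by simp
    qed
  qed
qed

end

section \<open>Almost sure properties of the weights\<close>

text \<open>Where the paths first separate, the edge of \<open>p\<close> starts at a common vertex
  that \<open>q\<close> visits only once, entering it from the common past and leaving it
  differently; so \<open>q\<close> does not contain this edge.\<close>

lemma distinct_paths_edge:
  assumes p: "edge_path E a b p" "distinct p" and q: "edge_path E a b q" "distinct q" and ne: "p \<noteq> q"
  shows "\<exists>e. e \<in> path_edges p \<and> e \<notin> path_edges q \<or> e \<in> path_edges q \<and> e \<notin> path_edges p"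
proof -
  obtain x n where x: "p = seg x 0 n" "x 0 = a" "x n = b" by (rule edge_path_as_seg[OF p(1)])
  obtain y m where y: "q = seg y 0 m" "y 0 = a" "y m = b" by (rule edge_path_as_seg[OF q(1)])
  have inj: "inj_on x {0..<Suc n}" "inj_on y {0..<Suc m}" using p(2) q(2) x(1) y(1) by (auto simp: distinct_map)
  \<comment> \<open>Without separation one path would be an initial part of the other, and the
    longer one would visit their common end twice.\<close>
  have "\<exists>t. t \<le> n \<and> t \<le> m \<and> x t \<noteq> y t"
  proof (rule ccontr)
    assume "\<not> ?thesis"
    then have eq: "x t = y t" if "t \<le> n" "t \<le> m" for t using that by auto
    have "n = m"
    proof (cases "n \<le> m")
      case True
      then have "y n = y m" using eq[of n] x y by simp
      then show ?thesis using inj_onD[OF inj(2), of n m] True by simp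
    next
      case False
      then have "x m = x n" using eq[of m] x y by simp
      then show ?thesis using inj_onD[OF inj(1), of m n] False by simp
    qed
    then have "p = q" unfolding x(1) y(1) using eq by (intro map_cong) auto
    with ne show False ..
  qed
  then obtain t0 where t0: "t0 \<le> n \<and> t0 \<le> m \<and> x t0 \<noteq> y t0" by auto
  define t where "t = (LEAST t. t \<le> n \<and> t \<le> m \<and> x t \<noteq> y t)"
  have t: "t \<le> n" "t \<le> m" "x t \<noteq> y t"
    using LeastI[of "\<lambda>t. t \<le> n \<and> t \<le> m \<and> x t \<noteq> y t", OF t0] unfolding t_def by auto
  have before: "x s = y s" if "s < t" for s
    using not_less_Least[of s "\<lambda>t. t \<le> n \<and> t \<le> m \<and> x t \<noteq> y t"] that t unfolding t_def[symmetric] by auto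
  obtain i where i: "t = Suc i" using t(3) x(2) y(2) by (cases t) auto
  have xi: "x i = y i" using before[of i] i by simp
  have "{x i, x (Suc i)} \<in> path_edges p" unfolding x(1) using t i by (auto simp: path_edges_seg)
  moreover have "{x i, x (Suc i)} \<notin> path_edges q"
  proof
    assume "{x i, x (Suc i)} \<in> path_edges q"
    then obtain s where s: "s < m" "{x i, x (Suc i)} = {y s, y (Suc s)}"
      unfolding y(1) by (auto simp: path_edges_seg)
    consider "y i = y s" "x (Suc i) = y (Suc s)" | "y i = y (Suc s)" "x (Suc i) = y s"
      using s(2) xi by (auto simp: doubleton_eq_iff)
    then show False
    proof cases
      case 1
      then have "i = s" using inj_onD[OF inj(2), of i s] t i s by simp
      with 1 t i show False by simp
    next
      case 2
      then have "i = Suc s" using inj_onD[OF inj(2), of i "Suc s"] t i s by simp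
      then have "x (Suc i) = x s" using 2 before[of s] i by simp
      then show False using inj_onD[OF inj(1), of "Suc i" s] t i \<open>i = Suc s\<close> by simp
    qed
  qed
  ultimately show ?thesis by blast
qed

section \<open>Existence and uniqueness of finite geodesics\<close>

context bounded_graph
begin

lemma loop_erasure:
  assumes \<omega>: "nonneg_weight \<omega>" and V: "a \<in> V"
  shows "edge_path E a b p \<Longrightarrow> \<exists>q. distinct q \<and> edge_path E a b q \<and> path_weight \<omega> q \<le> path_weight \<omega> p"
proof (induction "length p" arbitrary: p rule: less_induct)
  case less
  show ?case
  proof (cases "distinct p")
    case False
    obtain x n where x: "p = seg x 0 n" "x 0 = a" "x n = b" "\<And>t. t < n \<Longrightarrow> {x t, x (Suc t)} \<in> E" "length p = Suc n"
      using edge_path_as_seg[OF less.prems] by metis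
    have "\<not> inj_on x {0..<Suc n}" using False unfolding x(1) by (simp add: distinct_map)
    then obtain s t where st: "s < t" "t \<le> n" "x s = x t"
      unfolding inj_on_def by (metis atLeastLessThan_iff less_Suc_eq_le linorder_neqE_nat)
    have 1: "edge_path E a (x s) (seg x 0 s)" "edge_path E (x s) b (seg x t n)"
      using x st by (auto simp: edge_path_seg)
    let ?q = "seg x 0 s @ tl (seg x t n)"
    have q: "edge_path E a b ?q" by (rule edge_path_append[OF 1])
    have "path_weight \<omega> p = path_weight \<omega> (seg x 0 s) + path_weight \<omega> (seg x s t) + path_weight \<omega> (seg x t n)"
      unfolding x(1) path_weight_seg using st by (simp add: sum.atLeastLessThan_concat)
    moreover have "edge_path E (x s) (x t) (seg x s t)" using x st by (auto simp: edge_path_seg)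
    then have "path_weight \<omega> (seg x s t) \<ge> 0" by (rule path_weight_nonneg[OF \<omega>])
    ultimately have w: "path_weight \<omega> ?q \<le> path_weight \<omega> p"
      unfolding path_weight_append[OF 1] by simp
    have "length ?q < length p" using st x(5) by simp
    from less.hyps[OF this q] w show ?thesis by (meson order_trans)
  qed (use less.prems in auto)
qed

text \<open>By \<open>good_lower\<close>, simple paths no heavier than a fixed one have bounded
  length, so finitely many compete; loop erasure reduces the infimum to simple paths.\<close>

lemma fpp_geodesic_ex:
  assumes \<omega>: "nonneg_weight \<omega>" and V: "a \<in> V" "b \<in> V" and T: "0 < T" "0 < \<epsilon>"
    and good: "\<And>n. N \<le> n \<Longrightarrow> good a {} T \<epsilon> n \<omega>"
  shows "\<exists>p. fpp_geodesic E \<omega> a b p"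
proof -
  obtain p0 where p0: "edge_path E a b p0" "distinct p0"
    using connected[OF V] loop_erasure[OF \<omega> V(1)] by blast
  define S where "S = {p. edge_path E a b p \<and> distinct p \<and> path_weight \<omega> p \<le> path_weight \<omega> p0}"
  define n0 where "n0 = max N (nat \<lceil>2 * path_weight \<omega> p0 / \<epsilon>\<rceil>)"
  have "S \<subseteq> short_paths a n0"
  proof
    fix p assume p: "p \<in> S"
    have ne: "p \<noteq> []" using p unfolding S_def by (auto simp: edge_path_def)
    have "length p \<le> Suc n0"
    proof (cases "length p - 1 < N")
      case False
      have "\<epsilon> * real (length p - 1) / 2 \<le> path_weight \<omega> p"
        by (rule good_lower[OF good T \<omega>]) (use p ne False V in \<open>auto simp: S_def gball_def\<close>)
      then have "\<epsilon> * real (length p - 1) / 2 \<le> path_weight \<omega> p0" using p unfolding S_def by simp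
      then have "real (length p - 1) \<le> 2 * path_weight \<omega> p0 / \<epsilon>" using T by (simp add: field_simps)
      then show ?thesis unfolding n0_def by linarith
    qed (simp add: n0_def)
    then show "p \<in> short_paths a n0" using p short_pathsI unfolding S_def by blast
  qed
  then have fin: "finite S" using card_short_paths(1)[OF V(1)] finite_subset by blast
  have p0S: "p0 \<in> S" using p0 unfolding S_def by simp
  obtain q where q: "q \<in> S" "\<And>p. p \<in> S \<Longrightarrow> path_weight \<omega> q \<le> path_weight \<omega> p"
    using ex_min_if_finite[of "path_weight \<omega> ` S"] fin p0S by (auto simp: not_less)
  have "path_weight \<omega> q \<le> fpp_dist E \<omega> a b"
  proof (rule fpp_dist_greatest[OF V])
    fix p assume "edge_path E a b p"
    then obtain p' where p': "distinct p'" "edge_path E a b p'" "path_weight \<omega> p' \<le> path_weight \<omega> p"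
      using loop_erasure[OF \<omega> V(1)] by blast
    have "path_weight \<omega> q \<le> path_weight \<omega> p'"
      using q(2)[of p'] q(2)[OF p0S] p' unfolding S_def by (cases "path_weight \<omega> p' \<le> path_weight \<omega> p0") auto
    with p'(3) show "path_weight \<omega> q \<le> path_weight \<omega> p" by simp
  qed
  moreover have "fpp_dist E \<omega> a b \<le> path_weight \<omega> q"
    using fpp_dist_le[OF \<omega>] q(1) unfolding S_def by blast
  ultimately show ?thesis using q(1) unfolding fpp_geodesic_def S_def by (intro exI[of _ q]) auto
qed

lemma fpp_geodesic_ex1:
  assumes pos: "\<forall>e\<in>E. 0 < \<omega> e" and V: "a \<in> V" "b \<in> V" and T: "0 < T" "0 < \<epsilon>"
    and good: "\<And>n. N \<le> n \<Longrightarrow> good a {} T \<epsilon> n \<omega>"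
    and generic: "\<And>p q. \<lbrakk>edge_path E a b p; distinct p; edge_path E a b q; distinct q; p \<noteq> q\<rbrakk> \<Longrightarrow>
      path_weight \<omega> p \<noteq> path_weight \<omega> q"
  shows "\<exists>!p. fpp_geodesic E \<omega> a b p"
proof -
  have \<omega>: "nonneg_weight \<omega>" using pos by (auto simp: nonneg_weight_def less_imp_le)
  show ?thesis
  proof (rule ex_ex1I[OF fpp_geodesic_ex[OF \<omega> V T good]])
    fix p q assume pq: "fpp_geodesic E \<omega> a b p" "fpp_geodesic E \<omega> a b q"
    show "p = q"
      using generic[of p q] fpp_geodesic_distinct[OF pos pq(1) V(1)] fpp_geodesic_distinct[OF pos pq(2) V(1)] pq
      unfolding fpp_geodesic_def by auto
  qed
qed

text \<open>Up to \<open>n\<close> steps to reach the starting point and \<open>n\<close> more along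
  the path.\<close>

lemma short_paths_edges:
  assumes z: "z \<in> V" and u: "u \<in> gball z n" and p: "p \<in> short_paths u n"
  shows "path_edges p \<subseteq> ball_edges z (2 * n)"
proof
  fix e assume e: "e \<in> path_edges p"
  have uV: "u \<in> V" using u by (simp add: gball_def)
  obtain y where y: "edge_path E u y p" "length p \<le> Suc n"
    using p unfolding short_paths_def paths_from_def by auto
  obtain x m where x: "p = seg x 0 m" "x 0 = u" "\<And>t. t < m \<Longrightarrow> {x t, x (Suc t)} \<in> E" "length p = Suc m"
    using edge_path_as_seg[OF y(1)] by metis
  have in_ball: "x t \<in> gball z (2 * n)" if "t \<le> m" for t
  proof -
    have "x t \<in> V" by (rule seg_in[of 0 m x]) (use x uV that in auto)
    moreover have "gd (x 0) (x t) \<le> t - 0" by (rule seg_lipschitz) (use x that in auto)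
    moreover have "gd z (x t) \<le> gd z u + gd u (x t)" by (rule gd_tri) (use z uV \<open>x t \<in> V\<close> in auto)
    ultimately show ?thesis using u x y(2) that unfolding gball_def by auto
  qed
  obtain t where "t < m" "e = {x t, x (Suc t)}" using e unfolding x(1) by (auto simp: path_edges_seg)
  then show "e \<in> ball_edges z (2 * n)" using in_ball x(3) unfolding ball_edges_def by auto
qed

lemma card_short_path_edges: "p \<in> short_paths u n \<Longrightarrow> card (path_edges p) \<le> n"
proof -
  assume "p \<in> short_paths u n"
  then have "length p \<le> Suc n" unfolding short_paths_def paths_from_def by auto
  moreover have "card (path_edges p) \<le> length p - 1"
    unfolding path_edges_def using card_image_le[of "{..<length p - 1}"] by simp
  ultimately show ?thesis by simp
qed

end

locale fpp = bounded_graph V E \<Delta> for V :: "'a set" and E \<Delta> +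
  fixes N :: "real measure"
  assumes prob_N: "prob_space N"
    and sets_N: "sets N = sets (restrict_space borel {0..})"
    and atomless: "\<And>t. emeasure N {t} = 0"
    and exp_moment: "(\<integral>\<^sup>+ x. ennreal (exp x) \<partial>N) < \<infinity>"
begin

abbreviation \<Omega> :: "('a set \<Rightarrow> real) measure" where "\<Omega> \<equiv> PiM E (\<lambda>_. N)"

sublocale N: prob_space N by (rule prob_N)

sublocale \<Omega>: product_prob_space "\<lambda>_ :: 'a set. N" E
  by unfold_locales

lemma space_N: "space N = {0..}"
  using sets_eq_imp_space_eq[OF sets_N] by (simp add: space_restrict_space)

lemma measurable_N: "f \<in> borel_measurable borel \<Longrightarrow> f \<in> borel_measurable N"
  unfolding measurable_cong_sets[OF sets_N refl] by (rule measurable_restrict_space1)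

lemma measurable_coord:
  "e \<in> K \<Longrightarrow> (\<lambda>\<omega>. \<omega> e) \<in> borel_measurable (PiM K (\<lambda>_. N))"
  using measurable_compose[OF measurable_component_singleton[of e K "\<lambda>_. N"] measurable_N[OF measurable_ident]] by simp

lemma AE_positive: "AE \<omega> in \<Omega>. \<forall>e\<in>E. 0 < \<omega> e"
proof -
  have "AE x in N. 0 < x"
  proof (rule AE_I')
    show "{0} \<in> null_sets N" using atomless[of 0] sets_N by (auto simp: null_sets_def sets_restrict_space image_iff intro!: bexI[of _ "{0}"])
    show "{x \<in> space N. \<not> 0 < x} \<subseteq> {0}" by (auto simp: space_N)
  qed
  then show ?thesis using countable_E by (simp add: AE_ball_countable \<Omega>.AE_component)
qed

text \<open>With the other coordinates fixed, equality of the sums prescribes the value of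
  \<open>\<omega> e\<close>, which has probability 0. Fubini is applied to the finite marginal on
  \<open>insert e G\<close>, and the result is pulled back along the restriction map.\<close>

lemma AE_sums_differ:
  assumes F: "finite F1" "finite F2" "F1 \<subseteq> E" "F2 \<subseteq> E" and e: "e \<in> F1" "e \<notin> F2"
  shows "AE \<omega> in \<Omega>. (\<Sum>f\<in>F1. \<omega> f) \<noteq> (\<Sum>f\<in>F2. \<omega> f)"
proof -
  define G where "G = F1 \<union> F2 - {e}"
  have G: "finite G" "e \<notin> G" "insert e G \<subseteq> E" "F2 \<subseteq> G" "F1 - {e} \<subseteq> G" "F1 \<subseteq> insert e G" using F e unfolding G_def by auto
  let ?P = "\<lambda>\<omega> :: 'a set \<Rightarrow> real. (\<Sum>f\<in>F1. \<omega> f) = (\<Sum>f\<in>F2. \<omega> f)"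
  let ?A = "{\<omega> \<in> space (PiM (insert e G) (\<lambda>_. N)). ?P \<omega>}"
  have m: "(\<lambda>\<omega>. \<Sum>f\<in>F1. \<omega> f) \<in> borel_measurable (PiM (insert e G) (\<lambda>_. N))"
     "(\<lambda>\<omega>. \<Sum>f\<in>F2. \<omega> f) \<in> borel_measurable (PiM (insert e G) (\<lambda>_. N))"
    by (intro borel_measurable_sum measurable_coord; use G in auto)+
  have A: "?A \<in> sets (PiM (insert e G) (\<lambda>_. N))"
    by (rule borel_measurable_eq[OF m])
  have "emeasure (PiM (insert e G) (\<lambda>_. N)) ?A = (\<integral>\<^sup>+\<omega>. indicator ?A \<omega> \<partial>PiM (insert e G) (\<lambda>_. N))"
    using A by simp
  also have "\<dots> = (\<integral>\<^sup>+x. (\<integral>\<^sup>+y. indicator ?A (x(e := y)) \<partial>N) \<partial>PiM G (\<lambda>_. N))"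
    by (rule \<Omega>.product_nn_integral_insert[OF G(1,2)]) (use A in simp)
  also have "\<dots> = (\<integral>\<^sup>+x. 0 \<partial>PiM G (\<lambda>_. N))"
  proof (rule nn_integral_cong)
    fix x assume "x \<in> space (PiM G (\<lambda>_. N))"
    define t where "t = (\<Sum>f\<in>F2. x f) - (\<Sum>f\<in>F1 - {e}. x f)"
    have "indicator ?A (x(e := y)) \<le> (indicator {t} y :: ennreal)" for y
    proof (cases "x(e := y) \<in> ?A")
      case True
      have "(\<Sum>f\<in>F1. (x(e := y)) f) = y + (\<Sum>f\<in>F1 - {e}. (x(e := y)) f)"
        using F(1) e(1) by (subst sum.remove[of _ e]) auto
      also have "(\<Sum>f\<in>F1 - {e}. (x(e := y)) f) = (\<Sum>f\<in>F1 - {e}. x f)" by (rule sum.cong) auto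
      finally have 1: "(\<Sum>f\<in>F1. (x(e := y)) f) = y + (\<Sum>f\<in>F1 - {e}. x f)" .
      have "(\<Sum>f\<in>F2. (x(e := y)) f) = (\<Sum>f\<in>F2. x f)" using e by (intro sum.cong) auto
      with 1 True have "y = t" unfolding t_def by simp
      then show ?thesis by (simp add: indicator_def)
    qed simp
    then have "(\<integral>\<^sup>+y. indicator ?A (x(e := y)) \<partial>N) \<le> (\<integral>\<^sup>+y. indicator {t} y \<partial>N)"
      by (intro nn_integral_mono)
    also have "\<dots> = 0"
    proof (cases "t \<in> space N")
      case True
      then have "{t} \<in> sets N" unfolding sets_N space_N by (auto simp: sets_restrict_space image_iff intro!: bexI[of _ "{t}"])
      then show ?thesis using atomless by simp
    next
      \<comment> \<open>A negative \<open>t\<close> is not a possible weight, so the indicator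
        vanishes on the whole space.\<close>
      case False
      then have "(\<integral>\<^sup>+y. indicator {t} y \<partial>N) = (\<integral>\<^sup>+y. 0 \<partial>N)"
        by (intro nn_integral_cong) (auto simp: indicator_def)
      then show ?thesis by simp
    qed
    finally show "(\<integral>\<^sup>+y. indicator ?A (x(e := y)) \<partial>N) = 0" by simp
  qed
  finally have "emeasure (PiM (insert e G) (\<lambda>_. N)) ?A = 0" by simp
  then have "AE \<omega> in PiM (insert e G) (\<lambda>_. N). \<not> ?P \<omega>"
    using A by (intro AE_I'[of ?A]) (auto simp: null_sets_def)
  then have "AE \<omega> in distr \<Omega> (PiM (insert e G) (\<lambda>_. N)) (\<lambda>x. restrict x (insert e G)). \<not> ?P \<omega>"
    by (subst \<Omega>.distr_PiM_restrict_finite[OF _ G(3)]) (use G(1) in auto)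
  then have "AE \<omega> in \<Omega>. \<not> ?P (restrict \<omega> (insert e G))"
    by (rule AE_distrD[rotated]) (use G(3) in \<open>auto intro!: measurable_restrict_subset\<close>)
  moreover have "?P (restrict \<omega> (insert e G)) \<longleftrightarrow> ?P \<omega>" for \<omega>
  proof -
    have "(\<Sum>f\<in>F1. restrict \<omega> (insert e G) f) = (\<Sum>f\<in>F1. \<omega> f)"
      "(\<Sum>f\<in>F2. restrict \<omega> (insert e G) f) = (\<Sum>f\<in>F2. \<omega> f)"
      by (rule sum.cong; use G in auto)+
    then show ?thesis by simp
  qed
  ultimately show ?thesis by simp
qed

text \<open>Pairs of paths are countable, and each pair is settled by an edge that only one of them
  uses.\<close>

lemma AE_generic:
  "AE \<omega> in \<Omega>. \<forall>a\<in>V. \<forall>b\<in>V. \<forall>p q. edge_path E a b p \<longrightarrow> distinct p \<longrightarrow> edge_path E a b q \<longrightarrow> distinct q \<longrightarrow>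
     p \<noteq> q \<longrightarrow> path_weight \<omega> p \<noteq> path_weight \<omega> q"
proof -
  have one: "AE \<omega> in \<Omega>. path_weight \<omega> p \<noteq> path_weight \<omega> q"
    if pq: "edge_path E a b p" "distinct p" "edge_path E a b q" "distinct q" "p \<noteq> q" for a b p q
  proof -
    have sub: "path_edges p \<subseteq> E" "path_edges q \<subseteq> E" by (rule path_edges_subset[OF pq(1)], rule path_edges_subset[OF pq(3)])
    obtain e where "e \<in> path_edges p \<and> e \<notin> path_edges q \<or> e \<in> path_edges q \<and> e \<notin> path_edges p"
      using distinct_paths_edge[OF pq] by blast
    then have "AE \<omega> in \<Omega>. (\<Sum>f\<in>path_edges p. \<omega> f) \<noteq> (\<Sum>f\<in>path_edges q. \<omega> f)"
    proof
      assume "e \<in> path_edges p \<and> e \<notin> path_edges q"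
      then show ?thesis by (intro AE_sums_differ[where e = e]) (use sub in auto)
    next
      assume "e \<in> path_edges q \<and> e \<notin> path_edges p"
      then have "AE \<omega> in \<Omega>. (\<Sum>f\<in>path_edges q. \<omega> f) \<noteq> (\<Sum>f\<in>path_edges p. \<omega> f)"
        by (intro AE_sums_differ[where e = e]) (use sub in auto)
      then show ?thesis by eventually_elim auto
    qed
    then show ?thesis using pq by (simp add: path_weight_distinct)
  qed
  define S where "S = {(a, b, p, q). a \<in> V \<and> b \<in> V \<and> edge_path E a b p \<and> distinct p \<and>
    edge_path E a b q \<and> distinct q \<and> p \<noteq> q}"
  have "S \<subseteq> V \<times> V \<times> lists V \<times> lists V"
  proof
    fix s assume "s \<in> S"
    then obtain a b p q where "s = (a, b, p, q)" "a \<in> V" "b \<in> V" "edge_path E a b p" "edge_path E a b q"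
      unfolding S_def by auto
    then show "s \<in> V \<times> V \<times> lists V \<times> lists V"
      using edge_path_in[of a b p] edge_path_in[of a b q] by (auto simp: in_lists_conv_set)
  qed
  then have "countable S"
    by (rule countable_subset) (intro countable_SIGMA countable_V countable_lists)
  moreover have "AE \<omega> in \<Omega>. path_weight \<omega> (fst (snd (snd s))) \<noteq> path_weight \<omega> (snd (snd (snd s)))" if "s \<in> S" for s
    using that unfolding S_def by (auto intro: one)
  ultimately have "AE \<omega> in \<Omega>. \<forall>s\<in>S. path_weight \<omega> (fst (snd (snd s))) \<noteq> path_weight \<omega> (snd (snd (snd s)))"
    by (simp add: AE_ball_countable)
  then show ?thesis
  proof eventually_elim
    case (elim \<omega>)
    have "path_weight \<omega> p \<noteq> path_weight \<omega> q"
      if "a \<in> V" "b \<in> V" "edge_path E a b p" "distinct p" "edge_path E a b q" "distinct q" "p \<noteq> q" for a b p q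
    proof -
      have "(a, b, p, q) \<in> S" using that unfolding S_def by simp
      from bspec[OF elim this] show ?thesis by simp
    qed
    then show ?case by blast
  qed
qed

end

section \<open>Probability estimates\<close>

context bounded_graph
begin

lemma good_local:
  assumes "\<And>u p. u \<in> gball z n \<Longrightarrow> p \<in> short_paths u n \<Longrightarrow> path_edges p - B \<subseteq> K"
    and "\<And>e. e \<in> K \<Longrightarrow> \<omega> e = \<omega>' e"
  shows "good z B T \<epsilon> n \<omega> = good z B T \<epsilon> n \<omega>'"
proof -
  have "(\<Sum>e\<in>path_edges p - B. penalty T \<epsilon> (\<omega> e)) = (\<Sum>e\<in>path_edges p - B. penalty T \<epsilon> (\<omega>' e))"
    if "u \<in> gball z n" "p \<in> short_paths u n" for u p
    using assms(1)[OF that] assms(2) by (intro sum.cong) auto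
  then show ?thesis unfolding good_def by simp
qed

lemma block_local:
  "(\<And>e. e \<in> ball_edges (c k) R \<Longrightarrow> \<omega> e = \<omega>' e) \<Longrightarrow> block c k L R a b M \<omega> = block c k L R a b M \<omega>'"
  unfolding block_def by simp

text \<open>The bound is uniform in the centre, so that \<open>prob_block\<close> does not
  degenerate along the ray.\<close>

lemma card_ball_edges:
  assumes "z \<in> V" shows "card (ball_edges z R) \<le> (Suc \<Delta> ^ R) ^ 2"
proof -
  have "ball_edges z R \<subseteq> (\<lambda>(x, y). {x, y}) ` (gball z R \<times> gball z R)"
    using edge_pair unfolding ball_edges_def by fastforce
  then have "card (ball_edges z R) \<le> card (gball z R \<times> gball z R)"
    by (rule surj_card_le[rotated]) (use card_gball[OF assms] in auto)
  also have "\<dots> = card (gball z R) ^ 2" by (simp add: card_cartesian_product power2_eq_square)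
  also have "\<dots> \<le> (Suc \<Delta> ^ R) ^ 2" by (rule power_mono) (use card_gball[OF assms] in auto)
  finally show ?thesis .
qed

end

lemma penalty_measurable: "penalty T \<epsilon> \<in> borel_measurable borel"
  unfolding penalty_def by measurable

context fpp
begin

lemma sets_N_I: "A \<in> sets borel \<Longrightarrow> A \<subseteq> {0..} \<Longrightarrow> A \<in> sets N"
  unfolding sets_N sets_restrict_space by (rule image_eqI[of _ _ A]) auto

lemma indep_coords: "\<Omega>.P.indep_vars (\<lambda>_. N) (\<lambda>e \<omega>. \<omega> e) E"
proof (cases "E = {}")
  case True
  show ?thesis unfolding \<Omega>.P.indep_vars_def \<Omega>.P.indep_sets_def using True by auto
next
  case False
  have "distr \<Omega> \<Omega> (\<lambda>x. restrict x E) = distr \<Omega> \<Omega> (\<lambda>x. x)"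
    by (rule distr_cong) (auto simp: space_PiM PiE_restrict)
  moreover have "PiM E (\<lambda>e. distr \<Omega> N (\<lambda>\<omega>. \<omega> e)) = \<Omega>"
    by (rule PiM_cong) (auto simp: \<Omega>.PiM_component)
  ultimately show ?thesis
    by (subst \<Omega>.P.indep_vars_iff_distr_eq_PiM'[OF False]) (auto simp: distr_id)
qed

text \<open>Each \<open>P j\<close> can be evaluated on the restriction of \<open>\<omega>\<close>
  to \<open>K j\<close>, and restrictions to disjoint coordinate sets are independent.\<close>

lemma indep_local:
  assumes K: "\<And>j. j \<in> J \<Longrightarrow> K j \<subseteq> E" "disjoint_family_on K J"
    and meas: "\<And>j. j \<in> J \<Longrightarrow> Measurable.pred (PiM (K j) (\<lambda>_. N)) (P j)"
    and local: "\<And>j \<omega> \<omega>'. j \<in> J \<Longrightarrow> (\<And>e. e \<in> K j \<Longrightarrow> \<omega> e = \<omega>' e) \<Longrightarrow> P j \<omega> = P j \<omega>'"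
  shows "\<Omega>.P.indep_events (\<lambda>j. {\<omega> \<in> space \<Omega>. P j \<omega>}) J"
proof -
  have "\<Omega>.P.indep_events (\<lambda>j. {\<omega> \<in> space \<Omega>. P j (restrict \<omega> (K j))}) J"
    by (rule \<Omega>.P.indep_eventsI_indep_vars[OF \<Omega>.P.indep_vars_restrict[OF indep_coords K]])
      (use meas in \<open>auto simp: pred_def\<close>)
  moreover have "{\<omega> \<in> space \<Omega>. P j (restrict \<omega> (K j))} = {\<omega> \<in> space \<Omega>. P j \<omega>}" if "j \<in> J" for j
    using local[OF that, of "restrict _ (K j)"] by auto
  then have "\<Omega>.P.indep_sets (\<lambda>j. {{\<omega> \<in> space \<Omega>. P j (restrict \<omega> (K j))}}) J \<longleftrightarrow>
      \<Omega>.P.indep_sets (\<lambda>j. {{\<omega> \<in> space \<Omega>. P j \<omega>}}) J"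
    by (intro \<Omega>.P.indep_sets_cong) simp_all
  ultimately show ?thesis unfolding \<Omega>.P.indep_events_def_alt by simp
qed

lemma pred_sum_penalty:
  assumes "F \<subseteq> K"
  shows "(\<lambda>\<omega>. \<Sum>e\<in>F. penalty T \<epsilon> (\<omega> e)) \<in> borel_measurable (PiM K (\<lambda>_. N))"
  by (intro borel_measurable_sum measurable_compose[OF measurable_coord penalty_measurable]) (use assms in auto)

lemma pred_good:
  assumes z: "z \<in> V" and K: "\<And>u p. u \<in> gball z n \<Longrightarrow> p \<in> short_paths u n \<Longrightarrow> path_edges p - B \<subseteq> K"
  shows "Measurable.pred (PiM K (\<lambda>_. N)) (good z B T \<epsilon> n)"
  unfolding good_def
proof (intro pred_intros_finite(3))
  fix u p assume u: "u \<in> gball z n" and p: "p \<in> short_paths u n"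
  have "Measurable.pred (PiM K (\<lambda>_. N)) (\<lambda>\<omega>. (\<Sum>e\<in>path_edges p - B. penalty T \<epsilon> (\<omega> e)) \<le> T * n)"
    unfolding pred_def by (intro borel_measurable_le pred_sum_penalty[OF K[OF u p]] borel_measurable_const)
  then show "Measurable.pred (PiM K (\<lambda>_. N)) (\<lambda>\<omega>. distinct p \<longrightarrow> (\<Sum>e\<in>path_edges p - B. penalty T \<epsilon> (\<omega> e)) \<le> T * n)"
    by (cases "distinct p") auto
qed (use card_gball[OF z] card_short_paths in \<open>auto simp: gball_def\<close>)

lemma pred_good': 
  assumes z: "z \<in> V" shows "Measurable.pred \<Omega> (good z B T \<epsilon> n)"
  by (rule pred_good[OF z]) (use short_paths_edges[OF z] in \<open>fastforce simp: ball_edges_def\<close>)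

lemma pred_block:
  assumes "c k \<in> V" "ball_edges (c k) R \<subseteq> K"
  shows "Measurable.pred (PiM K (\<lambda>_. N)) (block c k L R a b M)"
  unfolding block_def
proof (intro pred_intros_finite(3) finite_ball_edges assms(1))
  fix e assume "e \<in> ball_edges (c k) R"
  then have [measurable]: "(\<lambda>\<omega>. \<omega> e) \<in> borel_measurable (PiM K (\<lambda>_. N))"
    using assms(2) by (intro measurable_coord) auto
  show "Measurable.pred (PiM K (\<lambda>_. N)) (\<lambda>\<omega>. if e \<in> corridor c k L then \<omega> e \<le> a else b \<le> \<omega> e \<and> \<omega> e \<le> M)"
    by (cases "e \<in> corridor c k L") (simp_all, measurable)
qed

text \<open>Exponential Markov inequality: by independence the exponential moment of the sum
  factorises; \<open>1 \<le> m\<close> allows for fewer than \<open>n\<close> edges.\<close>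

lemma chernoff:
  assumes F: "finite F" "F \<subseteq> E" "card F \<le> n" and m: "1 \<le> m" "(\<integral>\<^sup>+ x. ennreal (exp (penalty T \<epsilon> x)) \<partial>N) \<le> ennreal m"
  shows "measure \<Omega> {\<omega> \<in> space \<Omega>. T * n < (\<Sum>e\<in>F. penalty T \<epsilon> (\<omega> e))} \<le> (m * exp (- T)) ^ n"
    (is "measure \<Omega> ?A \<le> _")
proof -
  let ?f = "\<lambda>x. ennreal (exp (penalty T \<epsilon> x))"
  have f: "?f \<in> borel_measurable N"
    by (intro measurable_N) (use penalty_measurable in measurable)
  have "(\<integral>\<^sup>+\<omega>. (\<Prod>e\<in>F. ?f (\<omega> e)) \<partial>\<Omega>) = (\<Prod>e\<in>F. \<integral>\<^sup>+\<omega>. ?f (\<omega> e) \<partial>\<Omega>)"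
    by (rule \<Omega>.P.indep_vars_nn_integral[OF F(1)
        \<Omega>.P.indep_vars_compose2[OF \<Omega>.P.indep_vars_subset[OF indep_coords F(2)] f]]) simp
  also have "\<dots> = (\<Prod>e\<in>F. \<integral>\<^sup>+x. ?f x \<partial>N)"
  proof (rule prod.cong[OF refl])
    fix e assume "e \<in> F"
    then have e: "e \<in> E" using F by auto
    have "(\<integral>\<^sup>+x. ?f x \<partial>distr \<Omega> N (\<lambda>\<omega>. \<omega> e)) = (\<integral>\<^sup>+\<omega>. ?f (\<omega> e) \<partial>\<Omega>)"
      by (rule nn_integral_distr) (use e f in auto)
    then show "(\<integral>\<^sup>+\<omega>. ?f (\<omega> e) \<partial>\<Omega>) = (\<integral>\<^sup>+x. ?f x \<partial>N)" unfolding \<Omega>.PiM_component[OF e] by simp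
  qed
  also have "\<dots> \<le> ennreal (m ^ card F)"
  proof -
    obtain i where i: "(\<integral>\<^sup>+x. ?f x \<partial>N) = ennreal i" "0 \<le> i"
      using m(2) by (cases "\<integral>\<^sup>+x. ?f x \<partial>N") (auto simp: top_unique)
    then have "i ^ card F \<le> m ^ card F" using m by (intro power_mono) (auto simp: ennreal_le_iff)
    then show ?thesis unfolding i(1) using i(2) by (simp add: ennreal_power ennreal_leI)
  qed
  also have "\<dots> \<le> ennreal (m ^ n)" using m F(3) by (intro ennreal_leI power_increasing)
  finally have int: "(\<integral>\<^sup>+\<omega>. (\<Prod>e\<in>F. ?f (\<omega> e)) \<partial>\<Omega>) \<le> ennreal (m ^ n)" .
  have meas: "(\<lambda>\<omega>. \<Prod>e\<in>F. ?f (\<omega> e)) \<in> borel_measurable \<Omega>"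
  proof (intro borel_measurable_prod_ennreal)
    fix e assume "e \<in> F"
    then have "(\<lambda>\<omega>. \<omega> e) \<in> measurable \<Omega> N" using F(2) by (intro measurable_component_singleton) auto
    then show "(\<lambda>\<omega>. ?f (\<omega> e)) \<in> borel_measurable \<Omega>" using f by (rule measurable_compose)
  qed
  have prod: "(\<Prod>e\<in>F. ?f (\<omega> e)) = ennreal (exp (\<Sum>e\<in>F. penalty T \<epsilon> (\<omega> e)))" for \<omega>
    using F(1) by (simp add: exp_sum prod_ennreal)
  have "emeasure \<Omega> ?A \<le> emeasure \<Omega> {\<omega> \<in> space \<Omega>. 1 \<le> ennreal (exp (- (T * n))) * (\<Prod>e\<in>F. ?f (\<omega> e))}"
  proof (rule emeasure_mono)
    show "?A \<subseteq> {\<omega> \<in> space \<Omega>. 1 \<le> ennreal (exp (- (T * n))) * (\<Prod>e\<in>F. ?f (\<omega> e))}"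
      unfolding prod by (auto simp flip: ennreal_mult' exp_add)
    show "{\<omega> \<in> space \<Omega>. 1 \<le> ennreal (exp (- (T * n))) * (\<Prod>e\<in>F. ?f (\<omega> e))} \<in> sets \<Omega>"
      using meas by measurable
  qed
  also have "\<dots> \<le> ennreal (exp (- (T * n))) * (\<integral>\<^sup>+\<omega>. (\<Prod>e\<in>F. ?f (\<omega> e)) * indicator (space \<Omega>) \<omega> \<partial>\<Omega>)"
    by (rule nn_integral_Markov_inequality) (use meas in auto)
  also have "(\<integral>\<^sup>+\<omega>. (\<Prod>e\<in>F. ?f (\<omega> e)) * indicator (space \<Omega>) \<omega> \<partial>\<Omega>) = (\<integral>\<^sup>+\<omega>. (\<Prod>e\<in>F. ?f (\<omega> e)) \<partial>\<Omega>)"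
    by (intro nn_integral_cong) simp
  also have "ennreal (exp (- (T * n))) * \<dots> \<le> ennreal (exp (- (T * n))) * ennreal (m ^ n)"
    by (intro mult_left_mono int) simp
  also have "\<dots> = ennreal ((m * exp (- T)) ^ n)"
    using m by (simp add: ennreal_mult'[symmetric] power_mult_distrib exp_of_nat_mult[symmetric] mult.commute)
  finally show ?thesis unfolding \<Omega>.P.emeasure_eq_measure using m by (subst (asm) ennreal_le_iff) auto
qed

text \<open>Union bound over at most \<open>Suc \<Delta> ^ n\<close> starting points and as many
  paths from each; \<open>T\<close> is so large that \<open>m * exp (- T)\<close> beats this count
  with a factor 8 to spare per step.\<close>

lemma prob_not_good:
  assumes z: "z \<in> V" and m: "1 \<le> m" "(\<integral>\<^sup>+ x. ennreal (exp (penalty T \<epsilon> x)) \<partial>N) \<le> ennreal m"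
    and T: "(real (Suc \<Delta>))\<^sup>2 * (m * exp (- T)) \<le> 1 / 8"
  shows "measure \<Omega> {\<omega> \<in> space \<Omega>. \<not> good z B T \<epsilon> n \<omega>} \<le> (1 / 8) ^ n"
proof -
  define S where "S = Sigma (gball z n) (\<lambda>u. short_paths u n)"
  define A where "A s = {\<omega> \<in> space \<Omega>. T * n < (\<Sum>e\<in>path_edges (snd s) - B. penalty T \<epsilon> (\<omega> e))}" for s :: "'a \<times> 'a list"
  have fin: "finite S" unfolding S_def using card_gball[OF z] card_short_paths by (auto simp: gball_def)
  have card: "card S \<le> Suc \<Delta> ^ n * Suc \<Delta> ^ n"
  proof -
    have "card S = (\<Sum>u\<in>gball z n. card (short_paths u n))"
      unfolding S_def using card_gball[OF z] card_short_paths by (subst card_SigmaI) (auto simp: gball_def)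
    also have "\<dots> \<le> (\<Sum>u\<in>gball z n. Suc \<Delta> ^ n)"
      by (rule sum_mono) (use card_short_paths in \<open>auto simp: gball_def\<close>)
    also have "\<dots> \<le> Suc \<Delta> ^ n * Suc \<Delta> ^ n" using card_gball[OF z, of n] by simp
    finally show ?thesis .
  qed
  have sub: "path_edges (snd s) - B \<subseteq> E" "card (path_edges (snd s) - B) \<le> n" if "s \<in> S" for s
  proof -
    have s: "fst s \<in> gball z n" "snd s \<in> short_paths (fst s) n" using that unfolding S_def by auto
    show "path_edges (snd s) - B \<subseteq> E" using short_paths_edges[OF z s] unfolding ball_edges_def by auto
    have "card (path_edges (snd s) - B) \<le> card (path_edges (snd s))" by (rule card_mono) auto
    also have "\<dots> \<le> n" by (rule card_short_path_edges[OF s(2)])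
    finally show "card (path_edges (snd s) - B) \<le> n" .
  qed
  have A: "A s \<in> sets \<Omega>" if "s \<in> S" for s
    unfolding A_def by (intro borel_measurable_less borel_measurable_const pred_sum_penalty sub(1)[OF that])
  have "measure \<Omega> {\<omega> \<in> space \<Omega>. \<not> good z B T \<epsilon> n \<omega>} \<le> measure \<Omega> (\<Union>s\<in>S. A s)"
  proof (rule \<Omega>.P.finite_measure_mono)
    show "{\<omega> \<in> space \<Omega>. \<not> good z B T \<epsilon> n \<omega>} \<subseteq> (\<Union>s\<in>S. A s)"
      unfolding good_def A_def S_def by (force simp: not_le)
    show "(\<Union>s\<in>S. A s) \<in> sets \<Omega>" using A fin by auto
  qed
  also have "\<dots> \<le> (\<Sum>s\<in>S. measure \<Omega> (A s))"
    by (rule \<Omega>.P.finite_measure_subadditive_finite[OF fin]) (use A in auto)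
  also have "\<dots> \<le> (\<Sum>s\<in>S. (m * exp (- T)) ^ n)"
    unfolding A_def by (intro sum_mono chernoff m sub) auto
  also have "\<dots> = card S * (m * exp (- T)) ^ n" by simp
  also have "\<dots> \<le> real (Suc \<Delta> ^ n * Suc \<Delta> ^ n) * (m * exp (- T)) ^ n"
    by (intro mult_right_mono) (use card m in \<open>auto simp del: of_nat_mult of_nat_power\<close>)
  also have "\<dots> = ((real (Suc \<Delta>))\<^sup>2 * (m * exp (- T))) ^ n"
    by (simp add: power_mult_distrib power2_eq_square)
  also have "\<dots> \<le> (1 / 8) ^ n" by (rule power_mono[OF T]) (use m in auto)
  finally show ?thesis .
qed

lemma prob_block:
  assumes c: "c k \<in> V" and q: "q \<le> 1" "0 \<le> q" "q \<le> measure N {0..a}" "q \<le> measure N {b..M}" and b: "0 \<le> b"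
  shows "q ^ ((Suc \<Delta> ^ R) ^ 2) \<le> measure \<Omega> {\<omega> \<in> space \<Omega>. block c k L R a b M \<omega>}"
proof -
  let ?B = "ball_edges (c k) R"
  let ?X = "\<lambda>e. if e \<in> corridor c k L then {0..a} else {b..M}"
  have fin: "finite ?B" by (rule finite_ball_edges[OF c])
  have BE: "?B \<subseteq> E" by (auto simp: ball_edges_def)
  have X: "?X e \<in> sets N" for e by (auto intro!: sets_N_I simp: b order_trans[OF b])
  have "q ^ ((Suc \<Delta> ^ R) ^ 2) \<le> q ^ card ?B"
    by (rule power_decreasing[OF card_ball_edges[OF c]]) (use q in auto)
  also have "\<dots> = (\<Prod>e\<in>?B. q)" by simp
  also have "\<dots> \<le> (\<Prod>e\<in>?B. measure N (?X e))" by (rule prod_mono) (use q in auto)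
  also have "\<dots> = measure \<Omega> {\<omega> \<in> space \<Omega>. \<forall>e\<in>?B. \<omega> e \<in> ?X e}"
    using \<Omega>.emeasure_PiM_Collect[OF BE fin X]
    unfolding \<Omega>.P.emeasure_eq_measure N.emeasure_eq_measure by (simp add: prod_ennreal prod_nonneg)
  also have "\<dots> \<le> measure \<Omega> {\<omega> \<in> space \<Omega>. block c k L R a b M \<omega>}"
  proof (rule \<Omega>.P.finite_measure_mono)
    show "{\<omega> \<in> space \<Omega>. \<forall>e\<in>?B. \<omega> e \<in> ?X e} \<subseteq> {\<omega> \<in> space \<Omega>. block c k L R a b M \<omega>}"
      unfolding block_def by (auto split: if_splits)
    show "{\<omega> \<in> space \<Omega>. block c k L R a b M \<omega>} \<in> sets \<Omega>"
      using pred_block[of c k R E L a b M, OF c BE] by (simp add: pred_def)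
  qed
  finally show ?thesis .
qed

text \<open>\<open>a\<close> is a median, which exists because a distribution function without atoms
  is continuous. The other half of the mass lies in \<open>{a<..}\<close>, a countable union of
  compact intervals bounded away from \<open>a\<close>, so one of them has positive mass.\<close>

lemma exists_levels:
  "\<exists>a b M. 0 \<le> a \<and> a < b \<and> b \<le> M \<and> 0 < measure N {0..a} \<and> 0 < measure N {b..M}"
proof -
  \<comment> \<open>The law is moved to the whole line, where distribution functions are
    available.\<close>
  define D where "D = distr N borel (\<lambda>x. x)"
  have id: "(\<lambda>x. x) \<in> borel_measurable N" by (rule measurable_N) simp
  interpret D: real_distribution D unfolding D_def by (rule N.real_distribution_distr[OF id])
  have D_eq: "measure D A = measure N (A \<inter> {0..})" if "A \<in> sets borel" for A
    unfolding D_def using that by (subst measure_distr[OF id]) (auto simp: space_N vimage_def Int_def)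
  have "measure D {x} = 0" for x
  proof -
    have "measure D {x} \<le> measure N {x}"
    proof (cases "x \<ge> 0")
      case True then show ?thesis by (subst D_eq) auto
    next
      case False
      then have "{x} \<inter> {0..} = {}" by auto
      then show ?thesis by (subst D_eq) auto
    qed
    also have "measure N {x} = 0" using atomless[of x] by (simp add: measure_def)
    finally show ?thesis by (simp add: measure_le_0_iff)
  qed
  then have cont: "isCont (cdf D) x" for x by (simp add: D.isCont_cdf)
  obtain x1 where x1: "cdf D x1 < 1 / 2"
    using eventually_happens[OF order_tendstoD(2)[OF D.cdf_lim_at_bot, of "1/2"]] by auto
  obtain x2 where x2: "cdf D x2 > 1 / 2"
    using eventually_happens[OF order_tendstoD(1)[OF D.cdf_lim_at_top_prob, of "1/2"]] by auto
  have "x1 \<le> x2" using x1 x2 D.cdf_nondecreasing[of x2 x1] by (cases "x1 \<le> x2") auto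
  then obtain a where a: "cdf D a = 1 / 2"
    using IVT[of "cdf D" x1 "1/2" x2] cont x1 x2 by auto
  have a2: "measure N ({..a} \<inter> {0..}) = 1 / 2" using a D_eq[of "{..a}"] by (simp add: cdf_def)
  have a0: "0 \<le> a"
  proof (rule ccontr)
    assume "\<not> 0 \<le> a"
    then have "{..a} \<inter> {0..} = {}" by auto
    with a2 show False by simp
  qed
  have eq: "{..a} \<inter> {0..} = {0..a}" by auto
  have "\<exists>n. measure N {a + 1 / real (Suc n)..real n} \<noteq> 0"
  proof (rule ccontr)
    assume "\<not> ?thesis"
    then have "{a + 1 / real (Suc n)..real n} \<in> null_sets N" for n
      using sets_N_I[of "{a + 1 / real (Suc n)..real n}"] a0
      by (auto simp: null_sets_def N.emeasure_eq_measure intro: order_trans[OF add_nonneg_nonneg])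
    then have "(\<Union>n. {a + 1 / real (Suc n)..real n}) \<in> null_sets N" by auto
    moreover have "{a<..} \<subseteq> (\<Union>n. {a + 1 / real (Suc n)..real n})"
    proof
      fix x assume "x \<in> {a<..}"
      then obtain n1 where n1: "inverse (real (Suc n1)) < x - a" using reals_Archimedean[of "x - a"] by auto
      obtain n2 where n2: "x \<le> real n2" using real_arch_simple by blast
      have "1 / real (Suc (max n1 n2)) \<le> inverse (real (Suc n1))" by (simp add: field_simps)
      then have "x \<in> {a + 1 / real (Suc (max n1 n2))..real (max n1 n2)}" using n1 n2 by auto
      then show "x \<in> (\<Union>n. {a + 1 / real (Suc n)..real n})" by blast
    qed
    moreover have aN: "{a<..} \<in> sets N" using a0 by (intro sets_N_I) auto
    ultimately have "{a<..} \<in> null_sets N" using null_sets_subset by blast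
    then have 0: "measure N {a<..} = 0" by (simp add: null_sets_def measure_def)
    have "measure N ({0..a} \<union> {a<..}) \<le> measure N {0..a} + measure N {a<..}"
      by (rule measure_Un_le) (use aN in \<open>auto intro: sets_N_I\<close>)
    moreover have "{0..a} \<union> {a<..} = space N" using a0 by (auto simp: space_N)
    ultimately show False using 0 a2 eq N.prob_space by simp
  qed
  then obtain n where n: "measure N {a + 1 / real (Suc n)..real n} \<noteq> 0" by auto
  have "a + 1 / real (Suc n) \<le> real n"
  proof (rule ccontr)
    assume "\<not> ?thesis"
    then have "{a + 1 / real (Suc n)..real n} = {}" by simp
    with n show False by simp
  qed
  moreover have "0 < measure N {a + 1 / real (Suc n)..real n}" using n measure_nonneg[of N] by (simp add: less_le)
  moreover have "a < a + 1 / real (Suc n)" by simp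
  ultimately show ?thesis using a0 a2 eq by (intro exI[of _ a] exI[of _ "a + 1 / real (Suc n)"] exI[of _ "real n"]) auto
qed

text \<open>The order of choice avoids circularity: \<open>m\<close> depends only on the moment and
  \<open>T\<close> on \<open>m\<close> and the degree; then \<open>\<epsilon>\<close> is so small
  that the surcharge on light weights adds at most 1 to the moment, hence
  \<open>m = m0 + 1\<close>.\<close>

lemma exists_moment_bound:
  assumes b: "0 < b"
  shows "\<exists>m T \<epsilon>. 1 \<le> m \<and> 0 < T \<and> 0 < \<epsilon> \<and> \<epsilon> \<le> b \<and>
    (\<integral>\<^sup>+ x. ennreal (exp (penalty T \<epsilon> x)) \<partial>N) \<le> ennreal m \<and> (real (Suc \<Delta>))\<^sup>2 * (m * exp (- T)) \<le> 1 / 8"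
proof -
  obtain m0 where m0: "(\<integral>\<^sup>+ x. ennreal (exp x) \<partial>N) = ennreal m0" "0 \<le> m0"
    using exp_moment by (cases "\<integral>\<^sup>+ x. ennreal (exp x) \<partial>N") (auto simp: top.not_eq_extremum)
  define m where "m = m0 + 1"
  have m: "1 \<le> m" using m0 by (simp add: m_def)
  define Q where "Q = (real (Suc \<Delta>))\<^sup>2 * m * 8"
  have Q: "8 \<le> Q"
  proof -
    have "1 * 1 * 8 \<le> (real (Suc \<Delta>))\<^sup>2 * m * 8"
      using m by (intro mult_mono one_le_power) auto
    then show ?thesis by (simp add: Q_def)
  qed
  define T where "T = ln Q"
  have T: "0 < T" using Q by (simp add: T_def)
  have QT: "(real (Suc \<Delta>))\<^sup>2 * (m * exp (- T)) \<le> 1 / 8"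
    using Q m unfolding T_def by (simp add: exp_minus) (simp add: Q_def field_simps)
  have "(\<lambda>n. measure N {0..<1 / real (Suc n)}) \<longlonglongrightarrow> measure N (\<Inter>n. {0..<1 / real (Suc n)})"
  proof (rule N.finite_Lim_measure_decseq)
    show "range (\<lambda>n. {0..<1 / real (Suc n)}) \<subseteq> sets N" by (auto intro!: sets_N_I)
    show "decseq (\<lambda>n. {0..<1 / real (Suc n)})"
      unfolding decseq_def by (auto elim!: less_le_trans intro!: divide_left_mono)
  qed
  moreover have "(\<Inter>n. {0..<1 / real (Suc n)}) = {0}"
  proof
    show "(\<Inter>n. {0..<1 / real (Suc n)}) \<subseteq> {0}"
    proof
      fix x assume x: "x \<in> (\<Inter>n. {0..<1 / real (Suc n)})"
      show "x \<in> {0}"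
      proof (rule ccontr)
        assume "x \<notin> {0}"
        then have "0 < x" using x by auto
        then obtain n where "inverse (real (Suc n)) < x" using reals_Archimedean[of x] by auto
        moreover have "x < 1 / real (Suc n)" using INT_D[OF x, of n] by simp
        ultimately show False by (simp add: inverse_eq_divide)
      qed
    qed
  qed auto
  moreover have "measure N {0} = 0" using atomless[of 0] by (simp add: measure_def)
  ultimately have lim: "(\<lambda>n. measure N {0..<1 / real (Suc n)}) \<longlonglongrightarrow> 0" by simp
  \<comment> \<open>\<open>2 * T + 1\<close> bounds the penalty of weights below
    \<open>\<epsilon>\<close>, as \<open>\<epsilon>\<close> will be at most 1.\<close>
  have "eventually (\<lambda>n. measure N {0..<1 / real (Suc n)} < exp (- (2 * T + 1))) sequentially"
    by (rule order_tendstoD(2)[OF lim]) simp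
  moreover have "eventually (\<lambda>n. 1 / real (Suc n) < min b 1) sequentially"
    by (rule order_tendstoD(2)[OF LIMSEQ_Suc[OF lim_1_over_n]]) (use b in auto)
  ultimately have "eventually (\<lambda>n. measure N {0..<1 / real (Suc n)} < exp (- (2 * T + 1)) \<and> 1 / real (Suc n) < min b 1) sequentially"
    by (rule eventually_conj)
  then obtain n where n: "measure N {0..<1 / real (Suc n)} < exp (- (2 * T + 1))" "1 / real (Suc n) < min b 1"
    using eventually_happens by force
  define \<epsilon> where "\<epsilon> = 1 / real (Suc n)"
  have \<epsilon>: "0 < \<epsilon>" "\<epsilon> \<le> b" "\<epsilon> \<le> 1" using n(2) by (auto simp: \<epsilon>_def)
  have meas: "{0..<\<epsilon>} \<in> sets N" by (auto intro!: sets_N_I)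
  have "(\<integral>\<^sup>+ x. ennreal (exp (penalty T \<epsilon> x)) \<partial>N) \<le> (\<integral>\<^sup>+ x. ennreal (exp x) + ennreal (exp (2 * T + 1)) * indicator {0..<\<epsilon>} x \<partial>N)"
  proof (rule nn_integral_mono)
    fix x assume "x \<in> space N"
    then have x: "0 \<le> x" by (simp add: space_N)
    show "ennreal (exp (penalty T \<epsilon> x)) \<le> ennreal (exp x) + ennreal (exp (2 * T + 1)) * indicator {0..<\<epsilon>} x"
    proof (cases "x < \<epsilon>")
      case True
      then have "ennreal (exp (penalty T \<epsilon> x)) \<le> ennreal (exp (2 * T + 1))"
        using \<epsilon> by (intro ennreal_leI) (simp add: penalty_def)
      then show ?thesis using True x by (simp add: add_increasing)
    qed (simp add: penalty_def)
  qed
  also have "\<dots> = ennreal m0 + ennreal (exp (2 * T + 1)) * emeasure N {0..<\<epsilon>}"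
    using meas m0(1) measurable_N[of "\<lambda>x. ennreal (exp x)"]
    by (subst nn_integral_add) (auto simp: nn_integral_cmult_indicator)
  also have "ennreal (exp (2 * T + 1)) * emeasure N {0..<\<epsilon>} \<le> ennreal (exp (2 * T + 1)) * ennreal (exp (- (2 * T + 1)))"
    unfolding N.emeasure_eq_measure using n(1) by (intro mult_left_mono ennreal_leI) (auto simp: \<epsilon>_def)
  also have "ennreal (exp (2 * T + 1)) * ennreal (exp (- (2 * T + 1))) = 1"
    by (simp flip: ennreal_mult' exp_add)
  finally have "(\<integral>\<^sup>+ x. ennreal (exp (penalty T \<epsilon> x)) \<partial>N) \<le> ennreal m"
    unfolding m_def using m0(2) by (simp add: ennreal_plus)
  with m T \<epsilon> QT show ?thesis by blast
qed

end

section \<open>Almost sure bottlenecks\<close>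

text \<open>By the zero-one law the alternative is that almost surely finitely many events occur;
  then the tail unions decrease to a null set, though each has probability at least
  \<open>p\<close>.\<close>

lemma (in prob_space) AE_infinite_of_indep_events:
  assumes indep: "indep_events (\<lambda>m :: nat. {x \<in> space M. P m x}) UNIV"
    and lower: "\<And>m. p \<le> prob {x \<in> space M. P m x}" and p: "0 < p"
  shows "AE x in M. infinite {m. P m x}"
proof (rule ccontr)
  assume "\<not> ?thesis"
  then have fin: "AE x in M. finite {m. P m x}" using borel_0_1_law_AE[OF indep] by blast
  define U where "U n = (\<Union>m\<in>{n..}. {x \<in> space M. P m x})" for n
  have ev: "{x \<in> space M. P m x} \<in> events" for m using indep by (auto simp: indep_events_def)
  have U: "range U \<subseteq> events" unfolding U_def using ev by auto
  have "(\<lambda>n. prob (U n)) \<longlonglongrightarrow> prob (\<Inter>n. U n)"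
    by (rule finite_Lim_measure_decseq[OF U]) (unfold decseq_def U_def, intro allI impI UN_mono, auto)
  moreover have "p \<le> prob (U n)" for n
    by (rule order_trans[OF lower[of n]], rule finite_measure_mono) (use U in \<open>auto simp: U_def\<close>)
  ultimately have "p \<le> prob (\<Inter>n. U n)" by (intro LIMSEQ_le_const) auto
  moreover have "prob (\<Inter>n. U n) = 0"
  proof -
    have "AE x in M. x \<notin> (\<Inter>n. U n)"
      using fin
    proof eventually_elim
      case (elim x)
      then obtain n where "\<And>m. P m x \<Longrightarrow> m < n" unfolding finite_nat_iff_bounded by auto
      then have "x \<notin> U n" unfolding U_def by (auto simp: not_le[symmetric])
      then show ?case by auto
    qed
    then show ?thesis using U by (subst prob_eq_0) auto
  qed
  ultimately show False using p by simp
qed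

lemma sum_eighth: "(\<Sum>n\<in>{1..j}. (1 / 8 :: real) ^ n) = (1 - (1 / 8) ^ j) / 7"
proof (induction j)
  case (Suc j)
  have "(1 - y) / 7 + 1 / 8 * y = (1 - 1 / 8 * y) / 7" for y :: real by (simp add: field_simps)
  from this[of "(1 / 8) ^ j"] Suc show ?case by simp
qed simp

context bounded_graph
begin

lemma ball_edges_mono:
  assumes "z \<in> V" "y \<in> V" "gd y z + R \<le> R'" shows "ball_edges z R \<subseteq> ball_edges y R'"
proof -
  have "gball z R \<subseteq> gball y R'"
  proof
    fix x assume x: "x \<in> gball z R"
    then have "gd y x \<le> gd y z + gd z x" by (intro gd_tri) (use assms in \<open>auto simp: gball_def\<close>)
    then show "x \<in> gball y R'" using x assms(3) unfolding gball_def by auto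
  qed
  then show ?thesis unfolding ball_edges_def by auto
qed

end

context fpp
begin

text \<open>The restriction \<open>j < n\<close> keeps the union over centres finite; the scales \<open>n \<le> j\<close> at
  centre \<open>j\<close> are left to the local events.\<close>

lemma AE_eventually_good:
  assumes z: "\<And>j. z j \<in> V" and m: "1 \<le> m" "(\<integral>\<^sup>+ x. ennreal (exp (penalty T \<epsilon> x)) \<partial>N) \<le> ennreal m"
    and T: "(real (Suc \<Delta>))\<^sup>2 * (m * exp (- T)) \<le> 1 / 8"
  shows "AE \<omega> in \<Omega>. \<exists>N. \<forall>n\<ge>N. \<forall>j<n. good (z j) (B j) T \<epsilon> n \<omega>"
proof -
  define A where "A n = (\<Union>j<n. {\<omega> \<in> space \<Omega>. \<not> good (z j) (B j) T \<epsilon> n \<omega>})" for n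
  have ev: "{\<omega> \<in> space \<Omega>. \<not> good (z j) (B j) T \<epsilon> n \<omega>} \<in> sets \<Omega>" for j n
    using pred_intros_logic(2)[OF pred_good'[OF z[of j], of "B j" T \<epsilon> n]] by (simp add: pred_def)
  have A: "A n \<in> sets \<Omega>" for n unfolding A_def using ev by auto
  have "measure \<Omega> (A n) \<le> (1 / 4) ^ n" for n
  proof -
    have "measure \<Omega> (A n) \<le> (\<Sum>j<n. measure \<Omega> {\<omega> \<in> space \<Omega>. \<not> good (z j) (B j) T \<epsilon> n \<omega>})"
      unfolding A_def by (rule \<Omega>.P.finite_measure_subadditive_finite) (use ev in auto)
    also have "\<dots> \<le> (\<Sum>j<n. (1 / 8) ^ n)" by (intro sum_mono prob_not_good[OF z m T])
    also have "\<dots> = real n * (1 / 8) ^ n" by simp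
    \<comment> \<open>The number of centres is absorbed by \<open>2 ^ n\<close>; the rate 1/4 that
      remains is still summable.\<close>
    also have "\<dots> \<le> 2 ^ n * (1 / 8) ^ n"
      by (intro mult_right_mono) (auto simp: less_imp_le of_nat_less_two_power)
    also have "\<dots> = (1 / 4) ^ n" by (simp add: power_mult_distrib[symmetric])
    finally show ?thesis .
  qed
  then have "summable (\<lambda>n. measure \<Omega> (A n))"
    by (intro summable_comparison_test'[OF summable_geometric[of "1 / 4 :: real"], of 0]) auto
  then have "AE \<omega> in \<Omega>. eventually (\<lambda>n. \<omega> \<in> space \<Omega> - A n) sequentially"
    by (intro borel_cantelli_AE1 A) (auto simp: \<Omega>.P.emeasure_eq_measure)
  then show ?thesis by eventually_elim (auto simp: eventually_sequentially A_def)
qed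

end

locale hyperbolic_fpp = hyperbolic_graph V E \<Delta> \<delta> + fpp V E \<Delta> N
  for V :: "'a set" and E \<Delta> \<delta> N
begin

lemma exists_bottlenecks:
  assumes c: "geodesic_ray c"
  shows "\<exists>W. AE \<omega> in \<Omega>. infinite {k. bottleneck c W k \<omega>}"
proof -
  note cV = geodesic_rayD(1)[OF c]
  obtain a b M where ab: "0 \<le> a" "a < b" "b \<le> M" and levels: "0 < measure N {0..a}" "0 < measure N {b..M}"
    using exists_levels by blast
  have b0: "0 < b" using ab by simp
  obtain m T \<epsilon> where m: "1 \<le> m" and T: "0 < T" and \<epsilon>: "0 < \<epsilon>" "\<epsilon> \<le> b"
    and int: "(\<integral>\<^sup>+ x. ennreal (exp (penalty T \<epsilon> x)) \<partial>N) \<le> ennreal m"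
    and small: "(real (Suc \<Delta>))\<^sup>2 * (m * exp (- T)) \<le> 1 / 8"
    using exists_moment_bound[OF b0] by blast
  \<comment> \<open>The rounded-up terms below are read off from the requirements of
    \<open>bottleneckI\<close>; each constant depends only on earlier ones.\<close>
  define C where "C = nat \<lceil>4 * \<delta> + 1\<rceil>"
  define \<Lambda> where "\<Lambda> = 1 + 2 * (T + M) / \<epsilon>"
  define r where "r = nat \<lceil>10 * \<delta> + 4\<rceil> + 1 + nat \<lceil>2 * (5 * \<delta> + 2) * \<Lambda>\<rceil> + C"
  define D where "D = 4 * r + 2 * C + nat \<lceil>2 * (5 * \<delta> + 2)\<rceil>"
  define L where "L = D + 1 + nat \<lceil>2 * real D * (M + b) / (b - a)\<rceil>"
  define R where "R = L + D + (nat \<lceil>(2 * real D * M + 2 * real L * a) / b\<rceil> + 1)"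
  define W where "W = L + nat \<lceil>2 * \<delta>\<rceil> + 1"
  have C: "4 * \<delta> + 1 \<le> C" unfolding C_def by linarith
  have r: "10 * \<delta> + 4 < real r" "2 * (5 * \<delta> + 2) * (1 + 2 * (T + M) / \<epsilon>) \<le> real r" "C \<le> r"
    unfolding r_def \<Lambda>_def[symmetric] by linarith+
  have D: "4 * real r + 2 * real C + 2 * (5 * \<delta> + 2) \<le> real D" unfolding D_def by linarith
  have L: "D < L" "2 * real D * (M + b) < real L * (b - a)"
  proof -
    show "D < L" by (simp add: L_def)
    have "2 * real D * (M + b) / (b - a) < real L" unfolding L_def by linarith
    then show "2 * real D * (M + b) < real L * (b - a)" using ab by (simp add: pos_divide_less_eq)
  qed
  have R: "L + D \<le> R" "2 * real D * M + 2 * real L * a < b * real (R - (L + D))"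
  proof -
    show "L + D \<le> R" by (simp add: R_def)
    have "(2 * real D * M + 2 * real L * a) / b < real (R - (L + D))" unfolding R_def by simp linarith
    then show "2 * real D * M + 2 * real L * a < b * real (R - (L + D))"
      using b0 by (simp add: pos_divide_less_eq mult.commute)
  qed
  have W: "real L + 2 * \<delta> < real W" unfolding W_def by linarith
  \<comment> \<open>Quadratic growth leaves room for the balls \<open>K j\<close>, whose radii grow
    linearly in \<open>j\<close>.\<close>
  define k where "k j = 4 * (R + L + 1 + j)\<^sup>2" for j
  define B where "B j = ball_edges (c (k j)) R" for j
  \<comment> \<open>\<open>L\<close> reaches the two corridor ends, \<open>2 * j\<close> covers
    paths at scales up to \<open>j\<close> around them, and \<open>R\<close> makes room for
    \<open>B j\<close>.\<close>
  define \<rho> where "\<rho> j = R + L + 2 * j" for j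
  define K where "K j = ball_edges (c (k j)) (\<rho> j)" for j
  define G where "G j \<omega> \<longleftrightarrow> (\<forall>n\<in>{1..j}. good (c (k j - L)) (B j) T \<epsilon> n \<omega> \<and> good (c (k j + L)) (B j) T \<epsilon> n \<omega>)" for j \<omega>
  define A where "A j \<omega> \<longleftrightarrow> block c (k j) L R a b M \<omega> \<and> G j \<omega>" for j \<omega>
  have kL: "L \<le> k j" for j
  proof -
    have "L \<le> (R + L + 1 + j) * 1" by simp
    also have "\<dots> \<le> (R + L + 1 + j)\<^sup>2" unfolding power2_eq_square by (intro mult_left_mono) auto
    finally show ?thesis unfolding k_def by simp
  qed
  have gap: "k i + \<rho> i + \<rho> j < k j" if ij: "i < j" for i j
  proof -
    define s where "s = R + L + 1 + i"
    define t where "t = R + L + 1 + j"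
    have "s + 1 \<le> t" using ij by (simp add: s_def t_def)
    then have "s * (s + 1) \<le> s * t" "(s + 1) * t \<le> t * t" by (intro mult_left_mono mult_right_mono; simp)+
    then have "s\<^sup>2 + s + t \<le> t\<^sup>2" by (simp add: power2_eq_square)
    have "\<rho> i + \<rho> j < 4 * (s + t)" by (simp add: \<rho>_def s_def t_def)
    then have "4 * s\<^sup>2 + \<rho> i + \<rho> j < 4 * s\<^sup>2 + 4 * (s + t)" by simp
    moreover have "4 * s\<^sup>2 + 4 * (s + t) \<le> 4 * t\<^sup>2" using \<open>s\<^sup>2 + s + t \<le> t\<^sup>2\<close> by simp
    ultimately show ?thesis unfolding k_def s_def[symmetric] t_def[symmetric] by (rule less_le_trans)
  qed
  have KE: "K j \<subseteq> E" for j by (auto simp: K_def ball_edges_def)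
  have BK: "B j \<subseteq> K j" for j
    unfolding B_def K_def by (rule ball_edges_mono[OF cV cV]) (simp add: \<rho>_def)
  have anchor: "gd (c (k j)) (c (k j - L)) \<le> L" "gd (c (k j)) (c (k j + L)) \<le> L" for j
    using geodesic_ray_gd(2)[OF c, of "k j - L" "k j"] geodesic_ray_gd(1)[OF c, of "k j" "k j + L"] by auto
  have GK: "path_edges p - B j \<subseteq> K j - B j"
    if "z = c (k j - L) \<or> z = c (k j + L)" "u \<in> gball z n" "p \<in> short_paths u n" "n \<in> {1..j}" for z u p n j
  proof -
    have zV: "z \<in> V" using that(1) cV by auto
    have "path_edges p \<subseteq> ball_edges z (2 * n)" by (rule short_paths_edges[OF zV that(2,3)])
    also have "\<dots> \<subseteq> K j"
      unfolding K_def by (rule ball_edges_mono[OF zV cV]) (use that anchor[of j] in \<open>auto simp: \<rho>_def\<close>)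
    finally show ?thesis by auto
  qed
  have G_pred: "Measurable.pred (PiM K' (\<lambda>_. N)) (G j)" if "K j - B j \<subseteq> K'" for j K'
    unfolding G_def
  proof (intro pred_intros_finite(3) pred_intros_logic(3))
    fix n assume n: "n \<in> {1..j}"
    show "Measurable.pred (PiM K' (\<lambda>_. N)) (good (c (k j - L)) (B j) T \<epsilon> n)"
      by (rule pred_good[OF cV]) (use GK[OF _ _ _ n] that in blast)
    show "Measurable.pred (PiM K' (\<lambda>_. N)) (good (c (k j + L)) (B j) T \<epsilon> n)"
      by (rule pred_good[OF cV]) (use GK[OF _ _ _ n] that in blast)
  qed simp
  have G_local: "G j \<omega> = G j \<omega>'" if "\<And>e. e \<in> K j - B j \<Longrightarrow> \<omega> e = \<omega>' e" for j \<omega> \<omega>'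
  proof -
    have "good z (B j) T \<epsilon> n \<omega> = good z (B j) T \<epsilon> n \<omega>'"
      if "n \<in> {1..j}" "z = c (k j - L) \<or> z = c (k j + L)" for n z
      by (rule good_local[where K = "K j - B j"]) (use GK that \<open>\<And>e. e \<in> K j - B j \<Longrightarrow> \<omega> e = \<omega>' e\<close> in blast)+
    then show ?thesis unfolding G_def by blast
  qed
  have block_pred: "Measurable.pred (PiM K' (\<lambda>_. N)) (block c (k j) L R a b M)" if "B j \<subseteq> K'" for j K'
    by (rule pred_block[OF cV]) (use that in \<open>simp add: B_def\<close>)
  have block_loc: "block c (k j) L R a b M \<omega> = block c (k j) L R a b M \<omega>'" if "\<And>e. e \<in> B j \<Longrightarrow> \<omega> e = \<omega>' e" for j \<omega> \<omega>'
    by (rule block_local) (use that in \<open>simp add: B_def\<close>)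
  define q where "q = min (measure N {0..a}) (measure N {b..M})"
  have q: "q \<le> 1" "0 < q" "q \<le> measure N {0..a}" "q \<le> measure N {b..M}"
    using levels N.prob_le_1[of "{0..a}"] unfolding q_def by (auto simp: min_def)
  define p where "p = q ^ ((Suc \<Delta> ^ R) ^ 2) * (1 / 2)"
  have p: "0 < p" using q by (simp add: p_def)
  have G_prob: "1 / 2 \<le> measure \<Omega> {\<omega> \<in> space \<Omega>. G j \<omega>}" for j
  proof -
    define bad where "bad z n = {\<omega> \<in> space \<Omega>. \<not> good z (B j) T \<epsilon> n \<omega>}" for z n
    have bad: "bad z n \<in> sets \<Omega>" if "z \<in> V" for z n
      unfolding bad_def using pred_intros_logic(2)[OF pred_good'[OF that, of "B j" T \<epsilon> n]] by (simp add: pred_def)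
    have bad_le: "measure \<Omega> (bad z n) \<le> (1 / 8) ^ n" if "z \<in> V" for z n
      unfolding bad_def by (rule prob_not_good[OF that m int small])
    have sets: "{\<omega> \<in> space \<Omega>. G j \<omega>} \<in> sets \<Omega>" using G_pred[of j E] KE by (auto simp: pred_def)
    have "measure \<Omega> (space \<Omega> - {\<omega> \<in> space \<Omega>. G j \<omega>}) \<le> measure \<Omega> (\<Union>n\<in>{1..j}. bad (c (k j - L)) n \<union> bad (c (k j + L)) n)"
      by (rule \<Omega>.P.finite_measure_mono) (use bad cV in \<open>auto simp: G_def bad_def[abs_def]\<close>)
    also have "\<dots> \<le> (\<Sum>n\<in>{1..j}. measure \<Omega> (bad (c (k j - L)) n \<union> bad (c (k j + L)) n))"
      by (rule \<Omega>.P.finite_measure_subadditive_finite) (use bad cV in auto)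
    also have "\<dots> \<le> (\<Sum>n\<in>{1..j}. 2 * (1 / 8) ^ n)"
    proof (rule sum_mono)
      fix n
      have "measure \<Omega> (bad (c (k j - L)) n \<union> bad (c (k j + L)) n) \<le> measure \<Omega> (bad (c (k j - L)) n) + measure \<Omega> (bad (c (k j + L)) n)"
        by (rule measure_Un_le) (use bad cV in auto)
      then show "measure \<Omega> (bad (c (k j - L)) n \<union> bad (c (k j + L)) n) \<le> 2 * (1 / 8) ^ n"
        using bad_le[OF cV[of "k j - L"], of n] bad_le[OF cV[of "k j + L"], of n] by linarith
    qed
    also have "\<dots> = 2 * ((1 - (1 / 8) ^ j) / 7)" unfolding sum_distrib_left[symmetric] sum_eighth ..
    \<comment> \<open>The rate 1/8 leaves a failure probability of at most 2/7 at the two ends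
      together, less than 1/2.\<close>
    also have "\<dots> \<le> 2 * (1 / 7)" by simp
    finally show ?thesis using \<Omega>.P.prob_compl[OF sets] by simp
  qed
  have A_prob: "p \<le> measure \<Omega> {\<omega> \<in> space \<Omega>. A j \<omega>}" for j
  proof -
    let ?P = "\<lambda>i. if i = (0 :: nat) then block c (k j) L R a b M else G j"
    let ?K = "\<lambda>i. if i = (0 :: nat) then B j else K j - B j"
    \<comment> \<open>The block reads only \<open>B j\<close>, and goodness only
      \<open>K j - B j\<close>.\<close>
    have "\<Omega>.P.indep_events (\<lambda>i. {\<omega> \<in> space \<Omega>. ?P i \<omega>}) {0, 1}"
    proof (rule indep_local)
      show "disjoint_family_on ?K {0, 1}" by (auto simp: disjoint_family_on_def)
      show "?K i \<subseteq> E" for i using BK[of j] KE[of j] by auto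
      show "Measurable.pred (PiM (?K i) (\<lambda>_. N)) (?P i)" for i
        using block_pred[of j "B j"] G_pred[of j "K j - B j"] by auto
      show "?P i \<omega> = ?P i \<omega>'" if "\<And>e. e \<in> ?K i \<Longrightarrow> \<omega> e = \<omega>' e" for i \<omega> \<omega>'
        using block_loc[of j \<omega> \<omega>'] G_local[of j \<omega> \<omega>'] that by (cases "i = 0") auto
    qed
    then have "measure \<Omega> (\<Inter>i\<in>{0, 1}. {\<omega> \<in> space \<Omega>. ?P i \<omega>}) = (\<Prod>i\<in>{0, 1}. measure \<Omega> {\<omega> \<in> space \<Omega>. ?P i \<omega>})"
      unfolding \<Omega>.P.indep_events_def by (elim conjE allE[of _ "{0, 1}"]) auto
    moreover have "(\<Inter>i\<in>{0, 1}. {\<omega> \<in> space \<Omega>. ?P i \<omega>}) = {\<omega> \<in> space \<Omega>. A j \<omega>}"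
      unfolding A_def by auto
    ultimately have eq: "measure \<Omega> {\<omega> \<in> space \<Omega>. A j \<omega>} =
       measure \<Omega> {\<omega> \<in> space \<Omega>. block c (k j) L R a b M \<omega>} * measure \<Omega> {\<omega> \<in> space \<Omega>. G j \<omega>}" by simp
    have "q ^ ((Suc \<Delta> ^ R) ^ 2) \<le> measure \<Omega> {\<omega> \<in> space \<Omega>. block c (k j) L R a b M \<omega>}"
      by (rule prob_block[OF cV]) (use q b0 in auto)
    then show ?thesis unfolding p_def eq by (rule mult_mono[OF _ G_prob]) (use q in auto)
  qed
  have "\<Omega>.P.indep_events (\<lambda>j. {\<omega> \<in> space \<Omega>. A j \<omega>}) UNIV"
  proof (rule indep_local)
    show "disjoint_family_on K UNIV"
      unfolding disjoint_family_on_def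
    proof (intro ballI impI)
      have "K i \<inter> K j = {}" if "i < j" for i j
      proof (rule ccontr)
        assume "K i \<inter> K j \<noteq> {}"
        then obtain e where e: "e \<in> K i" "e \<in> K j" by auto
        then obtain x where "x \<in> e" using edge_pair[of e] KE by blast
        then have x: "x \<in> V" "gd (c (k i)) x \<le> \<rho> i" "gd (c (k j)) x \<le> \<rho> j"
          using e unfolding K_def ball_edges_def gball_def by auto
        have "gd (c (k i)) (c (k j)) \<le> gd (c (k i)) x + gd x (c (k j))" by (rule gd_tri) (use x cV in auto)
        moreover have "gd (c (k i)) (c (k j)) = k j - k i" using gap[OF that] by (intro geodesic_ray_gd[OF c]) simp
        ultimately show False using x gap[OF that] gd_sym[OF x(1) cV[of "k j"]] by linarith
      qed
      then show "K i \<inter> K j = {}" if "i \<noteq> j" for i j using that by (metis inf_commute linorder_neqE_nat)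
    qed
    show "Measurable.pred (PiM (K j) (\<lambda>_. N)) (A j)" for j
      unfolding A_def by (intro pred_intros_logic(3) block_pred G_pred BK) auto
    show "A j \<omega> = A j \<omega>'" if "\<And>e. e \<in> K j \<Longrightarrow> \<omega> e = \<omega>' e" for j \<omega> \<omega>'
      using block_loc[of j \<omega> \<omega>'] G_local[of j \<omega> \<omega>'] that BK[of j] unfolding A_def by blast
  qed (use KE in auto)
  then have inf: "AE \<omega> in \<Omega>. infinite {j. A j \<omega>}"
    by (rule \<Omega>.P.AE_infinite_of_indep_events[OF _ A_prob p])
  have "AE \<omega> in \<Omega>. infinite {k. bottleneck c W k \<omega>}"
    using AE_positive inf AE_eventually_good[OF cV m int small, of "\<lambda>j. k j - L" B]
      AE_eventually_good[OF cV m int small, of "\<lambda>j. k j + L" B]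
  proof eventually_elim
    case (elim \<omega>)
    obtain N1 where N1: "\<And>n j. N1 \<le> n \<Longrightarrow> j < n \<Longrightarrow> good (c (k j - L)) (B j) T \<epsilon> n \<omega>" using elim(3) by blast
    obtain N2 where N2: "\<And>n j. N2 \<le> n \<Longrightarrow> j < n \<Longrightarrow> good (c (k j + L)) (B j) T \<epsilon> n \<omega>" using elim(4) by blast
    \<comment> \<open>For these \<open>j\<close>, the event \<open>A j\<close> covers the scales up
      to \<open>j\<close>, and Borel-Cantelli the scales above \<open>j\<close>, which exceed
      \<open>N1\<close> and \<open>N2\<close>.\<close>
    define J where "J = {j. A j \<omega>} - {..<max N1 N2}"
    have "infinite J" unfolding J_def using elim(2) by (rule Diff_infinite_finite[rotated]) simp
    moreover have "inj_on k J"
    proof (rule inj_onI)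
      fix i j assume "k i = k j"
      then show "i = j" using gap[of i j] gap[of j i] by (cases i j rule: linorder_cases) auto
    qed
    ultimately have "infinite (k ` J)" by (simp add: finite_image_iff)
    moreover have "k ` J \<subseteq> {k. bottleneck c W k \<omega>}"
    proof safe
      fix j assume j: "j \<in> J"
      then have A: "block c (k j) L R a b M \<omega>" "G j \<omega>" "N1 \<le> j" "N2 \<le> j" unfolding J_def A_def by auto
      have "good (c (k j - L)) (ball_edges (c (k j)) R) T \<epsilon> n \<omega>"
         "good (c (k j + L)) (ball_edges (c (k j)) R) T \<epsilon> n \<omega>" if "1 \<le> n" for n
        using A(2-4) that N1[of n j] N2[of n j] unfolding G_def B_def by (cases "n \<le> j"; auto)+
      then show "bottleneck c W (k j) \<omega>"
        by (intro bottleneckI[OF c elim(1) kL ab \<epsilon> T C r D L R W A(1)]) auto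
    qed
    ultimately show ?case using finite_subset by blast
  qed
  then show ?thesis by blast
qed

theorem AE_unique_geodesic_ray:
  assumes w: "w \<in> V" and v: "v \<in> V" and \<xi>: "\<xi> \<in> gromov_boundary V E w"
  shows "AE \<omega> in \<Omega>. \<exists>!x. fpp_geodesic_ray E \<omega> x \<and> x 0 = v \<and> has_direction V E w x \<xi>"
proof -
  obtain c where c: "geodesic_ray c" "c 0 = v" "c \<in> \<xi>" using geodesic_ray_ex[OF v w \<xi>] by blast
  obtain W where W: "AE \<omega> in \<Omega>. infinite {k. bottleneck c W k \<omega>}" using exists_bottlenecks[OF c(1)] by blast
  obtain m T \<epsilon> where m: "1 \<le> m" and T: "0 < T" and \<epsilon>: "0 < \<epsilon>"
    and int: "(\<integral>\<^sup>+ x. ennreal (exp (penalty T \<epsilon> x)) \<partial>N) \<le> ennreal m"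
    and small: "(real (Suc \<Delta>))\<^sup>2 * (m * exp (- T)) \<le> 1 / 8"
    using exists_moment_bound[of 1] by auto
  have "AE \<omega> in \<Omega>. \<exists>n0. \<forall>n\<ge>n0. \<forall>j<n. good a {} T \<epsilon> n \<omega>" if "a \<in> V" for a
    by (rule AE_eventually_good[where z = "\<lambda>_. a" and B = "\<lambda>_. {}", OF that m int small])
  then have "AE \<omega> in \<Omega>. \<forall>a\<in>V. \<exists>n0. \<forall>n\<ge>n0. \<forall>j<n. good a {} T \<epsilon> n \<omega>"
    using countable_V by (simp add: AE_ball_countable)
  then show ?thesis
    using W AE_positive AE_generic
  proof eventually_elim
    case (elim \<omega>)
    have "\<exists>!p. fpp_geodesic E \<omega> y y' p" if y: "y \<in> V" "y' \<in> V" for y y'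
    proof -
      obtain n0 where n0: "\<And>n j. n0 \<le> n \<Longrightarrow> j < n \<Longrightarrow> good y {} T \<epsilon> n \<omega>" using elim(1) y(1) by blast
      \<comment> \<open>The sequence of centres is constant, so index 0 serves;
        \<open>Suc n0\<close> ensures \<open>0 < n\<close>.\<close>
      have good: "good y {} T \<epsilon> n \<omega>" if "Suc n0 \<le> n" for n using n0[of n 0] that by simp
      show ?thesis
        by (rule fpp_geodesic_ex1[OF elim(3) y T \<epsilon> good]) (use elim(4) y in blast)+
    qed
    from unique_ray[OF c(1) elim(3) this elim(2) w \<xi> c(3)] show ?case unfolding c(2) .
  qed
qed

end

section \<open>Cayley graphs of finitely generated groups\<close>

context group
begin

text \<open>Symmetry of \<open>S\<close> handles an unordered edge recorded from its other endpoint,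
  where the generator is inverted.\<close>

lemma cayley_neighbours:
  assumes S: "S \<subseteq> carrier G" "\<forall>s\<in>S. inv s \<in> S" and x: "x \<in> carrier G"
  shows "{y. {x, y} \<in> cayley_edges G S} \<subseteq> (\<lambda>s. x \<otimes> s) ` S"
proof
  fix y assume "y \<in> {y. {x, y} \<in> cayley_edges G S}"
  then obtain g h where gh: "{x, y} = {g, h}" "g \<in> carrier G" "h \<in> carrier G" "inv g \<otimes> h \<in> S"
    unfolding cayley_edges_def by auto
  consider "x = g" "y = h" | "x = h" "y = g" using gh(1) by (auto simp: doubleton_eq_iff)
  then show "y \<in> (\<lambda>s. x \<otimes> s) ` S"
  proof cases
    case 1
    then have "y = x \<otimes> (inv g \<otimes> h)" using gh by (simp add: m_assoc[symmetric])
    then show ?thesis using gh(4) by blast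
  next
    case 2
    have "inv (inv g \<otimes> h) \<in> S" using S(2) gh(4) by blast
    moreover have "y = x \<otimes> inv (inv g \<otimes> h)" using 2 gh by (simp add: inv_mult_group m_assoc[symmetric])
    ultimately show ?thesis by blast
  qed
qed

text \<open>Letters act by right multiplication, one edge each; generalising over \<open>x\<close>
  lets the paths for two factors be concatenated.\<close>

lemma cayley_path:
  assumes S: "S \<subseteq> carrier G" "\<forall>s\<in>S. inv s \<in> S"
  shows "g \<in> generate G S \<Longrightarrow> x \<in> carrier G \<Longrightarrow> \<exists>p. edge_path (cayley_edges G S) x (x \<otimes> g) p"
proof (induction g arbitrary: x rule: generate.induct)
  case one
  then show ?case by (intro exI[of _ "[x]"]) simp
next
  case (incl s)
  then have "{x, x \<otimes> s} \<in> cayley_edges G S"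
    unfolding cayley_edges_def
    by (intro CollectI exI[of _ x] exI[of _ "x \<otimes> s"]) (use S in \<open>auto simp: m_assoc[symmetric]\<close>)
  then show ?case by (intro exI[of _ "[x, x \<otimes> s]"]) simp
next
  case (inv s)
  then have "inv s \<in> S" "s \<in> carrier G" using S by auto
  then have "{x, x \<otimes> inv s} \<in> cayley_edges G S"
    unfolding cayley_edges_def
    by (intro CollectI exI[of _ x] exI[of _ "x \<otimes> inv s"]) (use inv in \<open>auto simp: m_assoc[symmetric]\<close>)
  then show ?case by (intro exI[of _ "[x, x \<otimes> inv s]"]) simp
next
  case (eng g h)
  have gh: "g \<in> carrier G" "h \<in> carrier G" using eng generate_in_carrier[OF S(1)] by auto
  obtain p q where "edge_path (cayley_edges G S) x (x \<otimes> g) p" "edge_path (cayley_edges G S) (x \<otimes> g) (x \<otimes> g \<otimes> h) q"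
    using eng gh by (meson m_closed)
  from edge_path_append[OF this] show ?case using gh eng.prems by (auto simp: m_assoc)
qed

lemma cayley_bounded_graph:
  assumes S: "S \<subseteq> carrier G" "finite S" "\<forall>s\<in>S. inv s \<in> S" "generate G S = carrier G"
  shows "bounded_graph (carrier G) (cayley_edges G S) (card S)"
proof
  fix x y assume "{x, y} \<in> cayley_edges G S"
  then show "x \<in> carrier G \<and> y \<in> carrier G" unfolding cayley_edges_def by (auto simp: doubleton_eq_iff)
next
  fix e assume "e \<in> cayley_edges G S"
  then show "\<exists>x y. e = {x, y}" unfolding cayley_edges_def by blast
next
  fix x assume x: "x \<in> carrier G"
  show "finite {y. {x, y} \<in> cayley_edges G S} \<and> card {y. {x, y} \<in> cayley_edges G S} \<le> card S"
    using cayley_neighbours[OF S(1,3) x] S(2) by (meson finite_imageI finite_subset surj_card_le)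
next
  fix x y assume xy: "x \<in> carrier G" "y \<in> carrier G"
  then obtain p where "edge_path (cayley_edges G S) x (x \<otimes> (inv x \<otimes> y)) p"
    using cayley_path[OF S(1,3), of "inv x \<otimes> y" x] S(4) by auto
  then show "\<exists>p. edge_path (cayley_edges G S) x y p" using xy by (auto simp: m_assoc[symmetric])
qed

end

section \<open>From the given weight law to the locale assumptions\<close>

lemma measure_support_null:
  fixes M :: "'a :: second_countable_topology measure"
  assumes "sets M = sets borel" "open U" "U \<inter> measure_support M = {}"
  shows "emeasure M U = 0"
proof -
  define F where "F = {B. open B \<and> emeasure M B = 0}"
  obtain F' where F': "F' \<subseteq> F" "countable F'" "\<Union>F' = \<Union>F"
    using Lindelof[of F] unfolding F_def by auto
  have "\<Union>F' \<in> null_sets M"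
    by (rule null_sets_UN'[where N = "\<lambda>x. x", simplified, OF F'(2)])
      (use F'(1) assms(1) in \<open>auto simp: F_def null_sets_def\<close>)
  moreover have "U \<subseteq> \<Union>F'"
    \<comment> \<open>Points outside the support have null open neighbourhoods; the Lindelof
      property reduces these to countably many.\<close>
    unfolding F'(3)
  proof
    fix x assume "x \<in> U"
    then have "x \<notin> measure_support M" using assms(3) by auto
    then show "x \<in> \<Union>F" unfolding measure_support_def F_def by (auto simp: not_less)
  qed
  moreover have "U \<in> sets M" using assms by simp
  ultimately show ?thesis using null_sets_subset by (auto simp: null_sets_def)
qed

lemma fpp_weights:
  assumes \<rho>: "prob_space \<rho>" and sets: "sets \<rho> = sets borel" and supp: "measure_support \<rho> \<subseteq> {0..}"
    and atomless: "\<forall>t. emeasure \<rho> {t} = 0"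
    and moment: "\<exists>a>0. (\<integral>\<^sup>+ t. ennreal (exp (a * t\<^sup>2)) \<partial>\<rho>) < \<infinity>"
  defines "N \<equiv> restrict_space \<rho> {0..}"
  shows "prob_space N" "sets N = sets (restrict_space borel {0..})" "\<And>t. emeasure N {t} = 0"
    "(\<integral>\<^sup>+ x. ennreal (exp x) \<partial>N) < \<infinity>"
proof -
  interpret \<rho>: prob_space \<rho> by fact
  have sp: "space \<rho> = UNIV" using sets_eq_imp_space_eq[OF sets] by simp
  have m: "{0..} \<inter> space \<rho> \<in> sets \<rho>" by (simp add: sp sets)
  have "emeasure \<rho> {..<0} = 0" by (rule measure_support_null[OF sets]) (use supp in auto)
  moreover have "space \<rho> - {..<0} = {0..}" by (auto simp: sp)
  ultimately have "emeasure \<rho> {0..} = 1"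
    using emeasure_compl[of "{..<0}" \<rho>] sets \<rho>.emeasure_space_1 by simp
  then show "prob_space N" unfolding N_def by (intro prob_space_restrict_space) (auto simp: sets)
  show "sets N = sets (restrict_space borel {0..})"
    unfolding N_def by (rule sets_restrict_space_cong[OF sets])
  show "emeasure N {t} = 0" for t
  proof (cases "{t} \<in> sets N")
    case True
    then have "{t} \<subseteq> {0..}" using sets.sets_into_space[OF True] by (auto simp: N_def space_restrict_space)
    then show ?thesis unfolding N_def using m atomless by (subst emeasure_restrict_space) auto
  qed (rule emeasure_notin_sets)
  obtain a where a: "0 < a" "(\<integral>\<^sup>+ t. ennreal (exp (a * t\<^sup>2)) \<partial>\<rho>) < \<infinity>" using moment by auto
  \<comment> \<open>Completing the square trades the Gaussian moment for the moment of
    \<open>exp x\<close>.\<close>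
  have le: "x \<le> 1 / (4 * a) + a * x\<^sup>2" for x
  proof -
    have "0 \<le> a * (x - 1 / (2 * a))\<^sup>2" using a by simp
    also have "\<dots> = 1 / (4 * a) + a * x\<^sup>2 - x" using a(1) by (simp add: power2_eq_square field_simps)
    finally show ?thesis by simp
  qed
  have "(\<integral>\<^sup>+ x. ennreal (exp x) \<partial>N) = (\<integral>\<^sup>+ x. ennreal (exp x) * indicator {0..} x \<partial>\<rho>)"
    unfolding N_def by (rule nn_integral_restrict_space[OF m])
  also have "\<dots> \<le> (\<integral>\<^sup>+ x. ennreal (exp (1 / (4 * a))) * ennreal (exp (a * x\<^sup>2)) \<partial>\<rho>)"
  proof (rule nn_integral_mono)
    fix x :: real
    have "ennreal (exp x) \<le> ennreal (exp (1 / (4 * a))) * ennreal (exp (a * x\<^sup>2))"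
      using le[of x] by (simp flip: ennreal_mult' exp_add)
    then show "ennreal (exp x) * indicator {0..} x \<le> ennreal (exp (1 / (4 * a))) * ennreal (exp (a * x\<^sup>2))"
      by (auto simp: indicator_def)
  qed
  also have "\<dots> = ennreal (exp (1 / (4 * a))) * (\<integral>\<^sup>+ x. ennreal (exp (a * x\<^sup>2)) \<partial>\<rho>)"
  proof (rule nn_integral_cmult)
    show "(\<lambda>x. ennreal (exp (a * x\<^sup>2))) \<in> borel_measurable \<rho>"
      unfolding measurable_cong_sets[OF sets refl] by measurable
  qed
  also have "\<dots> < \<infinity>" using a(2) by (simp add: ennreal_mult_less_top)
  finally show "(\<integral>\<^sup>+ x. ennreal (exp x) \<partial>N) < \<infinity>" .
qed

theorem lemma7p8:
  fixes G :: "('a, 'b) monoid_scheme" and S :: "'a set" and \<rho> :: "real measure"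
    and \<xi> :: "(nat \<Rightarrow> 'a) set" and v :: 'a
  assumes "group G"
    and "S \<subseteq> carrier G" and "finite S" and "\<forall>s\<in>S. inv\<^bsub>G\<^esub> s \<in> S"
    and "generate G S = carrier G"
    and "gromov_hyperbolic (carrier G) (cayley_edges G S)"
    and "prob_space \<rho>" and "sets \<rho> = sets borel"
    and "measure_support \<rho> \<subseteq> {0..}"
    and "\<forall>t. emeasure \<rho> {t} = 0"
    and "\<exists>a>0. (\<integral>\<^sup>+ t. ennreal (exp (a * t\<^sup>2)) \<partial>\<rho>) < \<infinity>"
    and "\<xi> \<in> gromov_boundary (carrier G) (cayley_edges G S) \<one>\<^bsub>G\<^esub>"
    and "v \<in> carrier G"
  shows "AE \<omega> in fpp_measure \<rho> (cayley_edges G S).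
    \<exists>!x :: nat \<Rightarrow> 'a. fpp_geodesic_ray (cayley_edges G S) \<omega> x \<and> x 0 = v \<and>
      has_direction (carrier G) (cayley_edges G S) \<one>\<^bsub>G\<^esub> x \<xi>"
proof -
  interpret G: group G by fact
  interpret bounded_graph "carrier G" "cayley_edges G S" "card S"
    by (rule G.cayley_bounded_graph[OF assms(2-5)])
  obtain \<delta> where \<delta>: "\<delta> \<ge> 0"
    "\<forall>w\<in>carrier G. \<forall>x\<in>carrier G. \<forall>y\<in>carrier G. \<forall>z\<in>carrier G.
       gromov_product (cayley_edges G S) w x z \<ge>
         min (gromov_product (cayley_edges G S) w x y) (gromov_product (cayley_edges G S) w y z) - \<delta>"
    using assms(6) unfolding gromov_hyperbolic_def by (elim exE conjE) (rule that)
  note N = fpp_weights[OF assms(7-11)]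
  interpret prob_space "restrict_space \<rho> {0..}" by (rule N(1))
  interpret hyperbolic_fpp "carrier G" "cayley_edges G S" "card S" \<delta> "restrict_space \<rho> {0..}"
  proof unfold_locales
    fix w x y z assume "w \<in> carrier G" "x \<in> carrier G" "y \<in> carrier G" "z \<in> carrier G"
    with \<delta>(2) show "min (gromov_product (cayley_edges G S) w x y) (gromov_product (cayley_edges G S) w y z) - \<delta>
      \<le> gromov_product (cayley_edges G S) w x z" by simp
  qed (rule \<delta>(1) N)+
  show ?thesis
    unfolding fpp_measure_def using AE_unique_geodesic_ray[OF G.one_closed assms(13,12)] .
qed

end
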